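(* Let $\alpha$ be a continuous rotationally symmetric norm on $L^\infty(\mathbb T)$ and let $M$ be a closed (i.e., $\alpha$-closed) linear subspace of $H^\alpha(\mathbb T)$. Then $zM\subseteq M$ if and only if $M=\varphi H^\alpha(\mathbb T)$ for some inner function $\varphi$.
   Context: $\mathbb T$ is the unit circle and $m$ is normalized arc length (Haar measure) on $\mathbb T$; functions equal a.e. are identified. For $w\in\mathbb T$, $f_w(z)=f(\overline wz)$. A continuous rotationally symmetric norm is a norm $\alpha$ on $L^\infty(\mathbb T)$ with $\alpha(1)=1$, $\alpha(|f|)=\alpha(f)$, $\alpha(f_w)=\alpha(f)$ for all $f\in L^\infty(\mathbb T)$, $w\in\mathbb T$, and $\lim_{m(E)\to0^+}\alpha(\chi_E)=0$. For any measurable $f:\mathbb T\to\mathbb C$ put $\alpha(f)=\sup\{\alpha(s):s\text{ a simple function},\ |s|\le|f|\}$. $\mathcal L^\alpha(\mathbb T)$ is the set of measurable $f$ with $\alpha(f)<\infty$, and $L^\alpha(\mathbb T)$ is the $\alpha$-closure of $L^\infty(\mathbb T)$ in $\mathcal L^\alpha(\mathbb T)$. $H^\alpha(\mathbb T)$ is the $\alpha$-closed linear span of $\{1,z,z^2,\ldots\}$ in $L^\alpha(\mathbb T)$. $H^\infty(\mathbb T)$ is the set of $f\in L^\infty(\mathbb T)$ whose Fourier coefficients $\int_{\mathbb T}f(z)z^{-n}\,dm(z)$ vanish for all $n<0$. An inner function is a member of $H^\infty(\mathbb T)$ that is unimodular a.e. on $\mathbb T$.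
   Formalization: The subspace M is assumed to be nonzero: for M = {0} the statement fails, since zM ⊆ M holds but φH^α(𝕋) contains the nonzero function φ for every inner function φ. *)

theory Defs
  imports "HOL-Analysis.Analysis" "HOL-Library.Function_Algebras"
begin

text \<open>
  Elements of the function spaces are represented by functions, not by equivalence classes.
  Every space below is therefore saturated with respect to equality almost everywhere, and
  values off the unit circle are irrelevant. In particular a nonzero element of a subspace is
  one that does not vanish almost everywhere.
\<close>

definition circle :: "complex measure" where
  "circle = distr (uniform_measure lborel {0..<2 * pi}) (restrict_space borel (sphere 0 1)) cis"

global_interpretation cfun: vector_space "\<lambda>(c::complex) (f::complex \<Rightarrow> complex) z. c * f z"
  by standard (auto simp: fun_eq_iff algebra_simps)

definition Linf :: "(complex \<Rightarrow> complex) set" where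
  "Linf = {f \<in> borel_measurable circle. \<exists>C. AE z in circle. norm (f z) \<le> C}"

text \<open>
  The first three assumptions say that \<open>\<alpha>\<close> is a norm on the space of a.e. classes: by
  definiteness and the triangle inequality, \<open>\<alpha>\<close> is nonnegative and respects equality
  almost everywhere.
\<close>

locale continuous_rotationally_symmetric_norm =
  fixes \<alpha> :: "(complex \<Rightarrow> complex) \<Rightarrow> real"
  assumes definite: "f \<in> Linf \<Longrightarrow> \<alpha> f = 0 \<longleftrightarrow> (AE z in circle. f z = 0)"
    and scale: "f \<in> Linf \<Longrightarrow> \<alpha> (\<lambda>z. c * f z) = norm c * \<alpha> f"
    and triangle: "f \<in> Linf \<Longrightarrow> g \<in> Linf \<Longrightarrow> \<alpha> (\<lambda>z. f z + g z) \<le> \<alpha> f + \<alpha> g"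
    and one: "\<alpha> (\<lambda>z. 1) = 1"
    and modulus: "f \<in> Linf \<Longrightarrow> \<alpha> (\<lambda>z. of_real (norm (f z))) = \<alpha> f"
    and rotation: "f \<in> Linf \<Longrightarrow> w \<in> sphere 0 1 \<Longrightarrow> \<alpha> (\<lambda>z. f (cnj w * z)) = \<alpha> f"
    and continuous: "\<epsilon> > 0 \<Longrightarrow>
      \<exists>\<delta>>0. \<forall>E\<in>sets circle. 0 < measure circle E \<and> measure circle E < \<delta> \<longrightarrow> \<alpha> (indicator E) < \<epsilon>"

text \<open>The extension of \<open>\<alpha>\<close> to all measurable functions, with values in \<open>[0,\<infinity>]\<close>.\<close>

definition ext_norm :: "((complex \<Rightarrow> complex) \<Rightarrow> real) \<Rightarrow> (complex \<Rightarrow> complex) \<Rightarrow> ennreal" where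
  "ext_norm \<alpha> f =
    (SUP s\<in>{s. simple_function circle s \<and> (AE z in circle. norm (s z) \<le> norm (f z))}. ennreal (\<alpha> s))"

definition closure_in ::
    "((complex \<Rightarrow> complex) \<Rightarrow> real) \<Rightarrow> (complex \<Rightarrow> complex) set \<Rightarrow> (complex \<Rightarrow> complex) set
      \<Rightarrow> (complex \<Rightarrow> complex) set" where
  "closure_in \<alpha> X S = {f \<in> X. \<forall>\<epsilon>>0. \<exists>g\<in>S. ext_norm \<alpha> (\<lambda>z. f z - g z) < ennreal \<epsilon>}"

definition calL :: "((complex \<Rightarrow> complex) \<Rightarrow> real) \<Rightarrow> (complex \<Rightarrow> complex) set" where
  "calL \<alpha> = {f \<in> borel_measurable circle. ext_norm \<alpha> f < \<infinity>}"

definition L_space :: "((complex \<Rightarrow> complex) \<Rightarrow> real) \<Rightarrow> (complex \<Rightarrow> complex) set" where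
  "L_space \<alpha> = closure_in \<alpha> (calL \<alpha>) Linf"

definition H_space :: "((complex \<Rightarrow> complex) \<Rightarrow> real) \<Rightarrow> (complex \<Rightarrow> complex) set" where
  "H_space \<alpha> = closure_in \<alpha> (L_space \<alpha>) (cfun.span (range (\<lambda>(n::nat) z. z ^ n)))"

definition Hinf :: "(complex \<Rightarrow> complex) set" where
  "Hinf = {f \<in> Linf. \<forall>n::int. n < 0 \<longrightarrow> (LINT z|circle. f z * z powi (- n)) = 0}"

definition inner_function :: "(complex \<Rightarrow> complex) \<Rightarrow> bool" where
  "inner_function \<phi> \<longleftrightarrow> \<phi> \<in> Hinf \<and> (AE z in circle. norm (\<phi> z) = 1)"

text \<open>The set \<open>\<phi> S\<close>, consisting of all measurable representatives of its elements.\<close>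

definition mult_set :: "(complex \<Rightarrow> complex) \<Rightarrow> (complex \<Rightarrow> complex) set \<Rightarrow> (complex \<Rightarrow> complex) set" where
  "mult_set \<phi> S = {f \<in> borel_measurable circle. \<exists>h\<in>S. AE z in circle. f z = \<phi> z * h z}"

end

theory Submission
  imports Defs "HOL-Probability.Probability_Measure"
begin

text \<open>
  The \<open>L\<^sup>2\<close> argument for Beurling's theorem is run inside \<open>M \<inter> Linf\<close>. Among the bounded elements
  of \<open>M\<close> whose first nonvanishing Fourier coefficient is normalized to \<open>1\<close>, a sequence of minimal
  \<open>L\<^sup>2\<close> norm converges in \<open>L\<^sup>2\<close>; minimality makes the limit orthogonal to \<open>z (M \<inter> Linf)\<close>, so after
  scaling it is a unimodular \<open>\<phi>\<close>, and \<open>cnj \<phi> * f\<close> lies in \<open>Hinf\<close> for every \<open>f \<in> M \<inter> Linf\<close>.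

  To pass between \<open>L\<^sup>2\<close> and \<open>\<alpha>\<close>, elements of \<open>M\<close> are multiplied by outer functions
  \<open>g = exp (- F)\<close> with \<open>Re F = u \<ge> 0\<close> in \<open>L\<^sup>2\<close>. Such \<open>g\<close> are bounded pointwise limits of polynomials
  (exponentials of Fejer means), hence preserve \<open>M\<close> because \<open>\<alpha>\<close> is continuous, and they tend to
  \<open>1\<close> when \<open>u\<close> tends to \<open>0\<close> in \<open>L\<^sup>2\<close>. With \<open>u = sqrt \<bar>f\<bar> / n\<close> this shows that \<open>M \<inter> Linf\<close> is dense in
  \<open>M\<close>; with \<open>u = max 0 (\<bar>f\<bar> - 1)\<close> it turns \<open>L\<^sup>2\<close> approximants of \<open>\<phi>\<close> into bounded ones, so \<open>\<phi> \<in> M\<close>.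
  Rotational symmetry enters only through \<open>\<bar>\<integral> f\<bar> \<le> \<alpha> f\<close>.
\<close>

section \<open>Square-integrable functions\<close>

text \<open>In general \<open>\<alpha>\<close> dominates only the L^1 norm and is dominated only by
  the sup norm: an L^p norm is a possible \<open>\<alpha>\<close> for \<open>p\<close> on either
  side of 2, so \<open>H_space \<alpha>\<close> and the L^2 Hardy space need not contain one
  another. Bounded functions are the common ground, and the usable limit theorem for
  \<open>\<alpha>\<close> is dominated convergence against a fixed element of
  \<open>L_space \<alpha>\<close>. This is why the multipliers must be uniformly bounded limits of
  polynomials. For \<open>f\<close> in \<open>M\<close> only integrability of the modulus is known;
  its square root is what lies in L^2, and \<open>exp (- c * sqrt x) * x\<close> is still bounded in
  \<open>x\<close>. No function theory in the disc is needed: an outer function appears only through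
  boundary values, as the exponential of an L^2 function with one-sided Fourier series. Control of
  integrals by \<open>\<alpha>\<close> makes Fourier coefficients continuous, so elements of
  \<open>H_space \<alpha>\<close> have no negative frequencies. The zero subspace is closed and
  invariant under \<open>z\<close>, but \<open>mult_set \<phi> (H_space \<alpha>)\<close> contains
  the unimodular \<open>\<phi>\<close>; this is why \<open>M\<close> is assumed nonzero.\<close>

definition L2 :: "'a measure \<Rightarrow> ('a \<Rightarrow> complex) set" where
  "L2 M = {f \<in> borel_measurable M. integrable M (\<lambda>x. (norm (f x))\<^sup>2)}"

definition sqn :: "'a measure \<Rightarrow> ('a \<Rightarrow> complex) \<Rightarrow> real" where
  "sqn M f = (LINT x|M. (norm (f x))\<^sup>2)"

lemma L2_measurable [measurable_dest]: "f \<in> L2 M \<Longrightarrow> f \<in> borel_measurable M"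
  by (simp add: L2_def)

lemma L2_integrable_sq: "f \<in> L2 M \<Longrightarrow> integrable M (\<lambda>x. (norm (f x))\<^sup>2)"
  by (simp add: L2_def)

lemma sqn_nonneg [simp]: "0 \<le> sqn M f"
  by (simp add: sqn_def)

lemma norm_add_sq_le: "(norm (a + b :: complex))\<^sup>2 \<le> 2 * (norm a)\<^sup>2 + 2 * (norm b)\<^sup>2"
proof -
  have "(norm (a + b))\<^sup>2 \<le> (norm a + norm b)\<^sup>2"
    by (simp add: norm_triangle_ineq power_mono)
  also have "\<dots> \<le> 2 * (norm a)\<^sup>2 + 2 * (norm b)\<^sup>2"
    using sum_squares_bound[of "norm a" "norm b"] by (simp add: power2_sum)
  finally show ?thesis .
qed

lemma L2I_bound:
  assumes "f \<in> borel_measurable M" "integrable M g" "AE x in M. (norm (f x))\<^sup>2 \<le> g x"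
  shows "f \<in> L2 M"
  using assms by (auto simp: L2_def intro!: Bochner_Integration.integrable_bound[of M g] elim!: eventually_mono)

lemma L2_add: "f \<in> L2 M \<Longrightarrow> g \<in> L2 M \<Longrightarrow> (\<lambda>x. f x + g x) \<in> L2 M"
  by (rule L2I_bound[where g = "\<lambda>x. 2 * (norm (f x))\<^sup>2 + 2 * (norm (g x))\<^sup>2"])
     (auto simp: L2_def norm_add_sq_le)

lemma L2_cmult: "f \<in> L2 M \<Longrightarrow> (\<lambda>x. c * f x) \<in> L2 M"
  by (auto simp: L2_def norm_mult power_mult_distrib)

lemma L2_diff: "f \<in> L2 M \<Longrightarrow> g \<in> L2 M \<Longrightarrow> (\<lambda>x. f x - g x) \<in> L2 M"
  using L2_add[of f M "\<lambda>x. (-1) * g x"] L2_cmult[of g M "-1"] by simp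

lemma L2_zero: "(\<lambda>x. 0) \<in> L2 M"
  by (simp add: L2_def)

lemma L2_sum: "(\<And>i. i \<in> I \<Longrightarrow> f i \<in> L2 M) \<Longrightarrow> (\<lambda>x. \<Sum>i\<in>I. f i x) \<in> L2 M"
  by (induction I rule: infinite_finite_induct) (auto simp: L2_zero L2_add)

lemma L2_mult_bounded:
  assumes "f \<in> L2 M" "g \<in> borel_measurable M" "AE x in M. norm (g x) \<le> C"
  shows "(\<lambda>x. g x * f x) \<in> L2 M"
proof (rule L2I_bound[where g = "\<lambda>x. C\<^sup>2 * (norm (f x))\<^sup>2"])
  show "AE x in M. (norm (g x * f x))\<^sup>2 \<le> C\<^sup>2 * (norm (f x))\<^sup>2"
    using assms(3)
    by eventually_elim (simp add: norm_mult power_mult_distrib mult_right_mono power_mono)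
qed (use assms in \<open>auto simp: L2_def\<close>)

lemma sqn_cong_AE:
  "f \<in> borel_measurable M \<Longrightarrow> g \<in> borel_measurable M \<Longrightarrow> AE x in M. norm (f x) = norm (g x) \<Longrightarrow> sqn M f = sqn M g"
  unfolding sqn_def by (rule integral_cong_AE) auto

lemma sqn_mono:
  assumes "f \<in> borel_measurable M" "g \<in> L2 M" "AE x in M. norm (f x) \<le> norm (g x)"
  shows "sqn M f \<le> sqn M g" and "f \<in> L2 M"
proof -
  show f: "f \<in> L2 M"
    using assms
    by (intro L2I_bound[where g = "\<lambda>x. (norm (g x))\<^sup>2"])
       (auto simp: L2_def power_mono elim!: eventually_mono)
  show "sqn M f \<le> sqn M g"
    unfolding sqn_def using f assms
    by (intro integral_mono_AE) (auto simp: L2_def power_mono elim!: eventually_mono)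
qed

lemma sqn_cmult: "sqn M (\<lambda>x. c * f x) = (norm c)\<^sup>2 * sqn M f"
  by (simp add: sqn_def norm_mult power_mult_distrib)

lemma sqn_minus_commute: "sqn M (\<lambda>x. f x - g x) = sqn M (\<lambda>x. g x - f x)"
  by (simp add: sqn_def norm_minus_commute)

lemma borel_measurable_cnj [measurable (raw)]:
  "f \<in> borel_measurable M \<Longrightarrow> (\<lambda>x. cnj (f x)) \<in> borel_measurable M"
  by (rule borel_measurable_continuous_on[of cnj]) (auto intro: continuous_intros)

lemma integrable_mult_cnj:
  assumes "f \<in> L2 M" "g \<in> L2 M"
  shows "integrable M (\<lambda>x. f x * cnj (g x))"
proof (rule Bochner_Integration.integrable_bound[where f = "\<lambda>x. (norm (f x))\<^sup>2 + (norm (g x))\<^sup>2"])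
  have "norm (f x * cnj (g x)) \<le> (norm (f x))\<^sup>2 + (norm (g x))\<^sup>2" for x
  proof -
    have "2 * (norm (f x) * norm (g x)) \<le> (norm (f x))\<^sup>2 + (norm (g x))\<^sup>2"
      using sum_squares_bound[of "norm (f x)" "norm (g x)"] by simp
    moreover have "0 \<le> norm (f x) * norm (g x)" by simp
    ultimately show ?thesis unfolding norm_mult complex_mod_cnj by linarith
  qed
  then show "AE x in M. norm (f x * cnj (g x)) \<le> norm ((norm (f x))\<^sup>2 + (norm (g x))\<^sup>2)"
    by (intro AE_I2) (simp add: order_trans[OF _ abs_ge_self])
qed (use assms in \<open>auto simp: L2_def\<close>)

definition ip :: "'a measure \<Rightarrow> ('a \<Rightarrow> complex) \<Rightarrow> ('a \<Rightarrow> complex) \<Rightarrow> complex" where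
  "ip M f g = (LINT x|M. f x * cnj (g x))"

lemma ip_diff_left: "f \<in> L2 M \<Longrightarrow> g \<in> L2 M \<Longrightarrow> h \<in> L2 M \<Longrightarrow> ip M (\<lambda>x. f x - g x) h = ip M f h - ip M g h"
  by (simp add: ip_def ring_distribs integrable_mult_cnj)

lemma ip_cmult_left: "ip M (\<lambda>x. c * f x) h = c * ip M f h"
  by (simp add: ip_def mult.assoc)

lemma ip_cnj: "cnj (ip M f g) = ip M g f"
  unfolding ip_def Bochner_Integration.integral_cnj[symmetric] by (simp add: mult.commute)

lemma ip_sum_left:
  "(\<And>i. i \<in> I \<Longrightarrow> f i \<in> L2 M) \<Longrightarrow> h \<in> L2 M \<Longrightarrow> ip M (\<lambda>x. \<Sum>i\<in>I. f i x) h = (\<Sum>i\<in>I. ip M (f i) h)"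
  by (simp add: ip_def sum_distrib_right integrable_mult_cnj)

lemma ip_self: "ip M f f = of_real (sqn M f)"
  by (simp add: ip_def sqn_def integral_complex_of_real[symmetric] complex_norm_square
      del: integral_complex_of_real of_real_power)

lemma sqn_add_expand:
  assumes "f \<in> L2 M" "g \<in> L2 M"
  shows "sqn M (\<lambda>x. f x + g x) = sqn M f + 2 * Re (ip M f g) + sqn M g"
proof -
  have eq: "(norm (a + b))\<^sup>2 = (norm a)\<^sup>2 + 2 * Re (a * cnj b) + (norm b)\<^sup>2" for a b :: complex
    unfolding cmod_power2 by (simp add: power2_eq_square algebra_simps)
  show ?thesis
    using assms integrable_mult_cnj[OF assms] unfolding sqn_def ip_def eq
    by (simp add: L2_def integral_Re del: Re_complex_of_real times_complex.sel)
qed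

lemma sqn_parallelogram:
  assumes "f \<in> L2 M" "g \<in> L2 M"
  shows "sqn M (\<lambda>x. f x - g x) = 2 * sqn M f + 2 * sqn M g - sqn M (\<lambda>x. f x + g x)"
proof -
  have "sqn M (\<lambda>x. f x + (-1) * g x) = sqn M f + 2 * Re (ip M f (\<lambda>x. (-1) * g x)) + sqn M (\<lambda>x. (-1) * g x)"
    by (rule sqn_add_expand[OF assms(1) L2_cmult[OF assms(2)]])
  then show ?thesis
    using sqn_add_expand[OF assms] by (simp add: ip_def sqn_def)
qed

text \<open>The square norm of \<open>f - t * I * g\<close> is nonnegative for every real
  \<open>t\<close>, where \<open>I\<close> is the inner product; \<open>t = 1 / sqn M g\<close> is
  the optimal choice.\<close>

lemma ip_Cauchy_Schwarz:
  assumes f: "f \<in> L2 M" and g: "g \<in> L2 M"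
  shows "(norm (ip M f g))\<^sup>2 \<le> sqn M f * sqn M g"
proof -
  define I where "I = ip M f g"
  have I: "(norm I)\<^sup>2 * (2 * t) \<le> sqn M f + t\<^sup>2 * (norm I)\<^sup>2 * sqn M g" for t :: real
  proof -
    let ?c = "- (of_real t * I)"
    have "0 \<le> sqn M (\<lambda>x. f x + ?c * g x)" by simp
    also have "\<dots> = sqn M f + 2 * Re (ip M f (\<lambda>x. ?c * g x)) + sqn M (\<lambda>x. ?c * g x)"
      by (rule sqn_add_expand[OF f L2_cmult[OF g]])
    also have "ip M f (\<lambda>x. ?c * g x) = cnj ?c * I"
      using ip_cmult_left[of M ?c g f] ip_cnj[of M "\<lambda>x. ?c * g x" f] ip_cnj[of M g f]
      unfolding I_def by (metis complex_cnj_mult)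
    also have "Re (cnj ?c * I) = - t * (norm I)\<^sup>2"
      unfolding cmod_power2 by (simp add: power2_eq_square algebra_simps)
    finally show ?thesis
      unfolding sqn_cmult by (simp add: norm_mult power_mult_distrib algebra_simps)
  qed
  show ?thesis
  proof (cases "I = 0")
    case False
    then have pos: "(norm I)\<^sup>2 > 0" by simp
    show ?thesis
    proof (cases "sqn M g = 0")
      \<comment> \<open>With no quadratic term the inequality is linear in \<open>t\<close>. The
        chosen \<open>t\<close> makes its left side \<open>sqn M f + 1\<close>, which is absurd, so
        this case cannot occur.\<close>
      case True
      have "(norm I)\<^sup>2 * (2 * ((sqn M f + 1) / (2 * (norm I)\<^sup>2))) \<le> sqn M f"
        using I[of "(sqn M f + 1) / (2 * (norm I)\<^sup>2)"] True by simp
      then show ?thesis using pos by (simp add: field_simps)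
    next
      case g0: False
      then have gp: "sqn M g > 0" using sqn_nonneg[of M g] by linarith
      have "(norm I)\<^sup>2 * (2 / sqn M g) \<le> sqn M f + (norm I)\<^sup>2 / sqn M g"
        using I[of "1 / sqn M g"] gp by (simp add: power2_eq_square)
      then have "(norm I)\<^sup>2 / sqn M g \<le> sqn M f" by (simp add: algebra_simps)
      then show ?thesis using gp by (simp add: I_def field_simps)
    qed
  qed (auto simp: I_def)
qed

lemma ip_tendsto:
  assumes "\<And>n. f n \<in> L2 M" "f' \<in> L2 M" "(\<lambda>n. sqn M (\<lambda>x. f n x - f' x)) \<longlonglongrightarrow> 0" "g \<in> L2 M"
  shows "(\<lambda>n. ip M (f n) g) \<longlonglongrightarrow> ip M f' g"
proof -
  have "(\<lambda>n. sqrt (sqn M (\<lambda>x. f n x - f' x) * sqn M g)) \<longlonglongrightarrow> sqrt (0 * sqn M g)"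
    by (intro tendsto_intros assms)
  then have lim: "(\<lambda>n. sqrt (sqn M (\<lambda>x. f n x - f' x) * sqn M g)) \<longlonglongrightarrow> 0" by simp
  have "norm (ip M (f n) g - ip M f' g) \<le> sqrt (sqn M (\<lambda>x. f n x - f' x) * sqn M g)" for n
    using ip_Cauchy_Schwarz[OF L2_diff[OF assms(1,2)] assms(4), of n] ip_diff_left[OF assms(1,2,4), of n]
    by (simp add: real_le_rsqrt)
  then have "(\<lambda>n. ip M (f n) g - ip M f' g) \<longlonglongrightarrow> 0"
    by (intro Lim_null_comparison[OF _ lim]) auto
  then show ?thesis by (simp add: LIM_zero_iff)
qed

lemma sqn_tendsto:
  assumes f: "\<And>n. f n \<in> L2 M" "f' \<in> L2 M" and lim: "(\<lambda>n. sqn M (\<lambda>x. f n x - f' x)) \<longlonglongrightarrow> 0"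
  shows "(\<lambda>n. sqn M (f n)) \<longlonglongrightarrow> sqn M f'"
proof -
  have "sqn M (f n) = sqn M (\<lambda>x. f n x - f' x) + 2 * Re (ip M (f n) f' - ip M f' f') + sqn M f'" for n
    using sqn_add_expand[OF L2_diff[OF f(1) f(2)] f(2), of n] ip_diff_left[OF f(1) f(2) f(2), of n] by simp
  moreover have "(\<lambda>n. sqn M (\<lambda>x. f n x - f' x) + 2 * Re (ip M (f n) f' - ip M f' f') + sqn M f')
      \<longlonglongrightarrow> 0 + 2 * Re (ip M f' f' - ip M f' f') + sqn M f'"
    by (intro tendsto_intros lim ip_tendsto[OF f lim f(2)])
  ultimately show ?thesis by simp
qed

text \<open>First variation: a small step along \<open>h\<close> against the inner product would
  lower the norm.\<close>

lemma ip_eq_0_of_minimal: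
  assumes f: "f \<in> L2 M" and h: "h \<in> L2 M" and min: "\<And>c. sqn M f \<le> sqn M (\<lambda>x. f x + c * h x)"
  shows "ip M f h = 0"
proof -
  define I where "I = ip M f h"
  \<comment> \<open>The step is small enough that the quadratic term costs at most half of the
    linear gain; the \<open>+ 1\<close> keeps \<open>t\<close> positive when \<open>h\<close>
    vanishes.\<close>
  define t where "t = 1 / (sqn M h + 1)"
  have pos: "sqn M h + 1 > 0" using sqn_nonneg[of M h] by linarith
  then have t: "t > 0" by (simp add: t_def)
  let ?c = "- (of_real t * I)"
  have "sqn M f \<le> sqn M f + 2 * Re (ip M f (\<lambda>x. ?c * h x)) + sqn M (\<lambda>x. ?c * h x)"
    using min[of ?c] unfolding sqn_add_expand[OF f L2_cmult[OF h]] .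
  moreover have "ip M f (\<lambda>x. ?c * h x) = cnj ?c * I"
    using ip_cmult_left[of M ?c h f] ip_cnj[of M "\<lambda>x. ?c * h x" f] ip_cnj[of M h f]
    unfolding I_def by (metis complex_cnj_mult)
  moreover have "Re (cnj ?c * I) = - t * (norm I)\<^sup>2"
    unfolding cmod_power2 by (simp add: power2_eq_square algebra_simps)
  moreover have "sqn M (\<lambda>x. ?c * h x) = t * (norm I)\<^sup>2 * (t * sqn M h)"
    unfolding sqn_cmult by (simp add: norm_mult power_mult_distrib power2_eq_square)
  moreover have "t * (norm I)\<^sup>2 * (t * sqn M h) \<le> t * (norm I)\<^sup>2 * 1"
    using pos t by (intro mult_left_mono) (auto simp: t_def divide_simps)
  ultimately have "t * (norm I)\<^sup>2 \<le> 0" by simp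
  then show ?thesis using t by (simp add: I_def mult_le_0_iff)
qed

section \<open>L^2 on a probability space: comparison with L^1, and completeness\<close>

context prob_space
begin

lemma L2_bounded:
  assumes "f \<in> borel_measurable M" "AE x in M. norm (f x) \<le> C"
  shows "f \<in> L2 M" 
  using assms by (intro L2I_bound[where g = "\<lambda>x. C\<^sup>2"]) (auto simp: power_mono elim!: eventually_mono)

lemma L2_const: "(\<lambda>x. c) \<in> L2 M"
  by (simp add: L2_def)

lemma L2_integrable: "f \<in> L2 M \<Longrightarrow> integrable M f"
  using integrable_mult_cnj[OF _ L2_const[of 1]] by fastforce

lemma integral_norm_le_sqn:
  assumes "f \<in> L2 M"
  shows "(LINT x|M. norm (f x)) \<le> sqrt (sqn M f)"
proof -
  let ?g = "\<lambda>x. complex_of_real (norm (f x))"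
  have g: "?g \<in> L2 M" using assms by (auto simp: L2_def)
  have "(norm (ip M ?g (\<lambda>x. 1)))\<^sup>2 \<le> sqn M ?g * sqn M (\<lambda>x. 1)"
    by (rule ip_Cauchy_Schwarz[OF g L2_const])
  moreover have "ip M ?g (\<lambda>x. 1) = of_real (LINT x|M. norm (f x))" by (simp add: ip_def)
  ultimately show ?thesis by (intro real_le_rsqrt) (simp add: sqn_def prob_space)
qed

lemma L1_tendsto_of_sqn:
  assumes "\<And>n. f n \<in> L2 M" "f' \<in> L2 M" "(\<lambda>n. sqn M (\<lambda>x. f n x - f' x)) \<longlonglongrightarrow> 0"
  shows "(\<lambda>n. LINT x|M. norm (f n x - f' x)) \<longlonglongrightarrow> 0"
proof (rule tendsto_sandwich[OF _ _ tendsto_const])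
  show "(\<lambda>n. sqrt (sqn M (\<lambda>x. f n x - f' x))) \<longlonglongrightarrow> 0"
    using tendsto_real_sqrt[OF assms(3)] by simp
qed (auto intro!: always_eventually integral_norm_le_sqn L2_diff assms)

lemma AE_subseq_of_sqn:
  assumes "\<And>n. f n \<in> L2 M" "f' \<in> L2 M" "(\<lambda>n. sqn M (\<lambda>x. f n x - f' x)) \<longlonglongrightarrow> 0"
  obtains r :: "nat \<Rightarrow> nat" where "strict_mono r" "AE x in M. (\<lambda>n. f (r n) x) \<longlonglongrightarrow> f' x"
proof -
  have "\<exists>r::nat\<Rightarrow>nat. strict_mono r \<and> (AE x in M. (\<lambda>n. f (r n) x - f' x) \<longlonglongrightarrow> 0)"
    by (rule tendsto_L1_AE_subseq[OF L2_integrable[OF L2_diff[OF assms(1,2)]] L1_tendsto_of_sqn[OF assms]])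
  then show ?thesis using that by (auto simp: LIM_zero_iff)
qed

text \<open>On a probability space an L^2 Cauchy sequence is L^1 Cauchy, so a subsequence converges
  a.e.; Fatou's lemma returns the pointwise limit to L^2.\<close>

theorem L2_complete:
  assumes f: "\<And>n. f n \<in> L2 M"
    and Cauchy: "\<And>e. e > 0 \<Longrightarrow> \<exists>N. \<forall>i\<ge>N. \<forall>j\<ge>N. sqn M (\<lambda>x. f i x - f j x) < e"
  obtains g where "g \<in> L2 M" "(\<lambda>n. sqn M (\<lambda>x. f n x - g x)) \<longlonglongrightarrow> 0"
proof -
  have "\<exists>N. \<forall>i\<ge>N. \<forall>j\<ge>N. (LINT x|M. norm (f i x - f j x)) < e" if e: "e > 0" for e
  proof -
    from e have "e\<^sup>2 > 0" by simp
    from Cauchy[OF this] obtain N where N: "\<And>i j. i \<ge> N \<Longrightarrow> j \<ge> N \<Longrightarrow> sqn M (\<lambda>x. f i x - f j x) < e\<^sup>2" by blast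
    have "(LINT x|M. norm (f i x - f j x)) < e" if "i \<ge> N" "j \<ge> N" for i j
      using integral_norm_le_sqn[OF L2_diff[OF f f], of i j] N[OF that] e
      by (smt (verit) real_sqrt_less_iff real_sqrt_abs)
    then show ?thesis by blast
  qed
  with cauchy_L1_AE_cauchy_subseq[of M f] L2_integrable[OF f] obtain r
    where r: "strict_mono r" and AEC: "AE x in M. Cauchy (\<lambda>i. f (r i) x)" by metis
  define g where "g = (\<lambda>x. lim (\<lambda>i. f (r i) x))"
  have [measurable]: "f n \<in> borel_measurable M" for n using f by (rule L2_measurable)
  have [measurable]: "g \<in> borel_measurable M" unfolding g_def by measurable
  have lim: "AE x in M. (\<lambda>i. f (r i) x) \<longlonglongrightarrow> g x"
    using AEC by eventually_elim (simp add: g_def Cauchy_convergent_iff convergent_LIMSEQ_iff)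
  \<comment> \<open>Fatou along the subsequence. It yields both that \<open>f n - g\<close> is
    square integrable, hence \<open>g\<close> too, and convergence of the full sequence.\<close>
  have bd: "integrable M (\<lambda>x. (norm (f n x - g x))\<^sup>2) \<and> sqn M (\<lambda>x. f n x - g x) \<le> e"
    if e: "e > 0" and n: "\<And>j. j \<ge> N \<Longrightarrow> sqn M (\<lambda>x. f n x - f j x) < e" for n N e
  proof -
    have "(\<integral>\<^sup>+x. ennreal ((norm (f n x - g x))\<^sup>2) \<partial>M)
        = (\<integral>\<^sup>+x. liminf (\<lambda>i. ennreal ((norm (f n x - f (r i) x))\<^sup>2)) \<partial>M)"
    proof (rule nn_integral_cong_AE, use lim in eventually_elim)
      fix x assume "(\<lambda>i. f (r i) x) \<longlonglongrightarrow> g x"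
      then have "(\<lambda>i. ennreal ((norm (f n x - f (r i) x))\<^sup>2)) \<longlonglongrightarrow> ennreal ((norm (f n x - g x))\<^sup>2)"
        by (intro tendsto_intros tendsto_ennrealI)
      then show "ennreal ((norm (f n x - g x))\<^sup>2) = liminf (\<lambda>i. ennreal ((norm (f n x - f (r i) x))\<^sup>2))"
        by (intro lim_imp_Liminf[symmetric]) auto
    qed
    also have "\<dots> \<le> liminf (\<lambda>i. \<integral>\<^sup>+x. ennreal ((norm (f n x - f (r i) x))\<^sup>2) \<partial>M)"
      by (rule nn_integral_liminf) simp
    also have "\<dots> \<le> ennreal e"
    proof (rule Liminf_le)
      show "\<forall>\<^sub>F i in sequentially. (\<integral>\<^sup>+x. ennreal ((norm (f n x - f (r i) x))\<^sup>2) \<partial>M) \<le> ennreal e"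
        using eventually_ge_at_top[of N]
      proof eventually_elim
        case (elim i)
        have "(\<integral>\<^sup>+x. ennreal ((norm (f n x - f (r i) x))\<^sup>2) \<partial>M) = ennreal (sqn M (\<lambda>x. f n x - f (r i) x))"
          unfolding sqn_def by (rule nn_integral_eq_integral) (auto intro: L2_integrable_sq[OF L2_diff[OF f f]])
        then show ?case using n[of "r i"] seq_suble[OF r, of i] elim
          by (simp add: ennreal_leI)
      qed
    qed simp
    finally have le: "(\<integral>\<^sup>+x. ennreal ((norm (f n x - g x))\<^sup>2) \<partial>M) \<le> ennreal e" .
    then have int: "integrable M (\<lambda>x. (norm (f n x - g x))\<^sup>2)"
      by (intro integrableI_bounded) (auto intro: le_less_trans)
    then have "ennreal (sqn M (\<lambda>x. f n x - g x)) \<le> ennreal e"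
      using le unfolding sqn_def by (subst nn_integral_eq_integral[symmetric]) auto
    then show ?thesis using int e by simp
  qed
  have "\<exists>n. (\<lambda>x. f n x - g x) \<in> L2 M"
  proof -
    obtain N where "\<forall>i\<ge>N. \<forall>j\<ge>N. sqn M (\<lambda>x. f i x - f j x) < 1" using Cauchy[of 1] by auto
    then have "integrable M (\<lambda>x. (norm (f N x - g x))\<^sup>2)" using bd[of 1 N N] by auto
    then show ?thesis by (auto simp: L2_def)
  qed
  then obtain n where n: "(\<lambda>x. f n x - g x) \<in> L2 M" ..
  have "g \<in> L2 M" using L2_diff[OF f[of n] n] by simp
  moreover have "(\<lambda>n. sqn M (\<lambda>x. f n x - g x)) \<longlonglongrightarrow> 0"
  proof (rule LIMSEQ_I)
    fix e :: real assume e: "e > 0"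
    then obtain N where N: "\<forall>i\<ge>N. \<forall>j\<ge>N. sqn M (\<lambda>x. f i x - f j x) < e/2" using Cauchy[of "e/2"] by auto
    have "sqn M (\<lambda>x. f n x - g x) < e" if "n \<ge> N" for n
      using bd[of "e/2" N n] N that e by auto
    then show "\<exists>N. \<forall>n\<ge>N. norm (sqn M (\<lambda>x. f n x - g x) - 0) < e" by auto
  qed
  ultimately show ?thesis using that by blast
qed

end

section \<open>Rotation invariance of the circle measure\<close>

lemma measurable_cis_sphere:
  "cis \<in> measurable (uniform_measure lborel {0..<2 * pi}) (restrict_space borel (sphere 0 1))"
proof -
  have "cis \<in> borel_measurable lborel"
    by (simp add: borel_measurable_continuous_onI continuous_on_cis)
  then show ?thesis
    by (intro measurable_restrict_space2) (auto simp: measurable_cong_sets[OF sets_uniform_measure refl])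
qed

lemma space_circle [simp]: "space circle = sphere 0 1"
  by (simp add: circle_def space_restrict_space)

lemma sets_circle: "sets circle = sets (restrict_space borel (sphere 0 1))"
  by (simp add: circle_def)

interpretation circle: prob_space circle
proof -
  interpret u: prob_space "uniform_measure lborel {0..<2 * pi}"
    by (rule prob_space_uniform_measure) auto
  show "prob_space circle"
    unfolding circle_def by (rule u.prob_space_distr[OF measurable_cis_sphere])
qed

lemma borel_measurable_circle_continuous:
  "continuous_on (sphere 0 1) f \<Longrightarrow> f \<in> borel_measurable circle"
  unfolding measurable_cong_sets[OF sets_circle refl]
  by (rule borel_measurable_continuous_on_restrict)

lemma id_measurable_circle [measurable]: "(\<lambda>z. z) \<in> borel_measurable circle"
  by (rule borel_measurable_circle_continuous) (rule continuous_on_id)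

lemma power_int_measurable_circle [measurable]: "(\<lambda>z. z powi m) \<in> borel_measurable circle"
  by (rule borel_measurable_circle_continuous) (auto intro!: continuous_intros)

lemma rotation_measurable:
  assumes "w \<in> sphere 0 1"
  shows "(\<lambda>z. w * z) \<in> measurable circle circle"
  unfolding measurable_cong_sets[OF refl sets_circle]
  by (intro measurable_restrict_space2) (use assms in \<open>auto simp: norm_mult\<close>)

lemma emeasure_circle:
  assumes "A \<in> sets circle"
  shows "emeasure circle A = (\<integral>\<^sup>+t\<in>{0..<2 * pi}. indicator A (cis t) \<partial>lborel) / ennreal (2 * pi)"
proof -
  have "emeasure circle A = (\<integral>\<^sup>+z. indicator A z \<partial>circle)" using assms by simp
  also have "\<dots> = (\<integral>\<^sup>+t. indicator A (cis t) \<partial>uniform_measure lborel {0..<2 * pi})"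
    unfolding circle_def using assms 
    by (subst nn_integral_distr[OF measurable_cis_sphere]) (auto simp: sets_circle)
  also have "\<dots> = (\<integral>\<^sup>+t. indicator A (cis t) * indicator {0..<2 * pi} t \<partial>lborel) / emeasure lborel {0..<2*pi}"
  proof (rule nn_integral_uniform_measure)
    have "(\<lambda>t. indicator A (cis t) :: ennreal) \<in> borel_measurable (uniform_measure lborel {0..<2 * pi})"
      by (rule measurable_compose[OF measurable_cis_sphere]) (use assms in \<open>auto simp: sets_circle\<close>)
    then show "(\<lambda>t. indicator A (cis t) :: ennreal) \<in> borel_measurable lborel"
      by (simp add: measurable_cong_sets[OF sets_uniform_measure refl])
  qed auto
  finally show ?thesis by simp
qed

text \<open>After translation the part of the interval beyond \<open>2 * pi\<close> is moved back by
  one period and fills the gap \<open>{0..<s}\<close>.\<close>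

lemma nn_integral_shift_periodic:
  fixes f :: "real \<Rightarrow> ennreal"
  assumes [measurable]: "f \<in> borel_measurable borel" and per: "\<And>t. f (t + 2 * pi) = f t"
    and s: "0 \<le> s" "s < 2 * pi"
  shows "(\<integral>\<^sup>+t\<in>{0..<2 * pi}. f (s + t) \<partial>lborel) = (\<integral>\<^sup>+t\<in>{0..<2 * pi}. f t \<partial>lborel)"
proof -
  have "(\<integral>\<^sup>+t\<in>{0..<2 * pi}. f (s + t) \<partial>lborel) = (\<integral>\<^sup>+t. f t * indicator {0..<2 * pi} (t - s) \<partial>lborel)"
    by (subst (2) nn_integral_real_affine[where c = 1 and t = s]) auto
  also have "\<dots> = (\<integral>\<^sup>+t. f t * indicator {s..<2 * pi} t + f t * indicator {2 * pi..<2 * pi + s} t \<partial>lborel)"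
    using s by (intro nn_integral_cong) (auto simp: indicator_def)
  also have "\<dots> = (\<integral>\<^sup>+t. f t * indicator {s..<2 * pi} t \<partial>lborel)
      + (\<integral>\<^sup>+t. f t * indicator {2 * pi..<2 * pi + s} t \<partial>lborel)"
    by (rule nn_integral_add) auto
  also have "(\<integral>\<^sup>+t. f t * indicator {2 * pi..<2 * pi + s} t \<partial>lborel)
      = (\<integral>\<^sup>+t. f t * indicator {0..<s} t \<partial>lborel)"
    using per by (subst nn_integral_real_affine[where c = 1 and t = "2 * pi"])
      (auto intro!: nn_integral_cong simp: indicator_def add.commute)
  also have "(\<integral>\<^sup>+t. f t * indicator {s..<2 * pi} t \<partial>lborel) + (\<integral>\<^sup>+t. f t * indicator {0..<s} t \<partial>lborel)
      = (\<integral>\<^sup>+t. f t * indicator {s..<2 * pi} t + f t * indicator {0..<s} t \<partial>lborel)"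
    by (rule nn_integral_add[symmetric]) auto
  also have "\<dots> = (\<integral>\<^sup>+t\<in>{0..<2 * pi}. f t \<partial>lborel)"
    using s by (intro nn_integral_cong) (auto simp: indicator_def)
  finally show ?thesis .
qed

text \<open>\<open>cis\<close> turns multiplication by \<open>cis s\<close> into translation by
  \<open>s\<close>, so the claim reduces to translation of a periodic function over one
  period.\<close>

lemma distr_rotation:
  assumes w: "w \<in> sphere 0 1"
  shows "distr circle circle (\<lambda>z. w * z) = circle"
proof (rule measure_eqI)
  fix A assume "A \<in> sets (distr circle circle (\<lambda>z. w * z))"
  then have A: "A \<in> sets circle" by simp
  obtain s where s: "0 \<le> s" "s < 2 * pi" "w = cis s"
    using Arg2pi_eq[of w] Arg2pi_ge_0[of w] Arg2pi_lt_2pi[of w] w that[of "Arg2pi w"]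
    by (simp add: cis_conv_exp)
  let ?B = "(\<lambda>z. w * z) -` A \<inter> space circle"
  have B: "?B \<in> sets circle" by (rule measurable_sets[OF rotation_measurable[OF w] A])
  have meas: "(\<lambda>t. indicator A (cis t) :: ennreal) \<in> borel_measurable borel"
  proof -
    have "(\<lambda>t. indicator A (cis t) :: ennreal) \<in> borel_measurable (uniform_measure lborel {0..<2 * pi})"
      by (rule measurable_compose[OF measurable_cis_sphere]) (use A in \<open>auto simp: sets_circle\<close>)
    then show ?thesis
      by (simp add: measurable_cong_sets[OF sets_uniform_measure refl])
  qed
  have "emeasure (distr circle circle (\<lambda>z. w * z)) A = emeasure circle ?B"
    by (rule emeasure_distr[OF rotation_measurable[OF w] A])
  also have "\<dots> = (\<integral>\<^sup>+t\<in>{0..<2 * pi}. indicator ?B (cis t) \<partial>lborel) / ennreal (2 * pi)"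
    by (rule emeasure_circle[OF B])
  also have "(\<integral>\<^sup>+t\<in>{0..<2 * pi}. indicator ?B (cis t) \<partial>lborel)
      = (\<integral>\<^sup>+t\<in>{0..<2 * pi}. indicator A (cis (s + t)) \<partial>lborel)"
    by (rule nn_integral_cong) (auto simp: indicator_def s(3) cis_mult)
  also have "\<dots> = (\<integral>\<^sup>+t\<in>{0..<2 * pi}. indicator A (cis t) \<partial>lborel)"
    by (rule nn_integral_shift_periodic[OF meas _ s(1,2)]) (simp add: cis_mult[symmetric])
  also have "\<dots> / ennreal (2 * pi) = emeasure circle A"
    by (rule emeasure_circle[OF A, symmetric])
  finally show "emeasure (distr circle circle (\<lambda>z. w * z)) A = emeasure circle A" .
qed simp

lemma integral_rotation:
  fixes f :: "complex \<Rightarrow> 'b::{banach, second_countable_topology}"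
  assumes "w \<in> sphere 0 1" "f \<in> borel_measurable circle"
  shows "(LINT z|circle. f (w * z)) = (LINT z|circle. f z)"
  using integral_distr[OF rotation_measurable[OF assms(1)] assms(2)] distr_rotation[OF assms(1)] by simp

lemma integrable_rotation:
  fixes f :: "complex \<Rightarrow> 'b::{banach, second_countable_topology}"
  assumes "w \<in> sphere 0 1" "f \<in> borel_measurable circle"
  shows "integrable circle (\<lambda>z. f (w * z)) \<longleftrightarrow> integrable circle f"
  using integrable_distr_eq[OF rotation_measurable[OF assms(1)] assms(2)] distr_rotation[OF assms(1)] by simp

lemma AE_rotation:
  assumes "w \<in> sphere 0 1" "AE z in circle. P z"
  shows "AE z in circle. P (w * z)"
proof -
  have "AE z in distr circle circle (\<lambda>z. w * z). P z"
    unfolding distr_rotation[OF assms(1)] by (rule assms(2))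
  then show ?thesis
    by (rule AE_distrD[OF rotation_measurable[OF assms(1)]])
qed

lemma integrable_circle_bounded:
  fixes f :: "complex \<Rightarrow> 'b::{banach, second_countable_topology}"
  assumes "f \<in> borel_measurable circle" "AE z in circle. norm (f z) \<le> C"
  shows "integrable circle f"
  using circle.integrable_const_bound[OF assms(2,1)] .

lemma integral_power_int: "(LINT z|circle. z powi m) = (if m = 0 then 1 else 0)"
proof (cases "m = 0")
  case True
  then show ?thesis using circle.prob_space by simp
next
  case False
  \<comment> \<open>This \<open>w\<close> satisfies \<open>w powi m = -1\<close>, so rotation
    invariance equates the integral with its own negative.\<close>
  define w where "w = cis (pi / of_int m)"
  have w: "w powi m = -1"
    using False by (simp add: w_def cis_power_int)
  have "(LINT z|circle. z powi m) = (LINT z|circle. (w * z) powi m)"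
    by (rule integral_rotation[symmetric]) (auto simp: w_def)
  also have "\<dots> = - (LINT z|circle. z powi m)"
    by (simp add: power_int_mult_distrib w)
  finally show ?thesis using False by simp
qed

lemma cnj_circle: "norm z = 1 \<Longrightarrow> cnj z = inverse z"
  using complex_norm_square[of z] by (intro inverse_unique[symmetric]) simp

lemma cnj_power_int: "norm z = 1 \<Longrightarrow> cnj (z powi m) = z powi (- m)"
  using cnj_circle[of z] by (metis complex_cnj_power_int power_int_inverse power_int_minus)

section \<open>Fourier series\<close>

definition fourier :: "(complex \<Rightarrow> complex) \<Rightarrow> int \<Rightarrow> complex" where
  "fourier f m = (LINT z|circle. f z * z powi (- m))"

definition trig_sum :: "int set \<Rightarrow> (int \<Rightarrow> complex) \<Rightarrow> complex \<Rightarrow> complex" where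
  "trig_sum A c z = (\<Sum>m\<in>A. c m * z powi m)"

lemma integrable_mult_bounded:
  fixes f :: "'a \<Rightarrow> complex"
  assumes "integrable M f" "g \<in> borel_measurable M" "AE x in M. norm (g x) \<le> C"
  shows "integrable M (\<lambda>x. f x * g x)"
proof (rule Bochner_Integration.integrable_bound[where f = "\<lambda>x. of_real C * f x"])
  show "AE x in M. norm (f x * g x) \<le> norm (of_real C * f x)"
    using assms(3)
  proof eventually_elim
    case (elim x)
    then have "norm (g x) \<le> \<bar>C\<bar>" by linarith
    then show ?case by (simp add: norm_mult mult.commute[of "norm (f x)"] mult_right_mono)
  qed
qed (use assms in auto)

lemma AE_norm_power_int: "AE z in circle. norm (z powi m) \<le> 1"
  by (rule AE_I2) (simp add: norm_power_int)

lemma integrable_mult_power_int: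
  "integrable circle f \<Longrightarrow> integrable circle (\<lambda>z. f z * z powi m)"
  by (rule integrable_mult_bounded[OF _ _ AE_norm_power_int]) auto

lemma power_int_circle_add: "norm z = 1 \<Longrightarrow> z powi a * z powi b = z powi (a + b)" for z :: complex
  by (subst power_int_add) auto

lemma fourier_mult_power_int: "fourier (\<lambda>z. f z * z powi k) m = fourier f (m - k)"
  unfolding fourier_def
  by (rule Bochner_Integration.integral_cong) (auto simp: power_int_circle_add mult.assoc)

lemma fourier_add:
  "integrable circle f \<Longrightarrow> integrable circle g \<Longrightarrow> fourier (\<lambda>z. f z + g z) m = fourier f m + fourier g m"
  by (simp add: fourier_def ring_distribs integrable_mult_power_int)

lemma fourier_diff:
  "integrable circle f \<Longrightarrow> integrable circle g \<Longrightarrow> fourier (\<lambda>z. f z - g z) m = fourier f m - fourier g m"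
  by (simp add: fourier_def ring_distribs integrable_mult_power_int)

lemma fourier_cmult: "fourier (\<lambda>z. c * f z) m = c * fourier f m"
  by (simp add: fourier_def mult.assoc)

text \<open>On the circle a real-linear function is a combination of \<open>z\<close> and its
  inverse, and these only shift Fourier coefficients. Leaving \<open>f\<close> arbitrary in the
  induction lets products be handled one factor at a time. This makes the real polynomials of
  Stone-Weierstrass usable in place of trigonometric ones.\<close>

lemma real_polynomial_function_preserves_vanishing_fourier:
  assumes "real_polynomial_function g" "integrable circle f" "\<And>m. fourier f m = 0"
  shows "integrable circle (\<lambda>z. f z * of_real (g z)) \<and> (\<forall>m. fourier (\<lambda>z. f z * of_real (g z)) m = 0)"
  using assms
proof (induction g arbitrary: f rule: real_polynomial_function.induct)
  case (linear g)
  note prems = linear.prems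
  interpret bounded_linear g by fact
  define a where "a = complex_of_real (g 1)"
  define b where "b = complex_of_real (g \<i>)"
  have eq: "complex_of_real (g z) = (a - \<i> * b) / 2 * z powi 1 + (a + \<i> * b) / 2 * z powi (-1)"
    if "z \<in> space circle" for z
  proof -
    have z: "norm z = 1" using that by simp
    have "g z = g (Re z *\<^sub>R 1 + Im z *\<^sub>R \<i>)"
      by (metis complex_eq mult.commute scaleR_conv_of_real mult.right_neutral)
    also have "\<dots> = Re z * g 1 + Im z * g \<i>" by (simp add: add scaleR)
    finally have "complex_of_real (g z) = of_real (Re z) * a + of_real (Im z) * b"
      by (simp add: a_def b_def)
    moreover have "of_real (Re z) = (z + cnj z) / 2" "of_real (Im z) = - \<i> * (z - cnj z) / 2"
      by (auto simp: complex_eq_iff)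
    ultimately have "complex_of_real (g z) = (a - \<i> * b) / 2 * z + (a + \<i> * b) / 2 * cnj z"
      by (simp add: field_simps)
    then show ?thesis using cnj_circle[OF z] by (simp add: power_int_minus)
  qed
  have eq': "f z * complex_of_real (g z) = (a - \<i> * b) / 2 * (f z * z powi 1) + (a + \<i> * b) / 2 * (f z * z powi (-1))"
    if "z \<in> space circle" for z
    unfolding eq[OF that] by (simp add: algebra_simps)
  define p where "p = (a - \<i> * b) / 2"
  define q where "q = (a + \<i> * b) / 2"
  let ?h = "\<lambda>z. p * (f z * z powi 1) + q * (f z * z powi (-1))"
  have int: "integrable circle ?h"
    by (intro Bochner_Integration.integrable_add integrable_mult_right integrable_mult_power_int prems)
  have "fourier ?h m = 0" for m
    using prems
    by (subst fourier_add)
       (auto intro!: integrable_mult_right integrable_mult_power_int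
        simp: fourier_cmult fourier_mult_power_int simp del: power_int_1_right power_int_minus1_right
          integrable_mult_right_iff)
  moreover have "fourier (\<lambda>z. f z * of_real (g z)) m = fourier ?h m" for m
    unfolding fourier_def by (rule Bochner_Integration.integral_cong) (simp_all only: eq' p_def q_def)
  moreover have "integrable circle (\<lambda>z. f z * of_real (g z)) \<longleftrightarrow> integrable circle ?h"
    by (rule Bochner_Integration.integrable_cong) (simp_all only: eq' p_def q_def)
  ultimately show ?case using int by simp
next
  case (const c)
  then show ?case using fourier_cmult[of "of_real c" f] by (simp add: mult.commute)
next
  case (add g h)
  have eq: "(\<lambda>z. f z * complex_of_real (g z + h z)) = (\<lambda>z. f z * of_real (g z) + f z * of_real (h z))"
    by (simp add: fun_eq_iff ring_distribs)
  show ?case unfolding eq using add.IH[OF add.prems] by (auto simp: fourier_add)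
next
  case (mult g h)
  have eq: "(\<lambda>z. f z * complex_of_real (g z * h z)) = (\<lambda>z. f z * of_real (g z) * of_real (h z))"
    by (simp add: fun_eq_iff)
  show ?case unfolding eq using mult.IH(1)[OF mult.prems] mult.IH(2) by simp
qed

lemma integral_mult_continuous_eq_0:
  fixes g :: "complex \<Rightarrow> real"
  assumes f: "integrable circle f" "\<And>m. fourier f m = 0" and g: "continuous_on (sphere 0 1) g"
  shows "(LINT z|circle. f z * of_real (g z)) = 0"
proof -
  have [measurable]: "g \<in> borel_measurable circle"
    by (rule borel_measurable_circle_continuous[OF g])
  have le: "norm (LINT z|circle. f z * of_real (g z)) \<le> e * (LINT z|circle. norm (f z))" if e: "e > 0" for e
  proof -
    obtain p where p: "real_polynomial_function p" "\<And>x. x \<in> sphere 0 1 \<Longrightarrow> \<bar>g x - p x\<bar> < e"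
      using Stone_Weierstrass_real_polynomial_function[OF compact_sphere g e] by blast
    note p0 = real_polynomial_function_preserves_vanishing_fourier[OF p(1) f]
    have p00: "(LINT z|circle. f z * of_real (p z)) = 0"
      using p0 fourier_def[of "\<lambda>z. f z * of_real (p z)" 0] by simp
    have [measurable]: "p \<in> borel_measurable circle"
      using p(1) by (intro borel_measurable_circle_continuous continuous_on_polymonial_function)
        (simp add: real_polynomial_function_eq)
    have int: "integrable circle (\<lambda>z. f z * of_real (g z - p z))"
      by (rule integrable_mult_bounded[where C = e, OF f(1)]) (use p(2) in \<open>auto intro!: AE_I2 less_imp_le simp: norm_of_real simp del: of_real_diff\<close>)
    have "(LINT z|circle. f z * of_real (g z)) = (LINT z|circle. f z * of_real (g z - p z) + f z * of_real (p z))"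
      by (simp add: algebra_simps)
    also have "\<dots> = (LINT z|circle. f z * of_real (g z - p z))"
      using int p0 p00 by simp
    finally have "norm (LINT z|circle. f z * of_real (g z)) \<le> (LINT z|circle. norm (f z * of_real (g z - p z)))"
      by simp
    also have "\<dots> \<le> (LINT z|circle. e * norm (f z))"
    proof (rule integral_mono)
      fix z assume "z \<in> space circle"
      then have "\<bar>g z - p z\<bar> \<le> e" using p(2)[of z] by simp
      then show "norm (f z * of_real (g z - p z)) \<le> e * norm (f z)"
        by (simp add: norm_mult norm_of_real mult.commute[of _ "norm (f z)"] mult_left_mono del: of_real_diff)
    qed (use int f in auto)
    finally show ?thesis by simp
  qed
  have "norm (LINT z|circle. f z * of_real (g z)) \<le> 0 * (LINT z|circle. norm (f z))"
  proof (rule tendsto_lowerbound)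
    show "((\<lambda>e. e * (LINT z|circle. norm (f z))) \<longlongrightarrow> 0 * (LINT z|circle. norm (f z))) (at_right 0)"
      by (intro tendsto_intros)
    show "\<forall>\<^sub>F e in at_right 0. norm (LINT z|circle. f z * of_real (g z)) \<le> e * (LINT z|circle. norm (f z))"
      using le by (auto simp: eventually_at_right_less intro: eventually_mono[OF eventually_at_right_less])
  qed auto
  then show ?thesis by simp
qed

lemma integral_closed_eq_0:
  assumes f: "integrable circle f" "\<And>m. fourier f m = 0" and A: "closed A" "A \<noteq> {}"
  shows "(LINT z|circle. f z * indicator A z) = 0"
proof -
  \<comment> \<open>Continuous functions tending pointwise to the indicator of \<open>A\<close>,
    because \<open>A\<close> is closed. Nonemptiness matters: \<open>infdist\<close> to the empty
    set is 0, so \<open>g n\<close> would be constantly 1.\<close>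
  define g where "g = (\<lambda>(n::nat) z. max 0 (1 - real n * infdist z A))"
  have cont: "continuous_on S (g n)" for S n
    unfolding g_def by (intro continuous_intros)
  have [measurable]: "g n \<in> borel_measurable circle" for n
    by (rule borel_measurable_circle_continuous[OF cont])
  have [measurable]: "A \<in> sets borel" using A by simp
  have indm: "(\<lambda>z. indicator A z :: complex) \<in> borel_measurable circle"
    unfolding measurable_cong_sets[OF sets_circle refl] by (intro measurable_restrict_space1) simp
  have gle: "0 \<le> g n z" "g n z \<le> 1" for n z
    by (auto simp: g_def infdist_nonneg)
  have lim: "(\<lambda>n. g n z) \<longlonglongrightarrow> indicator A z" for z
  proof (cases "z \<in> A")
    case True
    then show ?thesis by (simp add: g_def)
  next
    case False
    then have pos: "infdist z A > 0"
      using A by (metis in_closed_iff_infdist_zero infdist_nonneg less_eq_real_def)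
    obtain N :: nat where N: "1 / infdist z A < real N" using reals_Archimedean2 by blast
    have "g n z = 0" if "n \<ge> N" for n
    proof -
      have "1 < real N * infdist z A" using N pos by (simp add: field_simps)
      also have "\<dots> \<le> real n * infdist z A" using that pos by simp
      finally show ?thesis by (simp add: g_def)
    qed
    then have "\<forall>\<^sub>F n in sequentially. g n z = 0" using eventually_sequentially by blast
    then show ?thesis using False by (simp add: tendsto_eventually)
  qed
  have "(\<lambda>n. LINT z|circle. f z * of_real (g n z)) \<longlonglongrightarrow> (LINT z|circle. f z * indicator A z)"
  proof (rule integral_dominated_convergence[where w = "\<lambda>z. norm (f z)"])
    show "AE z in circle. (\<lambda>n. f z * of_real (g n z)) \<longlonglongrightarrow> f z * indicator A z"
    proof (rule AE_I2)
      fix z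
      have "(\<lambda>n. f z * of_real (g n z)) \<longlonglongrightarrow> f z * of_real (indicator A z)"
        by (intro tendsto_intros lim)
      then show "(\<lambda>n. f z * of_real (g n z)) \<longlonglongrightarrow> f z * indicator A z"
        by (cases "z \<in> A") simp_all
    qed
    show "AE z in circle. norm (f z * of_real (g n z)) \<le> norm (f z)" for n
      by (rule AE_I2) (use gle in \<open>auto simp: norm_mult mult_left_le\<close>)
  qed (use f indm in \<open>auto simp: borel_measurable_integrable\<close>)
  moreover have "(LINT z|circle. f z * of_real (g n z)) = 0" for n
    by (rule integral_mult_continuous_eq_0[OF f cont])
  ultimately show ?thesis by (simp add: LIMSEQ_const_iff)
qed

text \<open>Closed sets form an intersection-stable generator of the Borel sets, so vanishing of the
  integrals of \<open>f\<close> over closed sets spreads to all measurable sets by a Dynkin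
  argument.\<close>

theorem fourier_unique:
  assumes f: "integrable circle f" "\<And>m. fourier f m = 0"
  shows "AE z in circle. f z = 0"
proof (rule circle.density_zero[OF f(1)])
  have tot: "(LINT z|circle. f z) = 0" using f(2)[of 0] by (simp add: fourier_def)
  have ind: "(\<lambda>z. indicator A z :: complex) \<in> borel_measurable circle" if "A \<in> sets borel" for A
    unfolding measurable_cong_sets[OF sets_circle refl] by (intro measurable_restrict_space1) (use that in simp)
  have int: "integrable circle (\<lambda>z. f z * indicator A z)" if "A \<in> sets borel" for A
    by (rule integrable_mult_bounded[OF f(1) ind[OF that], where C = 1]) (auto simp: indicator_def)
  have Int_closed: "Int_stable {A :: complex set. closed A}" "{A :: complex set. closed A} \<subseteq> Pow UNIV"
    by (auto simp: Int_stable_def)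
  have main: "(LINT z|circle. f z * indicator A z) = 0" if "A \<in> sigma_sets UNIV {A. closed A}" for A :: "complex set"
    using Int_closed that
  proof (induction rule: sigma_sets_induct_disjoint)
    case (basic A)
    then show ?case using integral_closed_eq_0[OF f, of A] by (cases "A = {}") auto
  next
    case (compl A)
    then have A: "A \<in> sets borel" by (simp add: borel_eq_closed)
    have "(LINT z|circle. f z * indicator (UNIV - A) z) = (LINT z|circle. f z - f z * indicator A z)"
      by (intro Bochner_Integration.integral_cong) (auto simp: indicator_def)
    also have "\<dots> = 0" using f int[OF A] tot compl by simp
    finally show ?case .
  next
    case (union A)
    then have A: "A i \<in> sets borel" for i by (auto simp: borel_eq_closed)
    have "(\<lambda>n. LINT z|circle. (\<Sum>i<n. f z * indicator (A i) z)) \<longlonglongrightarrow> (LINT z|circle. f z * indicator (\<Union>i. A i) z)"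
    proof (rule integral_dominated_convergence[where w = "\<lambda>z. norm (f z)"])
      have sum: "(\<Sum>i<n. f z * indicator (A i) z) = f z * indicator (\<Union>i<n. A i) z" for n z
        using union(1) unfolding sum_distrib_left[symmetric]
        by (subst indicator_UN_disjoint) (auto simp: disjoint_family_on_def)
      show "AE z in circle. (\<lambda>n. \<Sum>i<n. f z * indicator (A i) z) \<longlonglongrightarrow> f z * indicator (\<Union>i. A i) z"
        unfolding sum by (intro AE_I2 tendsto_intros LIMSEQ_indicator_UN)
      show "AE z in circle. norm (\<Sum>i<n. f z * indicator (A i) z) \<le> norm (f z)" for n
        unfolding sum by (rule AE_I2) (auto simp: indicator_def)
      show "(\<lambda>z. \<Sum>i<n. f z * indicator (A i) z) \<in> borel_measurable circle" for n
        by (intro borel_measurable_sum borel_measurable_integrable int A)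
      show "(\<lambda>z. f z * indicator (\<Union>i. A i) z) \<in> borel_measurable circle"
        by (intro borel_measurable_integrable int sets.countable_UN) (use A in auto)
    qed (use f in auto)
    moreover have "(LINT z|circle. (\<Sum>i<n. f z * indicator (A i) z)) = 0" for n
      by (subst Bochner_Integration.integral_sum) (use union int A in auto)
    ultimately show ?case by (simp add: LIMSEQ_const_iff)
  qed simp
  show "set_lebesgue_integral circle A f = 0" if "A \<in> sets circle" for A
  proof -
    obtain B where B: "B \<in> sets borel" "A = sphere 0 1 \<inter> B"
      using \<open>A \<in> sets circle\<close> unfolding sets_circle sets_restrict_space by blast
    have "set_lebesgue_integral circle A f = (LINT z|circle. f z * indicator B z)"
      unfolding set_lebesgue_integral_def
      by (rule Bochner_Integration.integral_cong) (auto simp: B indicator_def)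
    then show ?thesis using main[of B] B(1) by (simp add: borel_eq_closed)
  qed
qed

section \<open>Orthonormality of the powers of \<open>z\<close>: Bessel, Riesz-Fischer, convergence
  in L^2\<close>

lemma L2_power_int: "(\<lambda>z. z powi m) \<in> L2 circle"
  by (rule circle.L2_bounded[OF _ AE_norm_power_int]) auto

lemma fourier_eq_ip: "fourier f m = ip circle f (\<lambda>z. z powi m)"
  unfolding fourier_def ip_def by (rule Bochner_Integration.integral_cong) (auto simp: cnj_power_int simp del: complex_cnj_power_int)

lemma L2_trig_sum: "trig_sum A c \<in> L2 circle"
  unfolding trig_sum_def [abs_def] by (intro L2_sum L2_cmult L2_power_int)

lemma fourier_power_int: "fourier (\<lambda>z. z powi k) m = (if k = m then 1 else 0)"
proof -
  have "fourier (\<lambda>z. z powi k) m = (LINT z|circle. z powi (k - m))"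
    unfolding fourier_def by (rule Bochner_Integration.integral_cong) (auto simp: power_int_circle_add)
  then show ?thesis by (simp add: integral_power_int)
qed

lemma fourier_trig_sum: "finite A \<Longrightarrow> fourier (trig_sum A c) m = (if m \<in> A then c m else 0)"
  unfolding fourier_eq_ip trig_sum_def [abs_def]
  by (subst ip_sum_left)
     (auto intro!: L2_cmult L2_power_int simp: ip_cmult_left fourier_eq_ip[symmetric] fourier_power_int if_distrib cong: if_cong)

lemma ip_trig_sum:
  assumes "finite A" "f \<in> L2 circle"
  shows "ip circle f (trig_sum A c) = (\<Sum>m\<in>A. fourier f m * cnj (c m))"
proof -
  have "ip circle (trig_sum A c) f = (\<Sum>m\<in>A. c m * cnj (fourier f m))"
    unfolding trig_sum_def [abs_def]
    by (subst ip_sum_left) (auto intro!: L2_cmult L2_power_int assms simp: ip_cmult_left fourier_eq_ip ip_cnj)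
  then have "cnj (ip circle (trig_sum A c) f) = (\<Sum>m\<in>A. fourier f m * cnj (c m))"
    by (simp add: mult.commute)
  then show ?thesis by (simp add: ip_cnj)
qed

lemma sqn_trig_sum:
  assumes "finite A"
  shows "sqn circle (trig_sum A c) = (\<Sum>m\<in>A. (norm (c m))\<^sup>2)"
proof -
  have "complex_of_real (sqn circle (trig_sum A c)) = of_real (\<Sum>m\<in>A. (norm (c m))\<^sup>2)"
    using ip_trig_sum[OF assms L2_trig_sum, of A c c] assms
    by (simp add: ip_self fourier_trig_sum complex_norm_square del: of_real_power)
  then show ?thesis by (simp only: of_real_eq_iff)
qed

text \<open>Completing the square in the coefficients. The last sum vanishes exactly when
  \<open>c\<close> agrees with the Fourier coefficients on \<open>A\<close>, which yields Bessel's
  inequality and the best approximation property.\<close>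

lemma sqn_diff_trig_sum:
  assumes A: "finite A" and f: "f \<in> L2 circle"
  shows "sqn circle (\<lambda>z. f z - trig_sum A c z) =
    sqn circle f - (\<Sum>m\<in>A. (norm (fourier f m))\<^sup>2) + (\<Sum>m\<in>A. (norm (fourier f m - c m))\<^sup>2)"
proof -
  have neg: "trig_sum A (\<lambda>m. - c m) z = - trig_sum A c z" for z
    by (simp add: trig_sum_def sum_negf)
  have "sqn circle (\<lambda>z. f z - trig_sum A c z) = sqn circle (\<lambda>z. f z + trig_sum A (\<lambda>m. - c m) z)"
    by (simp add: neg)
  also have "\<dots> = sqn circle f + 2 * Re (\<Sum>m\<in>A. fourier f m * cnj (- c m)) + (\<Sum>m\<in>A. (norm (c m))\<^sup>2)"
    unfolding sqn_add_expand[OF f L2_trig_sum] ip_trig_sum[OF A f] sqn_trig_sum[OF A] by simp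
  also have "\<dots> = sqn circle f - (\<Sum>m\<in>A. (norm (fourier f m))\<^sup>2)
      + (\<Sum>m\<in>A. (norm (fourier f m))\<^sup>2 + 2 * Re (fourier f m * cnj (- c m)) + (norm (c m))\<^sup>2)"
    by (simp add: sum.distrib sum_distrib_left sum_subtractf)
  also have "(\<Sum>m\<in>A. (norm (fourier f m))\<^sup>2 + 2 * Re (fourier f m * cnj (- c m)) + (norm (c m))\<^sup>2)
      = (\<Sum>m\<in>A. (norm (fourier f m - c m))\<^sup>2)"
    unfolding cmod_power2 by (rule sum.cong) (auto simp: power2_eq_square algebra_simps)
  finally show ?thesis .
qed

lemma Bessel:
  assumes "finite A" "f \<in> L2 circle"
  shows "(\<Sum>m\<in>A. (norm (fourier f m))\<^sup>2) \<le> sqn circle f"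
  using sqn_diff_trig_sum[OF assms, of "fourier f"] sqn_nonneg[of circle "\<lambda>z. f z - trig_sum A (fourier f) z"]
  by simp

lemma trig_sum_best_approximation:
  assumes "finite A" "finite B" "B \<subseteq> A" "f \<in> L2 circle"
  shows "sqn circle (\<lambda>z. f z - trig_sum A (fourier f) z) \<le> sqn circle (\<lambda>z. f z - trig_sum B c z)"
proof -
  have "(\<Sum>m\<in>B. (norm (fourier f m))\<^sup>2) \<le> (\<Sum>m\<in>A. (norm (fourier f m))\<^sup>2)"
    by (rule sum_mono2) (use assms in auto)
  moreover have "0 \<le> (\<Sum>m\<in>B. (norm (fourier f m - c m))\<^sup>2)" by (rule sum_nonneg) simp
  ultimately show ?thesis
    using assms by (simp add: sqn_diff_trig_sum)
qed

text \<open>By orthonormality, squared distances between symmetric partial sums are differences of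
  the bounded monotone sequence \<open>P\<close>; hence the sums are Cauchy. Coefficients pass to
  the limit by continuity of the inner product.\<close>

theorem Riesz_Fischer:
  assumes bd: "\<And>A. finite A \<Longrightarrow> (\<Sum>m\<in>A. (norm (c m))\<^sup>2) \<le> B"
  obtains g where "g \<in> L2 circle" "\<And>m. fourier g m = c m" "sqn circle g \<le> B"
    "(\<lambda>N. sqn circle (\<lambda>z. g z - trig_sum {- int N..int N} c z)) \<longlonglongrightarrow> 0"
proof -
  let ?A = "\<lambda>N. {- int N..int N}"
  let ?S = "\<lambda>N. trig_sum (?A N) c"
  define P where "P N = (\<Sum>m\<in>?A N. (norm (c m))\<^sup>2)" for N :: nat
  have inc: "incseq P" unfolding P_def by (intro incseq_SucI sum_mono2) auto
  obtain L where "P \<longlonglongrightarrow> L"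
    by (rule incseq_convergent[OF inc, of B]) (auto simp: P_def intro: bd)
  then have "convergent P" by (rule convergentI)
  then have PC: "Cauchy P" by (simp add: Cauchy_convergent_iff)
  have diff: "sqn circle (\<lambda>z. ?S i z - ?S j z) = \<bar>P i - P j\<bar>" if "i \<le> j" for i j
  proof -
    have sub: "?A i \<subseteq> ?A j" using that by auto
    have "?S j z - ?S i z = trig_sum (?A j - ?A i) c z" for z
      unfolding trig_sum_def by (rule sum_diff[symmetric, OF _ sub]) simp
    then have "sqn circle (\<lambda>z. ?S j z - ?S i z) = P j - P i"
      unfolding P_def by (simp add: sqn_trig_sum sum_diff[OF _ sub])
    moreover have "P i \<le> P j" using inc that by (simp add: incseq_def)
    ultimately show ?thesis by (simp add: sqn_minus_commute[of circle "?S i"])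
  qed
  have diff': "sqn circle (\<lambda>z. ?S i z - ?S j z) = \<bar>P i - P j\<bar>" for i j
    using diff[of i j] diff[of j i] sqn_minus_commute[of circle "?S i" "?S j"] by (cases "i \<le> j") auto
  have "\<exists>N. \<forall>i\<ge>N. \<forall>j\<ge>N. sqn circle (\<lambda>z. ?S i z - ?S j z) < e" if "e > 0" for e
    using PC that unfolding diff' Cauchy_def dist_real_def by blast
  from circle.L2_complete[of ?S, OF L2_trig_sum this] obtain g where g: "g \<in> L2 circle"
    and lim: "(\<lambda>n. sqn circle (\<lambda>z. ?S n z - g z)) \<longlonglongrightarrow> 0" by blast
  have fg: "fourier g m = c m" for m
  proof (rule LIMSEQ_unique)
    show "(\<lambda>n. fourier (?S n) m) \<longlonglongrightarrow> fourier g m"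
      using ip_tendsto[OF L2_trig_sum g lim L2_power_int] by (simp add: fourier_eq_ip[symmetric])
    have "\<forall>\<^sub>F n in sequentially. fourier (?S n) m = c m"
      using eventually_ge_at_top[of "nat \<bar>m\<bar>"] by eventually_elim (auto simp: fourier_trig_sum)
    then show "(\<lambda>n. fourier (?S n) m) \<longlonglongrightarrow> c m" by (rule tendsto_eventually)
  qed
  have lim': "(\<lambda>n. sqn circle (\<lambda>z. g z - ?S n z)) \<longlonglongrightarrow> 0"
    using lim by (simp add: sqn_minus_commute[of circle g])
  have "(\<lambda>n. sqn circle (\<lambda>z. g z - ?S n z) + B) \<longlonglongrightarrow> 0 + B"
    by (intro tendsto_intros lim')
  moreover have "sqn circle g \<le> sqn circle (\<lambda>z. g z - ?S n z) + B" for n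
    using sqn_diff_trig_sum[of "?A n" g c] bd[of "?A n"] g by (simp add: fg)
  ultimately have "sqn circle g \<le> 0 + B"
    by (intro LIMSEQ_le_const) auto
  then show ?thesis using that[OF g fg _ lim'] by simp
qed

text \<open>Riesz-Fischer sums the series to some \<open>g\<close>; since \<open>f\<close> and
  \<open>g\<close> have the same coefficients, uniqueness identifies them a.e.\<close>

theorem fourier_series_tendsto:
  assumes f: "f \<in> L2 circle"
  shows "(\<lambda>N. sqn circle (\<lambda>z. f z - trig_sum {- int N..int N} (fourier f) z)) \<longlonglongrightarrow> 0"
proof -
  obtain g where g: "g \<in> L2 circle" "\<And>m. fourier g m = fourier f m"
    and lim: "(\<lambda>N. sqn circle (\<lambda>z. g z - trig_sum {- int N..int N} (fourier f) z)) \<longlonglongrightarrow> 0"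
  proof (rule Riesz_Fischer[of "fourier f" "sqn circle f"])
    show "(\<Sum>m\<in>A. (norm (fourier f m))\<^sup>2) \<le> sqn circle f" if "finite A" for A
      by (rule Bessel[OF that f])
  qed (rule that)
  have "AE z in circle. f z - g z = 0"
  proof (rule fourier_unique)
    show "integrable circle (\<lambda>z. f z - g z)" by (rule circle.L2_integrable[OF L2_diff[OF f g(1)]])
    show "fourier (\<lambda>z. f z - g z) m = 0" for m
      using fourier_diff[OF circle.L2_integrable[OF f] circle.L2_integrable[OF g(1)]] g(2) by simp
  qed
  then have "AE z in circle. norm (f z - trig_sum A c z) = norm (g z - trig_sum A c z)" for A c
    by eventually_elim simp
  then have "sqn circle (\<lambda>z. f z - trig_sum A c z) = sqn circle (\<lambda>z. g z - trig_sum A c z)" for A c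
    by (rule sqn_cong_AE[OF L2_measurable[OF L2_diff[OF f L2_trig_sum]] L2_measurable[OF L2_diff[OF g(1) L2_trig_sum]]])
  then show ?thesis using lim by simp
qed

section \<open>Fejer means\<close>

text \<open>On the circle this is the Fejer kernel, the sum of
  \<open>(1 - \<bar>m\<bar> / n) * z powi m\<close> over \<open>\<bar>m\<bar> < n\<close> for
  positive \<open>n\<close>. The squared modulus makes positivity immediate. For
  \<open>n = 0\<close> the value is 0.\<close>

definition fejer_kernel :: "nat \<Rightarrow> complex \<Rightarrow> real" where
  "fejer_kernel n z = (norm (\<Sum>k<n. z ^ k))\<^sup>2 / real n"

definition fejer_mean :: "nat \<Rightarrow> (complex \<Rightarrow> complex) \<Rightarrow> complex \<Rightarrow> complex" where
  "fejer_mean n f w = (LINT z|circle. f z * of_real (fejer_kernel n (w * cnj z)))"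

lemma fejer_kernel_nonneg: "0 \<le> fejer_kernel n z"
  by (simp add: fejer_kernel_def)

lemma fejer_kernel_measurable [measurable]:
  "(\<lambda>z. fejer_kernel n (w * cnj z)) \<in> borel_measurable circle"
  unfolding fejer_kernel_def divide_inverse
  by (rule borel_measurable_circle_continuous) (intro continuous_intros)

lemma fejer_kernel_eq:
  assumes w: "norm w = 1" and z: "norm z = 1"
  shows "complex_of_real (fejer_kernel n (w * cnj z)) =
    (\<Sum>j<n. \<Sum>k<n. w powi (int j - int k) * z powi (- (int j - int k))) / of_nat n"
proof -
  define t where "t = w * cnj z"
  have t: "norm t = 1" using w z by (simp add: t_def norm_mult)
  have "complex_of_real ((norm (\<Sum>k<n. t ^ k))\<^sup>2) = (\<Sum>k<n. t ^ k) * (\<Sum>k<n. cnj t ^ k)"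
    using complex_norm_square[of "\<Sum>k<n. t ^ k"] by simp
  also have "\<dots> = (\<Sum>j<n. \<Sum>k<n. t powi (int j - int k))"
    unfolding sum_product
  proof (intro sum.cong refl)
    fix j k
    have "cnj t ^ k = t powi (- int k)"
      using cnj_power_int[OF t, of "int k"] by simp
    then have "t ^ j * cnj t ^ k = t powi (int j) * t powi (- int k)" by simp
    then show "t ^ j * cnj t ^ k = t powi (int j - int k)"
      using power_int_circle_add[OF t, of "int j" "- int k"] by (metis uminus_add_conv_diff add.commute)
  qed
  also have "\<dots> = (\<Sum>j<n. \<Sum>k<n. w powi (int j - int k) * z powi (- (int j - int k)))"
    unfolding t_def power_int_mult_distrib
    using cnj_power_int[OF z] by (intro sum.cong refl) simp
  finally show ?thesis by (simp add: fejer_kernel_def t_def)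
qed

text \<open>Grouping the double sum of the kernel by \<open>j\<close> gives an average of
  \<open>n\<close> partial sums over sliding windows of length \<open>n\<close>, rather than the
  customary symmetric ones. Each window contains frequency 0, and for fixed \<open>d\<close> all but
  at most \<open>2 * d\<close> of them contain \<open>{- d..d}\<close>.\<close>

lemma fejer_mean_eq:
  assumes w: "norm w = 1" and f: "integrable circle f"
  shows "fejer_mean n f w = (\<Sum>j<n. trig_sum {int j - int n + 1..int j} (fourier f) w) / of_nat n"
proof -
  have "fejer_mean n f w = (LINT z|circle.
      (\<Sum>j<n. \<Sum>k<n. w powi (int j - int k) * (f z * z powi (- (int j - int k)))) / of_nat n)"
    unfolding fejer_mean_def
    by (rule Bochner_Integration.integral_cong)
       (auto simp: fejer_kernel_eq[OF w] sum_distrib_left algebra_simps)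
  also have "\<dots> = (\<Sum>j<n. \<Sum>k<n. w powi (int j - int k) * fourier f (int j - int k)) / of_nat n"
    by (simp add: fourier_def integrable_mult_power_int f del: power_int_minus)
  also have "\<dots> = (\<Sum>j<n. trig_sum {int j - int n + 1..int j} (fourier f) w) / of_nat n"
  proof -
    have "(\<Sum>k<n. w powi (int j - int k) * fourier f (int j - int k))
      = trig_sum {int j - int n + 1..int j} (fourier f) w" for j
    unfolding trig_sum_def
    by (rule sum.reindex_bij_witness[where i = "\<lambda>m. nat (int j - m)" and j = "\<lambda>k. int j - int k"]) auto
    then show ?thesis by simp
  qed
  finally show ?thesis .
qed

lemma L2_fejer_mean:
  assumes f: "integrable circle f"
  shows "fejer_mean n f \<in> L2 circle"
proof -
  have "(\<lambda>w. inverse (of_nat n) * (\<Sum>j<n. trig_sum {int j - int n + 1..int j} (fourier f) w)) \<in> L2 circle"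
    by (intro L2_cmult L2_sum L2_trig_sum)
  moreover have "fejer_mean n f \<in> borel_measurable circle \<longleftrightarrow>
     (\<lambda>w. inverse (of_nat n) * (\<Sum>j<n. trig_sum {int j - int n + 1..int j} (fourier f) w)) \<in> borel_measurable circle"
    by (rule measurable_cong) (simp add: fejer_mean_eq[OF _ f] divide_inverse mult.commute)
  moreover have "integrable circle (\<lambda>w. (norm (fejer_mean n f w))\<^sup>2) \<longleftrightarrow>
     integrable circle (\<lambda>w. (norm (inverse (of_nat n) * (\<Sum>j<n. trig_sum {int j - int n + 1..int j} (fourier f) w)))\<^sup>2)"
    by (rule Bochner_Integration.integrable_cong) (simp_all add: fejer_mean_eq[OF _ f] divide_inverse mult.commute)
  ultimately show ?thesis by (simp add: L2_def)
qed

lemma integral_fejer_kernel: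
  assumes "norm w = 1" "n > 0"
  shows "(LINT z|circle. fejer_kernel n (w * cnj z)) = 1"
proof -
  have "complex_of_real (LINT z|circle. fejer_kernel n (w * cnj z)) = fejer_mean n (\<lambda>z. 1) w"
    by (simp add: fejer_mean_def)
  also have "\<dots> = (\<Sum>j<n. trig_sum {int j - int n + 1..int j} (fourier (\<lambda>z. 1)) w) / of_nat n"
    by (rule fejer_mean_eq[OF assms(1)]) simp
  also have "trig_sum {int j - int n + 1..int j} (fourier (\<lambda>z. 1)) w = 1" if "j < n" for j
  proof -
    have "fourier (\<lambda>z. 1) m = (if 0 = m then 1 else 0)" for m
      using fourier_power_int[of 0 m] by simp
    then have "trig_sum {int j - int n + 1..int j} (fourier (\<lambda>z. 1)) w
        = (\<Sum>m\<in>{int j - int n + 1..int j}. if 0 = m then w powi m else 0)"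
      unfolding trig_sum_def by (intro sum.cong) auto
    then show ?thesis using that by simp
  qed
  then have "(\<Sum>j<n. trig_sum {int j - int n + 1..int j} (fourier (\<lambda>z. 1)) w) / of_nat n = 1"
    using assms(2) by simp
  finally show ?thesis by (metis of_real_eq_1_iff)
qed

lemma fejer_kernel_bounded:
  assumes w: "norm w = 1"
  shows "AE z in circle. norm (fejer_kernel n (w * cnj z)) \<le> real n"
proof (rule AE_I2)
  fix z assume z: "z \<in> space circle"
  have "norm (\<Sum>k<n. (w * cnj z) ^ k) \<le> (\<Sum>k<n. 1)"
    using w z by (intro sum_norm_le) (simp add: norm_mult norm_power)
  then have "(norm (\<Sum>k<n. (w * cnj z) ^ k))\<^sup>2 \<le> (real n)\<^sup>2" by (intro power_mono) auto
  then have "fejer_kernel n (w * cnj z) \<le> (real n)\<^sup>2 / real n"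
    unfolding fejer_kernel_def by (intro divide_right_mono) auto
  then show "norm (fejer_kernel n (w * cnj z)) \<le> real n"
    using fejer_kernel_nonneg[of n "w * cnj z"] by (simp add: power2_eq_square split: if_splits)
qed

lemma integrable_mult_fejer_kernel:
  fixes f :: "complex \<Rightarrow> complex"
  assumes "integrable circle f" "norm w = 1"
  shows "integrable circle (\<lambda>z. f z * of_real (fejer_kernel n (w * cnj z)))"
  by (rule integrable_mult_bounded[where C = "real n"]) (use assms fejer_kernel_bounded[OF assms(2)] in auto)

lemma integrable_fejer_kernel:
  assumes "norm w = 1"
  shows "integrable circle (\<lambda>z. fejer_kernel n (w * cnj z))"
  by (rule integrable_circle_bounded[OF _ fejer_kernel_bounded[OF assms]]) simp

text \<open>Positivity of the kernel. It keeps \<open>exp\<close> of the negated means in the unit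
  disc even when \<open>f\<close> is unbounded.\<close>

lemma Re_fejer_mean_nonneg:
  assumes "integrable circle f" "norm w = 1" "AE z in circle. Re (f z) \<ge> 0"
  shows "Re (fejer_mean n f w) \<ge> 0"
proof -
  have "Re (fejer_mean n f w) = (LINT z|circle. Re (f z * of_real (fejer_kernel n (w * cnj z))))"
    unfolding fejer_mean_def by (rule integral_Re[symmetric, OF integrable_mult_fejer_kernel[OF assms(1,2)]])
  also have "\<dots> \<ge> 0"
    using assms(3) by (intro integral_nonneg_AE) (auto elim!: eventually_mono simp: fejer_kernel_nonneg)
  finally show ?thesis .
qed

lemma norm_fejer_mean_le:
  assumes f: "integrable circle f" and w: "norm w = 1" and C: "AE z in circle. norm (f z) \<le> C" and n: "n > 0"
  shows "norm (fejer_mean n f w) \<le> C"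
proof -
  have "norm (fejer_mean n f w) \<le> (LINT z|circle. norm (f z * of_real (fejer_kernel n (w * cnj z))))"
    unfolding fejer_mean_def by simp
  also have "\<dots> \<le> (LINT z|circle. C * fejer_kernel n (w * cnj z))"
  proof (rule integral_mono_AE)
    show "AE z in circle. norm (f z * of_real (fejer_kernel n (w * cnj z))) \<le> C * fejer_kernel n (w * cnj z)"
      using C by eventually_elim (simp add: norm_mult fejer_kernel_nonneg mult_right_mono)
  qed (use integrable_mult_fejer_kernel[OF f w] integrable_fejer_kernel[OF w] in auto)
  also have "\<dots> = C" by (simp add: integral_fejer_kernel[OF w n])
  finally show ?thesis .
qed

lemma norm_sum_sq_le:
  fixes a :: "'i \<Rightarrow> complex"
  shows "(norm (\<Sum>i\<in>I. a i))\<^sup>2 \<le> real (card I) * (\<Sum>i\<in>I. (norm (a i))\<^sup>2)"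
proof -
  have "(norm (\<Sum>i\<in>I. a i))\<^sup>2 \<le> (\<Sum>i\<in>I. norm (a i))\<^sup>2"
    by (intro power_mono norm_sum) auto
  also have "\<dots> \<le> real (card I) * (\<Sum>i\<in>I. (norm (a i))\<^sup>2)"
    using Cauchy_Schwarz_ineq_sum[of "\<lambda>_. 1" "\<lambda>i. norm (a i)" I] by simp
  finally show ?thesis .
qed

text \<open>Convexity of the square. It serves both Fejer means and averages over rotations.\<close>

lemma sqn_average_le:
  assumes "\<And>j. j < n \<Longrightarrow> g j \<in> L2 M"
  shows "sqn M (\<lambda>x. (\<Sum>j<n. g j x) / of_nat n) \<le> (\<Sum>j<n. sqn M (g j)) / real n"
proof -
  have sum: "(\<lambda>x. \<Sum>j<n. g j x) \<in> L2 M" by (rule L2_sum) (use assms in auto)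
  have "sqn M (\<lambda>x. \<Sum>j<n. g j x) \<le> (LINT x|M. real n * (\<Sum>j<n. (norm (g j x))\<^sup>2))"
    unfolding sqn_def
    using norm_sum_sq_le[of _ "{..<n}"] sum assms
    by (intro integral_mono)
       (auto intro!: L2_integrable_sq Bochner_Integration.integrable_sum integrable_mult_right simp del: integrable_mult_right_iff)
  also have "\<dots> = real n * (\<Sum>j<n. sqn M (g j))"
    using assms by (simp add: sqn_def L2_integrable_sq)
  finally have le: "sqn M (\<lambda>x. \<Sum>j<n. g j x) \<le> real n * (\<Sum>j<n. sqn M (g j))" .
  have "sqn M (\<lambda>x. (\<Sum>j<n. g j x) / of_nat n) = sqn M (\<lambda>x. inverse (of_nat n) * (\<Sum>j<n. g j x))"
    by (simp add: divide_inverse mult.commute)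
  also have "\<dots> = sqn M (\<lambda>x. \<Sum>j<n. g j x) / (real n)\<^sup>2"
    by (simp only: sqn_cmult) (simp add: norm_inverse divide_inverse power_inverse mult.commute)
  also have "\<dots> \<le> (\<Sum>j<n. sqn M (g j)) / real n"
    using le by (cases "n = 0") (auto simp: divide_simps power2_eq_square mult.commute mult.left_commute)
  finally show ?thesis .
qed

text \<open>The error is the average of the errors of the \<open>n\<close> windows: those containing
  \<open>{- d..d}\<close> do at least as well as a good partial sum, and the remaining ones are too
  few to matter.\<close>

theorem fejer_mean_tendsto:
  assumes f: "f \<in> L2 circle"
  shows "(\<lambda>n. sqn circle (\<lambda>z. fejer_mean n f z - f z)) \<longlonglongrightarrow> 0"
proof (rule LIMSEQ_I)
  fix r :: real assume r: "r > 0"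
  note fi = circle.L2_integrable[OF f]
  let ?T = "\<lambda>n j. trig_sum {int j - int n + 1..int j} (fourier f)"
  obtain d :: nat where d: "sqn circle (\<lambda>z. f z - trig_sum {- int d..int d} (fourier f) z) < r / 2"
    using LIMSEQ_D[OF fourier_series_tendsto[OF f], of "r / 2"] r by auto
  let ?S = "sqn circle f"
  \<comment> \<open>Chosen so that the at most \<open>2 * d\<close> bad windows, each costing at
    most \<open>sqn circle f\<close>, add less than \<open>r / 2\<close> after division by
    \<open>n\<close>.\<close>
  obtain N :: nat where N: "4 * real d * ?S / r < real N" using reals_Archimedean2 by blast
  have "sqn circle (\<lambda>z. fejer_mean n f z - f z) < r" if "n \<ge> Suc N" for n
  proof -
    have n: "n > 0" "real n > 0" using that by auto
    \<comment> \<open>The window \<open>{j - n + 1..j}\<close> contains \<open>{- d..d}\<close>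
      exactly when \<open>d \<le> j\<close> and \<open>j + d < n\<close>. Otherwise it is compared
      with the empty sum.\<close>
    have bound: "sqn circle (\<lambda>z. f z - ?T n j z) \<le> r / 2 + ?S * of_bool (j < d \<or> n \<le> j + d)" if "j < n" for j
    proof (cases "j < d \<or> n \<le> j + d")
      case True
      have "sqn circle (\<lambda>z. f z - ?T n j z) \<le> sqn circle (\<lambda>z. f z - trig_sum {} (fourier f) z)"
        by (rule trig_sum_best_approximation) (use f in auto)
      then show ?thesis using True r by (simp add: trig_sum_def)
    next
      case False
      then have "sqn circle (\<lambda>z. f z - ?T n j z) \<le> sqn circle (\<lambda>z. f z - trig_sum {- int d..int d} (fourier f) z)"
        by (intro trig_sum_best_approximation f) auto
      then show ?thesis using False d by simp
    qed
    have "sqn circle (\<lambda>z. fejer_mean n f z - f z) = sqn circle (\<lambda>z. (\<Sum>j<n. f z - ?T n j z) / of_nat n)"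
      unfolding sqn_def
    proof (rule Bochner_Integration.integral_cong[OF refl])
      fix z assume "z \<in> space circle"
      then have "fejer_mean n f z - f z = - ((\<Sum>j<n. f z - ?T n j z) / of_nat n)"
        using n by (simp add: fejer_mean_eq[OF _ fi] sum_subtractf diff_divide_distrib)
      then show "(norm (fejer_mean n f z - f z))\<^sup>2 = (norm ((\<Sum>j<n. f z - ?T n j z) / of_nat n))\<^sup>2"
        by (simp only: norm_minus_cancel)
    qed
    also have "\<dots> \<le> (\<Sum>j<n. sqn circle (\<lambda>z. f z - ?T n j z)) / real n"
      by (rule sqn_average_le) (intro L2_diff f L2_trig_sum)
    also have "\<dots> \<le> (\<Sum>j<n. r / 2 + ?S * of_bool (j < d \<or> n \<le> j + d)) / real n"
      using bound by (intro divide_right_mono sum_mono) auto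
    also have "\<dots> = r / 2 + ?S * card {j. j < n \<and> (j < d \<or> n \<le> j + d)} / real n"
    proof -
      have "(\<Sum>j<n. of_bool (j < d \<or> n \<le> j + d) :: real) = card {j. j < n \<and> (j < d \<or> n \<le> j + d)}"
        by (subst sum_of_bool_eq) (auto intro!: arg_cong[where f = card])
      note card = this
      show ?thesis
        unfolding sum.distrib sum_distrib_left[symmetric] card using n by (simp add: add_divide_distrib)
    qed
    also have "\<dots> \<le> r / 2 + ?S * (2 * real d) / real n"
    proof -
      have "card {j. j < n \<and> (j < d \<or> n \<le> j + d)} \<le> card ({..<d} \<union> {n - d..<n})"
        by (rule card_mono) auto
      also have "\<dots> \<le> d + d"
        by (rule order_trans[OF card_Un_le]) auto
      finally have "real (card {j. j < n \<and> (j < d \<or> n \<le> j + d)}) \<le> 2 * real d" by linarith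
      then show ?thesis using n by (intro add_left_mono divide_right_mono mult_left_mono) auto
    qed
    also have "\<dots> < r"
    proof -
      have "4 * real d * ?S < real N * r" using N r by (simp add: field_simps)
      also have "\<dots> \<le> real n * r" using that r by (intro mult_right_mono) auto
      finally show ?thesis using n by (simp add: field_simps)
    qed
    finally show ?thesis .
  qed
  then show "\<exists>no. \<forall>n\<ge>no. norm (sqn circle (\<lambda>z. fejer_mean n f z - f z) - 0) < r" by auto
qed

lemma fejer_mean_poly:
  assumes "integrable circle f" "\<And>m. m < 0 \<Longrightarrow> fourier f m = 0"
  obtains p where "\<And>w. norm w = 1 \<Longrightarrow> fejer_mean n f w = poly p w"
proof -
  define p where "p = smult (inverse (of_nat n)) (\<Sum>j<n. \<Sum>m\<le>j. monom (fourier f (int m)) m)"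
  have "trig_sum {int j - int n + 1..int j} (fourier f) w = (\<Sum>m\<le>j. fourier f (int m) * w ^ m)" if "j < n" for j w
  proof -
    have "trig_sum {int j - int n + 1..int j} (fourier f) w = (\<Sum>m\<in>int ` {..j}. fourier f m * w powi m)"
      unfolding trig_sum_def
    proof (rule sum.mono_neutral_right)
      show "\<forall>m\<in>{int j - int n + 1..int j} - int ` {..j}. fourier f m * w powi m = 0"
      proof
        fix m assume m: "m \<in> {int j - int n + 1..int j} - int ` {..j}"
        have "m < 0"
        proof (rule ccontr)
          assume "\<not> m < 0"
          then have "m = int (nat m)" "nat m \<le> j" using m by auto
          then show False using m by blast
        qed
        then show "fourier f m * w powi m = 0" using assms(2) by simp
      qed
    qed (use that in auto)
    then show ?thesis by (simp add: sum.reindex)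
  qed
  then have "fejer_mean n f w = poly p w" if "norm w = 1" for w
    using that by (simp add: fejer_mean_eq[OF _ assms(1)] p_def poly_sum poly_monom divide_inverse mult.commute)
  then show ?thesis using that by blast
qed

section \<open>Outer multipliers\<close>

lemma fourier_cnj: "fourier (\<lambda>z. cnj (f z)) m = cnj (fourier f (- m))"
proof -
  have "fourier (\<lambda>z. cnj (f z)) m = (LINT z|circle. cnj (f z * z powi (- (- m))))"
    unfolding fourier_def
  proof (rule Bochner_Integration.integral_cong[OF refl])
    fix z assume "z \<in> space circle"
    then have "cnj (z powi m) = z powi (- m)" by (intro cnj_power_int) simp
    then show "cnj (f z) * z powi (- m) = cnj (f z * z powi (- (- m)))" by simp
  qed
  also have "\<dots> = cnj (LINT z|circle. f z * z powi (- (- m)))"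
    by (rule Bochner_Integration.integral_cnj)
  finally show ?thesis unfolding fourier_def .
qed

text \<open>\<open>F\<close> is \<open>u\<close> plus \<open>\<i>\<close> times its conjugate
  function. For real \<open>u\<close> the coefficients at \<open>m\<close> and \<open>- m\<close>
  are conjugate, so \<open>F + cnj F\<close> and \<open>2 * u\<close> have the same Fourier series.
  The constant 4 comes from coefficients being at most doubled.\<close>

lemma analytic_completion:
  fixes u :: "complex \<Rightarrow> real"
  assumes u: "(\<lambda>z. complex_of_real (u z)) \<in> L2 circle"
  obtains F where "F \<in> L2 circle" "\<And>m. m < 0 \<Longrightarrow> fourier F m = 0" "AE z in circle. Re (F z) = u z"
    "sqn circle F \<le> 4 * sqn circle (\<lambda>z. complex_of_real (u z))"
proof -
  let ?u = "\<lambda>z. complex_of_real (u z)"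
  \<comment> \<open>The coefficient at 0 is not doubled, since it occurs in both \<open>F\<close>
    and \<open>cnj F\<close>.\<close>
  define c where "c m = (if m = 0 then fourier ?u 0 else if m < 0 then 0 else 2 * fourier ?u m)" for m
  have bd: "(\<Sum>m\<in>A. (norm (c m))\<^sup>2) \<le> 4 * sqn circle ?u" if "finite A" for A
  proof -
    have "(\<Sum>m\<in>A. (norm (c m))\<^sup>2) \<le> (\<Sum>m\<in>A. 4 * (norm (fourier ?u m))\<^sup>2)"
      by (rule sum_mono) (auto simp: c_def norm_mult power_mult_distrib)
    also have "\<dots> = 4 * (\<Sum>m\<in>A. (norm (fourier ?u m))\<^sup>2)" by (simp add: sum_distrib_left)
    also have "\<dots> \<le> 4 * sqn circle ?u" using Bessel[OF that u] by simp
    finally show ?thesis .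
  qed
  from Riesz_Fischer[OF bd] obtain F where F: "F \<in> L2 circle" "\<And>m. fourier F m = c m"
    "sqn circle F \<le> 4 * sqn circle ?u" by blast
  note int = circle.L2_integrable[OF F(1)] circle.L2_integrable[OF u]
  have real: "cnj (fourier ?u (- m)) = fourier ?u m" for m
    using fourier_cnj[of ?u m] by simp
  have "fourier (\<lambda>z. (F z + cnj (F z)) - 2 * ?u z) m = 0" for m
  proof -
    have "fourier (\<lambda>z. (F z + cnj (F z)) - 2 * ?u z) m = c m + cnj (c (- m)) - 2 * fourier ?u m"
      using int by (simp add: fourier_diff fourier_add fourier_cmult fourier_cnj F(2))
    also have "\<dots> = 0"
      using real[of m] by (cases m "0::int" rule: linorder_cases) (auto simp: c_def)
    finally show ?thesis .
  qed
  then have "AE z in circle. (F z + cnj (F z)) - 2 * ?u z = 0"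
    using int by (intro fourier_unique) auto
  then have "AE z in circle. Re (F z) = u z"
    by eventually_elim (simp add: complex_eq_iff)
  then show ?thesis using that F by (auto simp: c_def)
qed

text \<open>The class is tailored to multiplication on closed invariant subspaces: the uniform bound
  and the a.e. limit are what dominated convergence for \<open>ext_norm \<alpha>\<close> consumes.
  It contains \<open>Hinf\<close> and the exponentials constructed below.\<close>

definition bounded_poly_limit :: "(complex \<Rightarrow> complex) \<Rightarrow> bool" where
  "bounded_poly_limit g \<longleftrightarrow> g \<in> borel_measurable circle \<and>
    (\<exists>p C. (\<forall>n. \<forall>z\<in>sphere 0 1. norm (poly (p n) z) \<le> C) \<and>
      (AE z in circle. (\<lambda>n::nat. poly (p n) z) \<longlonglongrightarrow> g z))"

lemma poly_measurable_circle [measurable]: "poly p \<in> borel_measurable circle"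
  by (rule borel_measurable_circle_continuous) (intro continuous_intros)

lemma bounded_poly_limit_bounded:
  assumes "bounded_poly_limit g"
  obtains C where "AE z in circle. norm (g z) \<le> C"
proof -
  from assms obtain p C where C: "\<And>n z. z \<in> sphere 0 1 \<Longrightarrow> norm (poly (p n) z) \<le> C"
    and lim: "AE z in circle. (\<lambda>n::nat. poly (p n) z) \<longlonglongrightarrow> g z"
    unfolding bounded_poly_limit_def by blast
  have "AE z in circle. norm (g z) \<le> C"
    using lim AE_space
  proof eventually_elim
    case (elim z)
    then show ?case using C[of z] by (intro LIMSEQ_le_const2[OF tendsto_norm[OF elim(1)]]) auto
  qed
  then show ?thesis by (rule that)
qed

lemma fejer_mean_poly_seq:
  assumes f: "f \<in> L2 circle" "\<forall>m<0. fourier f m = 0"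
  shows "\<exists>p N. (\<forall>n::nat. 0 < N n) \<and> (\<forall>n w. norm w = 1 \<longrightarrow> poly (p n) w = fejer_mean (N n) f w) \<and>
    (AE z in circle. (\<lambda>n. poly (p n) z) \<longlonglongrightarrow> f z)"
proof -
  note int = circle.L2_integrable[OF f(1)]
  \<comment> \<open>The shift avoids order 0, at which the kernel is identically 0 instead of having
    integral 1.\<close>
  have lim: "(\<lambda>n. sqn circle (\<lambda>z. fejer_mean (Suc n) f z - f z)) \<longlonglongrightarrow> 0"
    using fejer_mean_tendsto[OF f(1)] by (rule LIMSEQ_Suc)
  obtain r where r: "strict_mono r" "AE z in circle. (\<lambda>n. fejer_mean (Suc (r n)) f z) \<longlonglongrightarrow> f z"
    by (rule circle.AE_subseq_of_sqn[OF L2_fejer_mean[OF int] f(1) lim])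
  have "\<exists>p. \<forall>w. norm w = 1 \<longrightarrow> poly p w = fejer_mean (Suc (r n)) f w" for n
    using fejer_mean_poly[OF int, of "Suc (r n)"] f(2) by metis
  then obtain p where p: "\<And>n w. norm w = 1 \<Longrightarrow> poly (p n) w = fejer_mean (Suc (r n)) f w" by metis
  have "AE z in circle. (\<lambda>n. poly (p n) z) \<longlonglongrightarrow> f z"
    using r(2) AE_space by eventually_elim (simp add: p)
  then show ?thesis using p by (intro exI[of _ p] exI[of _ "\<lambda>n. Suc (r n)"]) simp
qed

lemma Hinf_imp_bounded_poly_limit:
  assumes "f \<in> Hinf"
  shows "bounded_poly_limit f"
proof -
  obtain C where f: "f \<in> borel_measurable circle" "AE z in circle. norm (f z) \<le> C"
    using assms by (auto simp: Hinf_def Linf_def)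
  have neg: "\<forall>m<0. fourier f m = 0"
    using assms by (simp add: Hinf_def fourier_def)
  note L2 = circle.L2_bounded[OF f]
  obtain p N where N: "\<And>n. N n > 0" and p: "\<And>n w. norm w = 1 \<Longrightarrow> poly (p n) w = fejer_mean (N n) f w"
    and lim: "AE z in circle. (\<lambda>n. poly (p n) z) \<longlonglongrightarrow> f z"
    using fejer_mean_poly_seq[OF L2 neg] by blast
  have "norm (poly (p n) z) \<le> C" if "z \<in> sphere 0 1" for n z
    using norm_fejer_mean_le[OF circle.L2_integrable[OF L2] _ f(2) N[of n], of z] that by (simp add: p)
  then show ?thesis
    unfolding bounded_poly_limit_def using f(1) lim by blast
qed

lemma exp_poly_approx:
  fixes p :: "complex poly"
  assumes e: "e > 0"
  obtains q where "\<And>z. norm z = 1 \<Longrightarrow> norm (exp (poly p z) - poly q z) < e"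
proof -
  have "compact (poly p ` sphere 0 1)"
    by (intro compact_continuous_image continuous_intros) auto
  then obtain B where "\<forall>x\<in>poly p ` sphere 0 1. norm x \<le> B"
    using compact_imp_bounded bounded_iff by blast
  then have B: "norm (poly p z) \<le> B" if "norm z = 1" for z
    using that by simp
  have B0: "B \<ge> 0" using B[of 1] order_trans[OF norm_ge_zero] by force
  have "(\<lambda>n. exp B * B * (B ^ n / fact n)) \<longlonglongrightarrow> exp B * B * 0"
    using summable_LIMSEQ_zero[OF summable_exp[of B]] by (intro tendsto_intros) (simp add: field_simps)
  then have "\<forall>\<^sub>F n in sequentially. exp B * B * (B ^ n / fact n) < e"
    by (rule order_tendstoD) (use e in simp)
  then obtain n where n: "exp B * B * (B ^ n / fact n) < e"
    by (auto simp: eventually_sequentially)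
  define q where "q = (\<Sum>i\<le>n. smult (1 / fact i) (p ^ i))"
  have "norm (exp (poly p z) - poly q z) < e" if "norm z = 1" for z
  proof -
    have "poly q z = (\<Sum>i\<le>n. poly p z ^ i / fact i)"
      by (simp add: q_def poly_sum poly_power)
    then have "norm (exp (poly p z) - poly q z) \<le> exp (norm (poly p z)) * (norm (poly p z) ^ Suc n) / fact n"
      using Taylor_exp_field[of "poly p z" n] by simp
    also have "\<dots> \<le> exp B * (B ^ Suc n) / fact n"
      using B[OF that] B0 by (intro divide_right_mono mult_mono power_mono) auto
    also have "\<dots> < e" using n by simp
    finally show ?thesis .
  qed
  then show ?thesis by (rule that)
qed

text \<open>\<open>F\<close> may be unbounded, and so its Fejer means need not be uniformly bounded;
  but their real parts are nonnegative, so the exponentials have modulus at most 1. Polynomials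
  within \<open>1 / (n + 1)\<close> of them are then bounded by 2 and have the same a.e.
  limit.\<close>

lemma bounded_poly_limit_exp:
  assumes F: "F \<in> L2 circle" "\<forall>m<0. fourier F m = 0" and pos: "AE z in circle. Re (F z) \<ge> 0"
  shows "bounded_poly_limit (\<lambda>z. exp (- F z))"
proof -
  obtain p N where N: "\<And>n. N n > 0" and p: "\<And>n w. norm w = 1 \<Longrightarrow> poly (p n) w = fejer_mean (N n) F w"
    and lim: "AE z in circle. (\<lambda>n. poly (p n) z) \<longlonglongrightarrow> F z"
    using fejer_mean_poly_seq[OF F] by blast
  have "\<exists>q. \<forall>z. norm z = 1 \<longrightarrow> norm (exp (- poly (p n) z) - poly q z) < inverse (of_nat (Suc n))" for n
    using exp_poly_approx[of "inverse (of_nat (Suc n))" "- p n"] by (metis inverse_positive_iff_positive of_nat_0_less_iff poly_minus zero_less_Suc)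
  then obtain q where q: "\<And>n z. norm z = 1 \<Longrightarrow> norm (exp (- poly (p n) z) - poly (q n) z) < inverse (of_nat (Suc n))"
    by metis
  have "norm (poly (q n) z) \<le> 2" if z: "z \<in> sphere 0 1" for n z
  proof -
    have "Re (poly (p n) z) \<ge> 0"
      using Re_fejer_mean_nonneg[OF circle.L2_integrable[OF F(1)] _ pos] z by (simp add: p)
    then have "norm (exp (- poly (p n) z)) \<le> 1" by simp
    moreover have "norm (exp (- poly (p n) z) - poly (q n) z) < inverse (of_nat (Suc n))"
      using q z by simp
    moreover have "inverse (of_nat (Suc n)) \<le> (1::real)" by (simp add: field_simps)
    ultimately show ?thesis
      using norm_triangle_sub[of "poly (q n) z" "exp (- poly (p n) z)"]
        norm_minus_commute[of "poly (q n) z" "exp (- poly (p n) z)"] by linarith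
  qed
  moreover have "AE z in circle. (\<lambda>n. poly (q n) z) \<longlonglongrightarrow> exp (- F z)"
    using lim AE_space
  proof eventually_elim
    case (elim z)
    have "(\<lambda>n. exp (- poly (p n) z) - poly (q n) z) \<longlonglongrightarrow> 0"
      by (rule Lim_null_comparison[OF _ LIMSEQ_inverse_real_of_nat])
         (use q elim(2) in \<open>auto intro!: always_eventually less_imp_le\<close>)
    from tendsto_diff[OF tendsto_exp[OF tendsto_minus[OF elim(1)]] this] show ?case by simp
  qed
  moreover have "(\<lambda>z. exp (- F z)) \<in> borel_measurable circle"
    using F(1) by (auto dest: L2_measurable intro!: borel_measurable_continuous_on[of exp] continuous_intros)
  ultimately show ?thesis
    unfolding bounded_poly_limit_def by blast
qed

text \<open>The functions \<open>g\<^sub>n\<close> are the boundary values of outer functions of modulus \<open>exp (- u\<^sub>n)\<close>.\<close>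

lemma outer_multipliers:
  fixes u :: "nat \<Rightarrow> complex \<Rightarrow> real"
  assumes L2: "\<And>n. (\<lambda>z. complex_of_real (u n z)) \<in> L2 circle" and pos: "\<And>n. AE z in circle. u n z \<ge> 0"
    and lim: "(\<lambda>n. sqn circle (\<lambda>z. complex_of_real (u n z))) \<longlonglongrightarrow> 0"
  obtains g :: "nat \<Rightarrow> complex \<Rightarrow> complex" and r :: "nat \<Rightarrow> nat"
  where "\<And>n. bounded_poly_limit (g n)" "\<And>n. AE z in circle. norm (g n z) = exp (- u n z)"
    "strict_mono r" "AE z in circle. (\<lambda>n. g (r n) z) \<longlonglongrightarrow> 1"
proof -
  let ?u = "\<lambda>n z. complex_of_real (u n z)"
  have "\<exists>F. F \<in> L2 circle \<and> (\<forall>m<0. fourier F m = 0) \<and> (AE z in circle. Re (F z) = u n z) \<and>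
      sqn circle F \<le> 4 * sqn circle (?u n)" for n
    using analytic_completion[OF L2[of n]] by metis
  then obtain F where F: "\<And>n. F n \<in> L2 circle" "\<And>n. \<forall>m<0. fourier (F n) m = 0"
      "\<And>n. AE z in circle. Re (F n z) = u n z" "\<And>n. sqn circle (F n) \<le> 4 * sqn circle (?u n)"
    by metis
  have "(\<lambda>n. sqn circle (\<lambda>z. F n z - 0)) \<longlonglongrightarrow> 0"
  proof (rule tendsto_sandwich[OF _ _ tendsto_const])
    show "(\<lambda>n. 4 * sqn circle (?u n)) \<longlonglongrightarrow> 0" using tendsto_mult_left[OF lim, of 4] by simp
  qed (use F(4) in auto)
  then obtain r where r: "strict_mono r" "AE z in circle. (\<lambda>n. F (r n) z) \<longlonglongrightarrow> 0"
    by (rule circle.AE_subseq_of_sqn[OF F(1) L2_zero])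
  show ?thesis
  proof (rule that[of "\<lambda>n z. exp (- F n z)" r])
    show "bounded_poly_limit (\<lambda>z. exp (- F n z))" for n
      using F(3)[of n] pos[of n] by (intro bounded_poly_limit_exp F) (auto elim: eventually_elim2)
    show "AE z in circle. norm (exp (- F n z)) = exp (- u n z)" for n
      using F(3)[of n] by eventually_elim simp
    show "AE z in circle. (\<lambda>n. exp (- F (r n) z)) \<longlonglongrightarrow> 1"
      using r(2)
    proof eventually_elim
      case (elim z)
      from tendsto_exp[OF tendsto_minus[OF this]] show ?case by simp
    qed
  qed (fact r)
qed

section \<open>Norm estimates for bounded functions\<close>

lemma Linf_measurable [measurable_dest]: "f \<in> Linf \<Longrightarrow> f \<in> borel_measurable circle"
  by (simp add: Linf_def)

lemma LinfI: "f \<in> borel_measurable circle \<Longrightarrow> AE z in circle. norm (f z) \<le> C \<Longrightarrow> f \<in> Linf"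
  by (auto simp: Linf_def)

lemma LinfE:
  assumes "f \<in> Linf"
  obtains C where "C > 0" "AE z in circle. norm (f z) \<le> C"
proof -
  from assms obtain C where "AE z in circle. norm (f z) \<le> C" by (auto simp: Linf_def)
  then have "AE z in circle. norm (f z) \<le> max C 1" by eventually_elim simp
  then show ?thesis by (intro that[of "max C 1"]) auto
qed

lemma Linf_add: "f \<in> Linf \<Longrightarrow> g \<in> Linf \<Longrightarrow> (\<lambda>z. f z + g z) \<in> Linf"
proof -
  assume f: "f \<in> Linf" and g: "g \<in> Linf"
  obtain C where C: "AE z in circle. norm (f z) \<le> C" using f by (rule LinfE)
  obtain D where D: "AE z in circle. norm (g z) \<le> D" using g by (rule LinfE)
  have "AE z in circle. norm (f z + g z) \<le> C + D"
    using C D by eventually_elim (metis norm_add_rule_thm norm_triangle_mono)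
  then show ?thesis using f g by (intro LinfI) auto
qed

lemma Linf_mult: "f \<in> Linf \<Longrightarrow> g \<in> Linf \<Longrightarrow> (\<lambda>z. f z * g z) \<in> Linf"
proof -
  assume f: "f \<in> Linf" and g: "g \<in> Linf"
  obtain C where C: "C > 0" "AE z in circle. norm (f z) \<le> C" using f by (rule LinfE)
  obtain D where D: "D > 0" "AE z in circle. norm (g z) \<le> D" using g by (rule LinfE)
  have "AE z in circle. norm (f z * g z) \<le> C * D"
    using C(2) D(2) by eventually_elim (use C(1) in \<open>simp add: norm_mult mult_mono\<close>)
  then show ?thesis using f g by (intro LinfI) auto
qed

lemma Linf_const: "(\<lambda>z. c) \<in> Linf"
  by (rule LinfI[where C = "norm c"]) auto

lemma Linf_cmult: "f \<in> Linf \<Longrightarrow> (\<lambda>z. c * f z) \<in> Linf"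
  by (rule Linf_mult[OF Linf_const])

lemma Linf_diff: "f \<in> Linf \<Longrightarrow> g \<in> Linf \<Longrightarrow> (\<lambda>z. f z - g z) \<in> Linf"
  using Linf_add[of f "\<lambda>z. (-1) * g z"] Linf_cmult[of g "-1"] by simp

lemma Linf_sum: "(\<And>i. i \<in> I \<Longrightarrow> f i \<in> Linf) \<Longrightarrow> (\<lambda>z. \<Sum>i\<in>I. f i z) \<in> Linf"
  by (induction I rule: infinite_finite_induct) (auto simp: Linf_const Linf_add)

lemma Linf_norm: "f \<in> Linf \<Longrightarrow> (\<lambda>z. complex_of_real (norm (f z))) \<in> Linf"
  by (auto simp: Linf_def)

lemma Linf_mono:
  assumes "f \<in> borel_measurable circle" "g \<in> Linf" "AE z in circle. norm (f z) \<le> norm (g z)"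
  shows "f \<in> Linf"
proof -
  obtain C where "AE z in circle. norm (g z) \<le> C" using assms(2) by (rule LinfE)
  with assms(3) have "AE z in circle. norm (f z) \<le> C" by eventually_elim simp
  then show ?thesis by (rule LinfI[OF assms(1)])
qed

lemma Linf_indicator: "E \<in> sets circle \<Longrightarrow> indicator E \<in> Linf"
  by (rule LinfI[where C = 1]) (auto simp: indicator_def)

lemma Linf_simple_function:
  assumes "simple_function circle f"
  shows "f \<in> Linf"
proof (rule LinfI)
  show "f \<in> borel_measurable circle" using assms by (rule borel_measurable_simple_function)
  have fin: "finite (f ` space circle)" using assms by (rule simple_functionD)
  show "AE z in circle. norm (f z) \<le> Max ((\<lambda>w. norm w) ` f ` space circle)"
    by (rule AE_I2) (intro Max_ge finite_imageI fin imageI)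
qed

lemma Linf_imp_L2: "f \<in> Linf \<Longrightarrow> f \<in> L2 circle"
  by (auto simp: Linf_def intro: circle.L2_bounded)

lemma Linf_integrable: "f \<in> Linf \<Longrightarrow> integrable circle f"
  by (rule circle.L2_integrable[OF Linf_imp_L2])

lemma Linf_rotation:
  assumes "f \<in> Linf" "w \<in> sphere 0 1"
  shows "(\<lambda>z. f (w * z)) \<in> Linf"
proof -
  obtain C where "AE z in circle. norm (f z) \<le> C" using assms(1) by (rule LinfE)
  from AE_rotation[OF assms(2) this] show ?thesis
    using measurable_compose[OF rotation_measurable[OF assms(2)] Linf_measurable[OF assms(1)]]
    by (rule LinfI[rotated])
qed

lemma Linf_poly: "poly p \<in> Linf"
proof -
  have "compact (poly p ` sphere 0 1)"
    by (intro compact_continuous_image continuous_intros) auto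
  then obtain B where "\<forall>x\<in>poly p ` sphere 0 1. norm x \<le> B"
    using compact_imp_bounded bounded_iff by blast
  then show ?thesis by (intro LinfI[where C = B]) auto
qed

section \<open>Averages over roots of unity\<close>

definition rotation_average :: "nat \<Rightarrow> (complex \<Rightarrow> complex) \<Rightarrow> complex \<Rightarrow> complex" where
  "rotation_average N f z = (\<Sum>k<N. f (cnj (cis (2 * pi * real k / real N)) * z)) / of_nat N"

text \<open>A geometric sum whose ratio is an \<open>N\<close>-th root of unity; the ratio differs
  from 1 because \<open>N\<close> does not divide \<open>m\<close>.\<close>

lemma sum_roots_of_unity:
  assumes "m \<noteq> 0" "\<bar>m\<bar> < int N"
  shows "(\<Sum>k<N. cnj (cis (2 * pi * real k / real N)) powi m) = 0"
proof -
  define x where "x = 2 * pi * of_int (- m) / real N"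
  have N: "N > 0" using assms by auto
  have eq: "cnj (cis (2 * pi * real k / real N)) powi m = cis x ^ k" for k
    by (simp add: cis_cnj cis_power_int Complex.DeMoivre x_def mult_ac)
  have "cis x ^ N = cis (2 * pi * of_int (- m))"
    using N by (simp add: Complex.DeMoivre x_def)
  also have "\<dots> = 1" by (rule cis_multiple_2pi) simp
  finally have one: "cis x ^ N = 1" .
  have ne: "cis x \<noteq> 1"
  proof
    assume "cis x = 1"
    then have "cos x = 1" by (metis cis.simps(1) one_complex.simps(1))
    then obtain j :: int where j: "x = of_int j * 2 * pi" using cos_one_2pi_int by blast
    then have "pi * real_of_int (- m) = pi * real_of_int (j * int N)"
      using N by (simp add: x_def field_simps)
    then have "real_of_int (- m) = real_of_int (j * int N)"
      by (simp only: mult_cancel_left pi_neq_zero)  simp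
    then have "- m = j * int N" by (simp only: of_int_eq_iff)
    then have "\<bar>m\<bar> = \<bar>j\<bar> * int N" by (metis abs_minus_cancel abs_mult abs_of_nat)
    moreover have "j \<noteq> 0" using \<open>- m = j * int N\<close> assms(1) by auto
    then have "\<bar>j\<bar> \<ge> 1" by linarith
    ultimately have "\<bar>m\<bar> \<ge> int N" using mult_right_mono[of 1 "\<bar>j\<bar>" "int N"] by simp
    then show False using assms(2) by simp
  qed
  show ?thesis unfolding eq using ne one by (simp add: geometric_sum)
qed

lemma rotation_average_diff:
  "rotation_average N (\<lambda>z. f z - g z) z = rotation_average N f z - rotation_average N g z"
  by (simp add: rotation_average_def sum_subtractf diff_divide_distrib)

lemma rotation_average_trig_sum:
  assumes "d < N"
  shows "rotation_average N (trig_sum {- int d..int d} c) z = c 0"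
proof -
  have "rotation_average N (trig_sum {- int d..int d} c) z =
      (\<Sum>m\<in>{- int d..int d}. c m * z powi m * (\<Sum>k<N. cnj (cis (2 * pi * real k / real N)) powi m)) / of_nat N"
    unfolding rotation_average_def trig_sum_def
    by (subst sum.swap) (simp add: power_int_mult_distrib sum_distrib_left mult_ac)
  also have "(\<Sum>m\<in>{- int d..int d}. c m * z powi m * (\<Sum>k<N. cnj (cis (2 * pi * real k / real N)) powi m))
      = (\<Sum>m\<in>{- int d..int d}. if m = 0 then c 0 * of_nat N else 0)"
    using assms by (intro sum.cong refl) (auto simp: sum_roots_of_unity)
  finally show ?thesis using assms by simp
qed

lemma sqn_rotation:
  assumes "w \<in> sphere 0 1" "f \<in> borel_measurable circle"
  shows "sqn circle (\<lambda>z. f (w * z)) = sqn circle f"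
  unfolding sqn_def using assms(2) by (intro integral_rotation[OF assms(1)]) simp

lemma L2_rotation:
  assumes "w \<in> sphere 0 1" "f \<in> L2 circle"
  shows "(\<lambda>z. f (w * z)) \<in> L2 circle"
  using integrable_rotation[OF assms(1), of "\<lambda>z. (norm (f z))\<^sup>2"] assms(2)
    measurable_compose[OF rotation_measurable[OF assms(1)] L2_measurable[OF assms(2)]]
  by (simp add: L2_def)

lemma rotation_average_alt:
  "rotation_average N f = (\<lambda>z. inverse (of_nat N) * (\<Sum>k<N. f (cnj (cis (2 * pi * real k / real N)) * z)))"
  by (rule ext) (simp only: rotation_average_def divide_inverse_commute)

lemma L2_rotation_average:
  assumes "f \<in> L2 circle"
  shows "rotation_average N f \<in> L2 circle"
  unfolding rotation_average_alt by (intro L2_cmult L2_sum L2_rotation assms) simp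

lemma sqn_rotation_average_le:
  assumes "f \<in> L2 circle" "N > 0"
  shows "sqn circle (rotation_average N f) \<le> sqn circle f"
proof -
  have "sqn circle (rotation_average N f) \<le> (\<Sum>k<N. sqn circle (\<lambda>z. f (cnj (cis (2 * pi * real k / real N)) * z))) / real N"
    unfolding rotation_average_def[abs_def] by (rule sqn_average_le) (intro L2_rotation assms, simp)
  also have "\<dots> = sqn circle f"
    using assms by (simp add: sqn_rotation L2_measurable)
  finally show ?thesis .
qed

text \<open>For \<open>N > d\<close> the average reduces a trigonometric polynomial of degree at
  most \<open>d\<close> to its constant term. The remainder of \<open>f\<close> is small in L^2, and
  averaging does not enlarge it.\<close>

lemma rotation_average_tendsto:
  assumes f: "f \<in> L2 circle"
  shows "(\<lambda>N. sqn circle (\<lambda>z. rotation_average N f z - fourier f 0)) \<longlonglongrightarrow> 0"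
proof (rule LIMSEQ_I)
  fix r :: real assume r: "r > 0"
  let ?T = "\<lambda>d. trig_sum {- int d..int d} (fourier f)"
  obtain d :: nat where d: "sqn circle (\<lambda>z. f z - ?T d z) < r"
    using LIMSEQ_D[OF fourier_series_tendsto[OF f] r] by auto
  have "sqn circle (\<lambda>z. rotation_average N f z - fourier f 0) < r" if "N \<ge> Suc d" for N
  proof -
    have "sqn circle (\<lambda>z. rotation_average N f z - fourier f 0) = sqn circle (rotation_average N (\<lambda>z. f z - ?T d z))"
      using that by (simp add: rotation_average_diff[abs_def] rotation_average_trig_sum)
    also have "\<dots> \<le> sqn circle (\<lambda>z. f z - ?T d z)"
      using that by (intro sqn_rotation_average_le L2_diff f L2_trig_sum) auto
    finally show ?thesis using d by simp
  qed
  then show "\<exists>no. \<forall>n\<ge>no. norm (sqn circle (\<lambda>z. rotation_average n f z - fourier f 0) - 0) < r" by auto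
qed

section \<open>Consequences of the axioms of \<open>\<alpha>\<close> on bounded functions\<close>

context continuous_rotationally_symmetric_norm
begin

lemma alpha_zero: "\<alpha> (\<lambda>z. 0) = 0"
  by (subst definite) (auto simp: Linf_const)

lemma alpha_nonneg: "f \<in> Linf \<Longrightarrow> 0 \<le> \<alpha> f"
  using triangle[of f "\<lambda>z. (-1) * f z"] scale[of f "-1"] Linf_cmult[of f "-1"] alpha_zero by simp

lemma alpha_cong_AE:
  assumes f: "f \<in> Linf" and g: "g \<in> Linf" and eq: "AE z in circle. f z = g z"
  shows "\<alpha> f = \<alpha> g"
proof -
  have le: "\<alpha> f \<le> \<alpha> g" if f: "f \<in> Linf" and g: "g \<in> Linf" and eq: "AE z in circle. f z = g z" for f g
  proof -
    have "\<alpha> (\<lambda>z. f z - g z) = 0"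
      using eq by (subst definite[OF Linf_diff[OF f g]]) (auto elim: eventually_mono)
    then show ?thesis using triangle[OF g Linf_diff[OF f g]] by simp
  qed
  have "AE z in circle. g z = f z" using eq by eventually_elim simp
  then show ?thesis using le[OF f g eq] le[OF g f] by simp
qed

text \<open>A real number \<open>h \<in> [0,1]\<close> is the mean of the two unimodular numbers with real part \<open>h\<close>.\<close>

lemma alpha_mono:
  assumes f: "f \<in> Linf" and g: "g \<in> Linf" and le: "AE z in circle. norm (f z) \<le> norm (g z)"
  shows "\<alpha> f \<le> \<alpha> g"
proof -
  have [measurable]: "f \<in> borel_measurable circle" "g \<in> borel_measurable circle" using f g by auto
  define h where "h z = min 1 (norm (f z) / norm (g z))" for z
  define u where "u z = Complex (h z) (sqrt (1 - (h z)\<^sup>2))" for z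
  have [measurable]: "h \<in> borel_measurable circle" unfolding h_def by measurable
  have u_eq: "u z = of_real (h z) + \<i> * of_real (sqrt (1 - (h z)\<^sup>2))" for z
    by (simp add: u_def complex_eq_iff)
  have [measurable]: "u \<in> borel_measurable circle" unfolding u_eq by measurable
  have h: "0 \<le> h z" "h z \<le> 1" for z by (auto simp: h_def)
  have "(norm (u z))\<^sup>2 = 1" for z
    using h[of z] by (simp add: u_def cmod_def abs_square_le_1)
  then have u1: "norm (u z) = 1" for z by (simp add: power2_eq_1_iff) (metis norm_ge_zero not_one_le_zero neg_0_le_iff_le)
  define p where "p z = of_real (norm (g z)) * u z" for z
  define q where "q z = of_real (norm (g z)) * cnj (u z)" for z
  have pq: "p \<in> Linf" "q \<in> Linf"
    unfolding p_def q_def by (intro Linf_mult Linf_norm g; rule LinfI[where C = 1]; simp add: u1)+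
  have "\<alpha> p = \<alpha> g" "\<alpha> q = \<alpha> g"
    using modulus[OF pq(1)] modulus[OF pq(2)] modulus[OF g] by (simp_all add: p_def q_def norm_mult u1)
  have "\<alpha> f = \<alpha> (\<lambda>z. of_real (norm (f z)))" by (rule modulus[OF f, symmetric])
  also have "\<dots> = \<alpha> (\<lambda>z. (1/2) * (p z + q z))"
  proof (rule alpha_cong_AE[OF Linf_norm[OF f] Linf_cmult[OF Linf_add[OF pq]]])
    show "AE z in circle. of_real (norm (f z)) = (1/2) * (p z + q z)"
      using le
    proof eventually_elim
      case (elim z)
      have "p z + q z = of_real (norm (g z)) * of_real (2 * h z)"
        unfolding p_def q_def distrib_left[symmetric] by (simp add: u_def complex_eq_iff)
      moreover have "norm (g z) * h z = norm (f z)"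
        using elim by (cases "g z = 0") (auto simp: h_def min_def divide_simps)
      ultimately show ?case by (simp add: mult.left_commute flip: of_real_mult) simp
    qed
  qed
  also have "\<dots> \<le> (1/2) * (\<alpha> p + \<alpha> q)"
    using scale[OF Linf_add[OF pq], of "1/2"] triangle[OF pq] by simp
  finally show ?thesis using \<open>\<alpha> p = \<alpha> g\<close> \<open>\<alpha> q = \<alpha> g\<close> by simp
qed

lemma alpha_const: "\<alpha> (\<lambda>z. c) = norm c"
  using scale[OF Linf_const[of 1], of c] one by simp

lemma alpha_le_bound:
  assumes "f \<in> Linf" "AE z in circle. norm (f z) \<le> C" "0 \<le> C"
  shows "\<alpha> f \<le> C"
  using alpha_mono[OF assms(1) Linf_const[of "of_real C"]] assms by (simp add: alpha_const)

lemma alpha_sum_le: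
  "(\<And>i. i \<in> I \<Longrightarrow> f i \<in> Linf) \<Longrightarrow> \<alpha> (\<lambda>z. \<Sum>i\<in>I. f i z) \<le> (\<Sum>i\<in>I. \<alpha> (f i))"
proof (induction I rule: infinite_finite_induct)
  case (insert i I)
  then show ?case
    using triangle[of "f i" "\<lambda>z. \<Sum>i\<in>I. f i z"] Linf_sum[of I f] by fastforce
qed (auto simp: alpha_zero)

text \<open>The continuity axiom speaks of sets of positive measure; null sets are covered by
  definiteness.\<close>

lemma alpha_indicator_small:
  assumes "e > 0"
  obtains d where "d > 0" "\<And>E. E \<in> sets circle \<Longrightarrow> measure circle E < d \<Longrightarrow> \<alpha> (indicator E) < e"
proof -
  obtain d where d: "d > 0" "\<forall>E\<in>sets circle. 0 < measure circle E \<and> measure circle E < d \<longrightarrow> \<alpha> (indicator E) < e"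
    using continuous[OF assms] by blast
  have "\<alpha> (indicator E) < e" if E: "E \<in> sets circle" "measure circle E < d" for E
  proof (cases "measure circle E = 0")
    case True
    then have "E \<in> null_sets circle" using E by (simp add: circle.emeasure_eq_measure null_sets_def)
    then have "AE z in circle. z \<notin> E" by (rule AE_not_in)
    then have "AE z in circle. (indicator E z :: complex) = 0" by eventually_elim simp
    then show ?thesis using definite[OF Linf_indicator[OF E(1)]] assms by simp
  next
    case False
    then show ?thesis using d E by (simp add: zero_less_measure_iff circle.emeasure_eq_measure)
  qed
  then show ?thesis using that d by blast
qed

text \<open>The modulus of \<open>h n\<close> is at most \<open>e / 4\<close> off \<open>E n\<close>
  and at most \<open>D\<close> on it, and the measure of \<open>E n\<close> tends to 0. The
  threshold \<open>e / (4 * D)\<close> for the indicator makes the two parts contribute at most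
  \<open>e / 4\<close> each.\<close>

lemma alpha_bounded_convergence:
  assumes h: "\<And>n. h n \<in> borel_measurable circle" and C: "\<And>n. AE z in circle. norm (h n z) \<le> C"
    and lim: "AE z in circle. (\<lambda>n. h n z) \<longlonglongrightarrow> 0"
  shows "(\<lambda>n. \<alpha> (h n)) \<longlonglongrightarrow> 0"
proof (rule LIMSEQ_I)
  fix e :: real assume e: "e > 0"
  define D where "D = max C 1"
  have D: "D > 0" "AE z in circle. norm (h n z) \<le> D" for n
    using C[of n] by (auto simp: D_def elim: eventually_mono)
  have hL: "h n \<in> Linf" for n by (rule LinfI[OF h C])
  note [measurable] = h
  define E where "E n = {z \<in> space circle. norm (h n z) > e / 4}" for n
  have E: "E n \<in> sets circle" for n unfolding E_def by measurable
  have "e / (4 * D) > 0" using e D by simp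
  then obtain d where d: "d > 0" "\<And>E. E \<in> sets circle \<Longrightarrow> measure circle E < d \<Longrightarrow> \<alpha> (indicator E) < e / (4 * D)"
    by (rule alpha_indicator_small) blast
  have "(\<lambda>n. LINT z|circle. indicator (E n) z :: real) \<longlonglongrightarrow> (LINT z|circle. 0)"
  proof (rule integral_dominated_convergence[where w = "\<lambda>_. 1"])
    show "AE z in circle. (\<lambda>n. indicator (E n) z :: real) \<longlonglongrightarrow> 0"
      using lim
    proof eventually_elim
      case (elim z)
      have "e / 4 > 0" using e by simp
      from order_tendstoD(2)[OF tendsto_norm[OF elim], of "e/4"] this
      have "\<forall>\<^sub>F n in sequentially. norm (h n z) < e / 4" by simp
      then have "\<forall>\<^sub>F n in sequentially. (indicator (E n) z :: real) = 0"
        by eventually_elim (simp add: E_def indicator_def)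
      then show ?case by (rule tendsto_eventually)
    qed
    show "(\<lambda>z. indicator (E n) z :: real) \<in> borel_measurable circle" for n using E by simp
  qed (auto simp: indicator_def)
  moreover have "E n \<inter> sphere 0 1 = E n" for n by (auto simp: E_def)
  ultimately have "(\<lambda>n. measure circle (E n)) \<longlonglongrightarrow> 0" using E by simp
  from order_tendstoD(2)[OF this d(1)] obtain N where N: "\<And>n. n \<ge> N \<Longrightarrow> measure circle (E n) < d"
    by (auto simp: eventually_sequentially)
  have "\<alpha> (h n) < e" if "n \<ge> N" for n
  proof -
    have "\<alpha> (h n) \<le> \<alpha> (\<lambda>z. of_real (e / 4) + of_real D * indicator (E n) z)"
    proof (rule alpha_mono[OF hL])
      show "(\<lambda>z. of_real (e / 4) + of_real D * indicator (E n) z) \<in> Linf"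
        by (intro Linf_add Linf_const Linf_cmult Linf_indicator E)
      show "AE z in circle. norm (h n z) \<le> norm (of_real (e / 4) + of_real D * indicator (E n) z :: complex)"
        using D(2)[of n] AE_space
      proof eventually_elim
        case (elim z)
        have "norm (of_real (e / 4 + D * indicator (E n) z) :: complex) = e / 4 + D * indicator (E n) z"
          using e D(1) by (simp only: norm_of_real) (auto simp: indicator_def)
        moreover have "norm (h n z) \<le> e / 4 + D * indicator (E n) z"
          using elim e by (auto simp: E_def indicator_def)
        moreover have "(of_real (e / 4 + D * indicator (E n) z) :: complex) = of_real (e / 4) + of_real D * indicator (E n) z"
          by (simp add: indicator_def)
        ultimately show ?case by metis
      qed
    qed
    also have "\<dots> \<le> \<alpha> (\<lambda>z. of_real (e / 4)) + \<alpha> (\<lambda>z. of_real D * indicator (E n) z)"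
      by (intro triangle Linf_const Linf_cmult Linf_indicator E)
    also have "\<dots> = e / 4 + D * \<alpha> (indicator (E n))"
      using scale[OF Linf_indicator[OF E], of "of_real D" n] e D by (simp add: alpha_const)
    also have "\<dots> \<le> e / 4 + D * (e / (4 * D))"
      using d(2)[OF E N[OF that]] D by (intro add_left_mono mult_left_mono) auto
    also have "\<dots> < e" using D e by simp
    finally show ?thesis .
  qed
  then show "\<exists>no. \<forall>n\<ge>no. norm (\<alpha> (h n) - 0) < e"
    using alpha_nonneg[OF hL] by auto
qed

text \<open>Averages of \<open>f\<close> over the \<open>N\<close>-th roots of unity have norm at most \<open>\<alpha> f\<close> and tend to the mean
  of \<open>f\<close>; along an a.e. convergent subsequence, continuity of \<open>\<alpha>\<close> lets the inequality pass to the limit.\<close>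

lemma norm_integral_le_alpha:
  assumes f: "f \<in> Linf"
  shows "norm (LINT z|circle. f z) \<le> \<alpha> f"
proof -
  define c where "c = fourier f 0"
  note f2 = Linf_imp_L2[OF f]
  obtain C where C: "C > 0" "AE z in circle. norm (f z) \<le> C" using f by (rule LinfE)
  let ?rot = "\<lambda>N k z. f (cnj (cis (2 * pi * real k / real N)) * z)"
  have rotL: "?rot N k \<in> Linf" for N k by (rule Linf_rotation[OF f]) simp
  have AL: "rotation_average N f \<in> Linf" for N
    unfolding rotation_average_alt by (intro Linf_cmult Linf_sum rotL)
  have A_le: "\<alpha> (rotation_average N f) \<le> \<alpha> f" for N
  proof -
    have "\<alpha> (rotation_average N f) = \<alpha> (\<lambda>z. inverse (of_nat N) * (\<Sum>k<N. ?rot N k z))"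
      by (simp only: rotation_average_alt)
    also have "\<dots> = inverse (real N) * \<alpha> (\<lambda>z. \<Sum>k<N. ?rot N k z)"
      using scale[OF Linf_sum[of "{..<N}" "?rot N"]] rotL by (simp add: norm_inverse)
    also have "\<dots> \<le> inverse (real N) * (\<Sum>k<N. \<alpha> (?rot N k))"
      using rotL by (intro mult_left_mono alpha_sum_le) auto
    also have "\<dots> = inverse (real N) * (real N * \<alpha> f)"
      using rotation[OF f] by simp
    also have "\<dots> \<le> \<alpha> f" using alpha_nonneg[OF f] by (cases "N = 0") (auto simp: field_simps)
    finally show ?thesis .
  qed
  obtain r where r: "strict_mono r" "AE z in circle. (\<lambda>n. rotation_average (r n) f z) \<longlonglongrightarrow> c"
    using circle.AE_subseq_of_sqn[OF L2_rotation_average[OF f2] circle.L2_const rotation_average_tendsto[OF f2]]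
    unfolding c_def by blast
  have A_bd: "AE z in circle. norm (rotation_average N f z) \<le> C" for N
  proof -
    have "AE z in circle. \<forall>k\<in>{..<N}. norm (?rot N k z) \<le> C"
      by (rule AE_finite_allI) (auto intro: AE_rotation[OF _ C(2)])
    then show ?thesis
    proof eventually_elim
      case (elim z)
      have "norm (\<Sum>k<N. ?rot N k z) \<le> (\<Sum>k<N. C)" using elim by (intro sum_norm_le) auto
      then show ?case using C(1)
        by (cases "N = 0") (auto simp: rotation_average_def norm_divide field_simps)
    qed
  qed
  have "(\<lambda>n. \<alpha> (\<lambda>z. rotation_average (r n) f z - c)) \<longlonglongrightarrow> 0"
  proof (rule alpha_bounded_convergence)
    show "(\<lambda>z. rotation_average (r n) f z - c) \<in> borel_measurable circle" for n
      using AL[of "r n"] by (auto dest: Linf_measurable)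
    show "AE z in circle. norm (rotation_average (r n) f z - c) \<le> C + norm c" for n
      using A_bd[of "r n"] by eventually_elim (metis add_right_mono norm_triangle_ineq4 order_trans)
    show "AE z in circle. (\<lambda>n. rotation_average (r n) f z - c) \<longlonglongrightarrow> 0"
      using r(2) by eventually_elim (simp add: LIM_zero)
  qed
  then have lim: "(\<lambda>n. \<alpha> (\<lambda>z. rotation_average (r n) f z - c) + \<alpha> f) \<longlonglongrightarrow> 0 + \<alpha> f"
    by (intro tendsto_intros)
  have "norm c \<le> \<alpha> (\<lambda>z. rotation_average (r n) f z - c) + \<alpha> f" for n
  proof -
    have "norm c = \<alpha> (\<lambda>z. (-1) * (rotation_average (r n) f z - c) + rotation_average (r n) f z)"
      by (simp add: alpha_const)
    also have "\<dots> \<le> \<alpha> (\<lambda>z. (-1) * (rotation_average (r n) f z - c)) + \<alpha> (rotation_average (r n) f)"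
      by (intro triangle Linf_cmult Linf_diff AL Linf_const)
    also have "\<dots> \<le> \<alpha> (\<lambda>z. rotation_average (r n) f z - c) + \<alpha> f"
      using scale[OF Linf_diff[OF AL Linf_const], of "-1" "r n" c] A_le[of "r n"] by simp
    finally show ?thesis .
  qed
  then have "norm c \<le> 0 + \<alpha> f" by (intro LIMSEQ_le_const[OF lim]) auto
  then show ?thesis by (simp add: c_def fourier_def)
qed

end

section \<open>The extended norm\<close>

context continuous_rotationally_symmetric_norm
begin

abbreviation "\<beta> \<equiv> ext_norm \<alpha>"

lemma ext_norm_mono:
  assumes "AE z in circle. norm (f z) \<le> norm (g z)"
  shows "\<beta> f \<le> \<beta> g"
  unfolding ext_norm_def
proof (rule SUP_subset_mono)
  show "{s. simple_function circle s \<and> (AE z in circle. norm (s z) \<le> norm (f z))}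
    \<subseteq> {s. simple_function circle s \<and> (AE z in circle. norm (s z) \<le> norm (g z))}"
    using assms by (auto elim: eventually_elim2)
qed simp

lemma ext_norm_le_alpha:
  assumes "f \<in> Linf"
  shows "\<beta> f \<le> ennreal (\<alpha> f)"
  unfolding ext_norm_def
  by (rule SUP_least) (auto intro!: ennreal_leI alpha_mono assms Linf_simple_function)

text \<open>The supremum defining \<open>\<beta>\<close> runs over simple functions only; rounding
  the modulus of \<open>t\<close> down to multiples of \<open>e\<close> shows that bounded
  competitors do not exceed it. With \<open>ext_norm_le_alpha\<close> this means that
  \<open>\<beta>\<close> agrees with \<open>\<alpha>\<close> on \<open>Linf\<close>.\<close>

lemma alpha_le_ext_norm:
  assumes t: "t \<in> Linf" and le: "AE z in circle. norm (t z) \<le> norm (f z)"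
  shows "ennreal (\<alpha> t) \<le> \<beta> f"
proof (rule ennreal_le_epsilon)
  fix e :: real assume e: "e > 0"
  have [measurable]: "t \<in> borel_measurable circle" using t by auto
  obtain C where C: "C > 0" "AE z in circle. norm (t z) \<le> C" using t by (rule LinfE)
  \<comment> \<open>\<open>t\<close> is bounded only a.e.; truncation bounds \<open>m\<close>
    everywhere, so the floor takes finitely many values.\<close>
  define m where "m z = min (norm (t z)) C" for z
  define s where "s z = complex_of_real (e * of_int \<lfloor>m z / e\<rfloor>)" for z
  have [measurable]: "m \<in> borel_measurable circle" unfolding m_def by measurable
  have m: "0 \<le> m z" "m z \<le> C" for z using C(1) by (auto simp: m_def)
  have sm: "0 \<le> e * of_int \<lfloor>m z / e\<rfloor>" "e * of_int \<lfloor>m z / e\<rfloor> \<le> m z" "m z \<le> e * of_int \<lfloor>m z / e\<rfloor> + e" for z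
  proof -
    have "of_int \<lfloor>m z / e\<rfloor> \<le> m z / e" "m z / e \<le> of_int \<lfloor>m z / e\<rfloor> + 1" by linarith+
    from this[THEN mult_left_mono, of e]
    show "e * of_int \<lfloor>m z / e\<rfloor> \<le> m z" "m z \<le> e * of_int \<lfloor>m z / e\<rfloor> + e"
      using e by (simp_all only: distrib_left times_divide_eq_right nonzero_mult_div_cancel_left less_imp_le less_imp_neq[symmetric] not_False_eq_True mult_1_right)
    show "0 \<le> e * of_int \<lfloor>m z / e\<rfloor>" using e m[of z] by simp
  qed
  have ns: "norm (s z) = e * of_int \<lfloor>m z / e\<rfloor>" for z
    unfolding s_def using sm(1)[of z] by (simp only: norm_of_real abs_of_nonneg)
  have s: "simple_function circle s"
  proof (rule simple_function_borel_measurable)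
    show "s \<in> borel_measurable circle" unfolding s_def by measurable
    have "s ` space circle \<subseteq> (\<lambda>k::int. complex_of_real (e * of_int k)) ` {0..\<lfloor>C / e\<rfloor>}"
      using m e by (auto simp: s_def intro!: imageI floor_mono divide_right_mono)
    then show "finite (s ` space circle)" by (rule finite_subset) simp
  qed
  have tm: "AE z in circle. norm (t z) = m z" using C(2) by eventually_elim (simp add: m_def)
  have sle: "AE z in circle. norm (s z) \<le> norm (f z)"
    using tm le by eventually_elim (use sm(2) ns in \<open>simp add: order_trans[OF sm(2)]\<close>)
  have sL: "s \<in> Linf" by (rule Linf_simple_function[OF s])
  let ?d = "\<lambda>z. of_real (norm (t z)) - s z"
  have dL: "?d \<in> Linf" by (intro Linf_diff Linf_norm t sL)
  have "\<alpha> t = \<alpha> (\<lambda>z. s z + ?d z)" using modulus[OF t] by simp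
  also have "\<dots> \<le> \<alpha> s + \<alpha> ?d" by (rule triangle[OF sL dL])
  also have "\<alpha> ?d \<le> e"
  proof (rule alpha_le_bound[OF dL])
    show "AE z in circle. norm (?d z) \<le> e"
      using tm
    proof eventually_elim
      case (elim z)
      have "?d z = of_real (m z - e * of_int \<lfloor>m z / e\<rfloor>)" by (simp add: elim s_def)
      moreover have "\<bar>m z - e * of_int \<lfloor>m z / e\<rfloor>\<bar> \<le> e" using sm[of z] by linarith
      ultimately show ?case by (simp only: norm_of_real)
    qed
  qed (use e in simp)
  finally have "ennreal (\<alpha> t) \<le> ennreal (\<alpha> s) + ennreal e"
    using alpha_nonneg[OF sL] e by (simp flip: ennreal_plus)
  also have "ennreal (\<alpha> s) \<le> \<beta> f"
    unfolding ext_norm_def by (rule SUP_upper) (use s sle in simp)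
  finally show "ennreal (\<alpha> t) \<le> \<beta> f + ennreal e" by simp
qed

text \<open>A simple competitor for \<open>f + g\<close> is split in proportion to the moduli of
  \<open>f\<close> and \<open>g\<close>. The pieces are bounded but need not be simple, which is why
  \<open>alpha_le_ext_norm\<close> is needed for bounded competitors.\<close>

lemma ext_norm_triangle:
  assumes [measurable]: "f \<in> borel_measurable circle" "g \<in> borel_measurable circle"
  shows "\<beta> (\<lambda>z. f z + g z) \<le> \<beta> f + \<beta> g"
  unfolding ext_norm_def [of \<alpha> "\<lambda>z. f z + g z"]
proof (rule SUP_least)
  fix s :: "complex \<Rightarrow> complex"
  assume "s \<in> {s. simple_function circle s \<and> (AE z in circle. norm (s z) \<le> norm (f z + g z))}"
  then have s: "simple_function circle s" and sle: "AE z in circle. norm (s z) \<le> norm (f z + g z)" by auto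
  have sL: "s \<in> Linf" by (rule Linf_simple_function[OF s])
  have [measurable]: "s \<in> borel_measurable circle" using sL by auto
  \<comment> \<open>Where \<open>f\<close> and \<open>g\<close> both vanish the quotient is 0 by
    convention; there \<open>s\<close> vanishes as well, up to a null set, so the splitting remains
    correct.\<close>
  define a where "a z = s z * of_real (norm (f z) / (norm (f z) + norm (g z)))" for z
  define b where "b z = s z * of_real (norm (g z) / (norm (f z) + norm (g z)))" for z
  have [measurable]: "a \<in> borel_measurable circle" "b \<in> borel_measurable circle"
    unfolding a_def b_def by measurable
  have le1: "norm (f z) / (norm (f z) + norm (g z)) \<le> 1" "norm (g z) / (norm (f z) + norm (g z)) \<le> 1" for z
    by (intro divide_le_eq_1[THEN iffD2]; cases "norm (f z) + norm (g z) = 0"; use add_nonneg_nonneg[OF norm_ge_zero norm_ge_zero, of "f z" "g z"] in \<open>simp add: add_nonneg_eq_0_iff less_le\<close>)+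
  have na: "norm (a z) = norm (s z) * (norm (f z) / (norm (f z) + norm (g z)))" for z
    unfolding a_def norm_mult norm_of_real by simp
  have nb: "norm (b z) = norm (s z) * (norm (g z) / (norm (f z) + norm (g z)))" for z
    unfolding b_def norm_mult norm_of_real by simp
  have "norm (a z) \<le> norm (s z)" "norm (b z) \<le> norm (s z)" for z
    unfolding na nb by (intro mult_left_le le1 norm_ge_zero)+
  then have ab: "a \<in> Linf" "b \<in> Linf"
    by (auto intro!: Linf_mono[OF _ sL])
  have a: "AE z in circle. norm (a z) \<le> norm (f z)" and b: "AE z in circle. norm (b z) \<le> norm (g z)"
    and sab: "AE z in circle. s z = a z + b z"
  proof -
    have *: "norm (a z) \<le> norm (f z) \<and> norm (b z) \<le> norm (g z) \<and> s z = a z + b z"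
      if le: "norm (s z) \<le> norm (f z + g z)" for z
    proof (cases "norm (f z) + norm (g z) = 0")
      case True
      then have "f z = 0" "g z = 0" by (auto simp: add_nonneg_eq_0_iff)
      then show ?thesis using le by (simp add: a_def b_def)
    next
      case False
      then have pos: "norm (f z) + norm (g z) > 0" by (metis add_nonneg_nonneg norm_ge_zero order_le_less)
      have sfg: "norm (s z) \<le> norm (f z) + norm (g z)" using le norm_triangle_ineq[of "f z" "g z"] by linarith
      have "norm (a z) \<le> norm (f z)"
        unfolding na using pos mult_right_mono[OF sfg norm_ge_zero[of "f z"]] by (simp add: field_simps)
      moreover have "norm (b z) \<le> norm (g z)"
        unfolding nb using pos mult_right_mono[OF sfg norm_ge_zero[of "g z"]] by (simp add: field_simps)
      moreover have "a z + b z = s z * of_real (norm (f z) / (norm (f z) + norm (g z)) + norm (g z) / (norm (f z) + norm (g z)))"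
        unfolding a_def b_def of_real_add distrib_left ..
      then have "s z = a z + b z"
        using pos by (simp add: add_divide_distrib[symmetric] del: of_real_add of_real_divide)
      ultimately show ?thesis by simp
    qed
    show "AE z in circle. norm (a z) \<le> norm (f z)" "AE z in circle. norm (b z) \<le> norm (g z)"
      "AE z in circle. s z = a z + b z"
      using sle by (eventually_elim, use * in blast)+
  qed
  have "\<alpha> s = \<alpha> (\<lambda>z. a z + b z)" by (rule alpha_cong_AE[OF sL Linf_add[OF ab] sab])
  also have "\<dots> \<le> \<alpha> a + \<alpha> b" by (rule triangle[OF ab])
  finally have "ennreal (\<alpha> s) \<le> ennreal (\<alpha> a) + ennreal (\<alpha> b)"
    using alpha_nonneg ab by (simp flip: ennreal_plus)
  also have "\<dots> \<le> \<beta> f + \<beta> g"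
    by (intro add_mono alpha_le_ext_norm ab a b)
  finally show "ennreal (\<alpha> s) \<le> \<beta> f + \<beta> g" .
qed

lemma ext_norm_mult_bounded_le:
  assumes "AE z in circle. norm (g z) \<le> C" "C > 0"
  shows "\<beta> (\<lambda>z. g z * f z) \<le> ennreal C * \<beta> f"
  unfolding ext_norm_def [of \<alpha> "\<lambda>z. g z * f z"]
proof (rule SUP_least)
  fix s :: "complex \<Rightarrow> complex"
  assume "s \<in> {s. simple_function circle s \<and> (AE z in circle. norm (s z) \<le> norm (g z * f z))}"
  then have s: "simple_function circle s" and sle: "AE z in circle. norm (s z) \<le> norm (g z * f z)" by auto
  let ?t = "\<lambda>z. of_real (1 / C) * s z"
  have sL: "s \<in> Linf" by (rule Linf_simple_function[OF s])
  have t: "?t \<in> Linf" by (rule Linf_cmult[OF sL])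
  have le: "AE z in circle. norm (?t z) \<le> norm (f z)"
    using sle assms(1)
  proof eventually_elim
    case (elim z)
    have "norm (s z) \<le> C * norm (f z)"
      using elim by (simp add: norm_mult mult_right_mono order_trans)
    then show ?case using assms(2) by (simp add: norm_mult norm_divide field_simps)
  qed
  have "\<alpha> s = C * \<alpha> ?t"
    using scale[OF sL, of "of_real (1 / C)"] assms(2) by (simp add: norm_divide)
  then have "ennreal (\<alpha> s) = ennreal C * ennreal (\<alpha> ?t)"
    using assms(2) alpha_nonneg[OF t] by (simp add: ennreal_mult)
  also have "\<dots> \<le> ennreal C * \<beta> f"
    by (intro mult_left_mono alpha_le_ext_norm t le) simp
  finally show "ennreal (\<alpha> s) \<le> ennreal C * \<beta> f" .
qed

lemma L_spaceD:
  assumes "f \<in> L_space \<alpha>"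
  shows "f \<in> borel_measurable circle" "\<beta> f < \<infinity>"
  using assms by (auto simp: L_space_def closure_in_def calL_def)

lemma L_space_approx:
  assumes "f \<in> L_space \<alpha>" "e > 0"
  obtains b where "b \<in> Linf" "\<beta> (\<lambda>z. f z - b z) < ennreal e"
  using assms by (auto simp: L_space_def closure_in_def)

lemma ext_norm_mult_bounded_lt:
  assumes "\<beta> f < ennreal (e / C)" "AE z in circle. norm (g z) \<le> C" "C > 0" "e > 0"
  shows "\<beta> (\<lambda>z. g z * f z) < ennreal e"
proof -
  have "\<beta> (\<lambda>z. g z * f z) \<le> ennreal C * \<beta> f" by (rule ext_norm_mult_bounded_le[OF assms(2,3)])
  also have "\<dots> < ennreal C * ennreal (e / C)"
    using assms by (intro ennreal_mult_strict_left_mono) auto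
  also have "\<dots> = ennreal e" using assms by (simp flip: ennreal_mult)
  finally show ?thesis .
qed

lemma L_space_mult_bounded:
  assumes f: "f \<in> L_space \<alpha>" and g: "g \<in> Linf"
  shows "(\<lambda>z. g z * f z) \<in> L_space \<alpha>"
proof -
  obtain C where C: "C > 0" "AE z in circle. norm (g z) \<le> C" using g by (rule LinfE)
  have "\<beta> (\<lambda>z. g z * f z) \<le> ennreal C * \<beta> f" by (rule ext_norm_mult_bounded_le[OF C(2,1)])
  also have "\<dots> < \<infinity>" using L_spaceD(2)[OF f] by (simp add: ennreal_mult_less_top)
  finally have 1: "(\<lambda>z. g z * f z) \<in> calL \<alpha>"
    using L_spaceD(1)[OF f] g by (auto simp: calL_def)
  have "\<exists>b\<in>Linf. \<beta> (\<lambda>z. g z * f z - b z) < ennreal e" if e: "e > 0" for e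
  proof -
    obtain b where b: "b \<in> Linf" "\<beta> (\<lambda>z. f z - b z) < ennreal (e / C)"
      using e C(1) by (auto intro: L_space_approx[OF f, of "e / C"])
    have "\<beta> (\<lambda>z. g z * (f z - b z)) < ennreal e"
      by (rule ext_norm_mult_bounded_lt[OF b(2) C(2,1) e])
    then show ?thesis using Linf_mult[OF g b(1)] by (intro bexI[of _ "\<lambda>z. g z * b z"]) (simp_all add: right_diff_distrib)
  qed
  then show ?thesis using 1 by (simp add: L_space_def closure_in_def)
qed

lemma L_space_AE_eq:
  assumes g: "g \<in> L_space \<alpha>" and f: "f \<in> borel_measurable circle" and eq: "AE z in circle. f z = g z"
  shows "f \<in> L_space \<alpha>"
proof -
  have "\<beta> f \<le> \<beta> g" by (rule ext_norm_mono) (use eq in eventually_elim, simp)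
  then have "f \<in> calL \<alpha>" using f L_spaceD(2)[OF g] by (simp add: calL_def)
  moreover have "\<exists>b\<in>Linf. \<beta> (\<lambda>z. f z - b z) < ennreal e" if e: "e > 0" for e
  proof -
    obtain b where b: "b \<in> Linf" "\<beta> (\<lambda>z. g z - b z) < ennreal e" by (rule L_space_approx[OF g e])
    have "\<beta> (\<lambda>z. f z - b z) \<le> \<beta> (\<lambda>z. g z - b z)" by (rule ext_norm_mono) (use eq in eventually_elim, simp)
    then show ?thesis using b by (blast intro: le_less_trans)
  qed
  ultimately show ?thesis by (simp add: L_space_def closure_in_def)
qed

lemma ext_norm_zero: "\<beta> (\<lambda>z. 0) = 0"
  using ext_norm_le_alpha[OF Linf_const[of 0]] by (simp add: alpha_zero)

lemma Linf_subset_L_space: "f \<in> Linf \<Longrightarrow> f \<in> L_space \<alpha>"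
proof -
  assume f: "f \<in> Linf"
  have "f \<in> calL \<alpha>"
    using f le_less_trans[OF ext_norm_le_alpha[OF f], of \<infinity>] by (auto simp: calL_def)
  moreover have "\<beta> (\<lambda>z. f z - f z) < ennreal e" if "e > 0" for e using that by (simp add: ext_norm_zero)
  ultimately show ?thesis using f by (auto simp: L_space_def closure_in_def intro!: bexI[of _ f])
qed

text \<open>Replacing \<open>f\<close> by a bounded \<open>b\<close> costs at most \<open>D\<close>
  times the approximation error, uniformly in \<open>n\<close>, and the products
  \<open>h n * b\<close> are covered by bounded convergence. Density of \<open>Linf\<close> in
  \<open>L_space \<alpha>\<close> is the essential input.\<close>

lemma ext_norm_dominated_convergence:
  assumes f: "f \<in> L_space \<alpha>" and h: "\<And>n. h n \<in> borel_measurable circle"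
    and C: "\<And>n. AE z in circle. norm (h n z) \<le> C" and lim: "AE z in circle. (\<lambda>n. h n z) \<longlonglongrightarrow> 0"
    and e: "e > 0"
  shows "\<exists>n::nat. \<beta> (\<lambda>z. h n z * f z) < ennreal e"
proof -
  define D where "D = max C 1"
  have D: "D > 0" "AE z in circle. norm (h n z) \<le> D" for n
    using C[of n] by (auto simp: D_def elim: eventually_mono)
  have hL: "h n \<in> Linf" for n by (rule LinfI[OF h C])
  note [measurable] = h L_spaceD(1)[OF f]
  obtain b where b: "b \<in> Linf" "\<beta> (\<lambda>z. f z - b z) < ennreal (e / 2 / D)"
    using e D(1) by (auto intro: L_space_approx[OF f, of "e / 2 / D"])
  have [measurable]: "b \<in> borel_measurable circle" using b by auto
  obtain B where B: "B > 0" "AE z in circle. norm (b z) \<le> B" using b(1) by (rule LinfE)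
  have "(\<lambda>n. \<alpha> (\<lambda>z. h n z * b z)) \<longlonglongrightarrow> 0"
  proof (rule alpha_bounded_convergence)
    show "AE z in circle. norm (h n z * b z) \<le> D * B" for n
      using D(2)[of n] B(2) by eventually_elim (use D(1) in \<open>simp add: norm_mult mult_mono\<close>)
    show "AE z in circle. (\<lambda>n. h n z * b z) \<longlonglongrightarrow> 0"
      using lim by eventually_elim (rule tendsto_mult_left_zero)
  qed simp
  then have "\<forall>\<^sub>F n in sequentially. \<alpha> (\<lambda>z. h n z * b z) < e / 2"
    by (rule order_tendstoD) (use e in simp)
  then obtain n where n: "\<alpha> (\<lambda>z. h n z * b z) < e / 2" by (auto simp: eventually_sequentially)
  have "\<beta> (\<lambda>z. h n z * f z) = \<beta> (\<lambda>z. h n z * (f z - b z) + h n z * b z)" by (simp add: right_diff_distrib)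
  also have "\<dots> \<le> \<beta> (\<lambda>z. h n z * (f z - b z)) + \<beta> (\<lambda>z. h n z * b z)"
    by (rule ext_norm_triangle) auto
  also have "\<dots> < ennreal (e / 2) + ennreal (e / 2)"
  proof (rule add_strict_mono)
    show "\<beta> (\<lambda>z. h n z * (f z - b z)) < ennreal (e / 2)"
      by (rule ext_norm_mult_bounded_lt[OF b(2) D(2,1)]) (use e in simp)
    show "\<beta> (\<lambda>z. h n z * b z) < ennreal (e / 2)"
      by (rule le_less_trans[OF ext_norm_le_alpha[OF Linf_mult[OF hL b(1)]]]) (use n e in \<open>auto intro: ennreal_lessI\<close>)
  qed
  also have "\<dots> = ennreal e" using e by (simp flip: ennreal_plus)
  finally show ?thesis by blast
qed

text \<open>Truncation reduces to bounded functions, where the integral is controlled by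
  \<open>\<alpha>\<close>; Fatou removes the truncation. In particular
  \<open>L_space \<alpha>\<close> lies in L^1, so its elements have Fourier coefficients.\<close>

lemma nn_integral_norm_le_ext_norm:
  assumes [measurable]: "f \<in> borel_measurable circle"
  shows "(\<integral>\<^sup>+z. norm (f z) \<partial>circle) \<le> \<beta> f"
proof -
  let ?t = "\<lambda>n z. complex_of_real (min (norm (f z)) (real n))"
  have tL: "?t n \<in> Linf" for n by (rule LinfI[where C = "real n"]) auto
  have "(\<integral>\<^sup>+z. norm (f z) \<partial>circle) = (\<integral>\<^sup>+z. liminf (\<lambda>n. ennreal (min (norm (f z)) (real n))) \<partial>circle)"
  proof (rule nn_integral_cong)
    fix z
    obtain N :: nat where N: "norm (f z) < real N" using reals_Archimedean2 by blast
    have "\<forall>\<^sub>F n in sequentially. ennreal (min (norm (f z)) (real n)) = ennreal (norm (f z))"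
      using eventually_ge_at_top[of N] by eventually_elim (use N in \<open>simp add: min_def\<close>)
    then have "(\<lambda>n. ennreal (min (norm (f z)) (real n))) \<longlonglongrightarrow> ennreal (norm (f z))"
      by (rule tendsto_eventually)
    then show "ennreal (norm (f z)) = liminf (\<lambda>n. ennreal (min (norm (f z)) (real n)))"
      by (intro lim_imp_Liminf[symmetric]) auto
  qed
  also have "\<dots> \<le> liminf (\<lambda>n. \<integral>\<^sup>+z. ennreal (min (norm (f z)) (real n)) \<partial>circle)"
    by (rule nn_integral_liminf) simp
  also have "\<dots> \<le> \<beta> f"
  proof (rule Liminf_le)
    show "\<forall>\<^sub>F n in sequentially. (\<integral>\<^sup>+z. ennreal (min (norm (f z)) (real n)) \<partial>circle) \<le> \<beta> f"
    proof (rule always_eventually, rule allI)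
      fix n
      have int: "integrable circle (\<lambda>z. min (norm (f z)) (real n))"
        by (rule integrable_circle_bounded[where C = "real n"]) auto
      have "(\<integral>\<^sup>+z. ennreal (min (norm (f z)) (real n)) \<partial>circle) = ennreal (LINT z|circle. min (norm (f z)) (real n))"
        by (rule nn_integral_eq_integral[OF int]) simp
      also have "(LINT z|circle. min (norm (f z)) (real n)) \<le> norm (LINT z|circle. ?t n z)"
        by (simp only: integral_complex_of_real norm_of_real abs_ge_self)
      also have "\<dots> \<le> \<alpha> (?t n)" by (rule norm_integral_le_alpha[OF tL])
      also have "ennreal (\<alpha> (?t n)) \<le> \<beta> f"
        by (rule alpha_le_ext_norm[OF tL]) (auto simp: min_def)
      finally show "(\<integral>\<^sup>+z. ennreal (min (norm (f z)) (real n)) \<partial>circle) \<le> \<beta> f"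
        by (simp add: ennreal_leI)
    qed
  qed simp
  finally show ?thesis .
qed

lemma integrable_ext_norm:
  assumes "f \<in> borel_measurable circle" "\<beta> f < \<infinity>"
  shows "integrable circle f"
  using assms nn_integral_norm_le_ext_norm[OF assms(1)]
  by (intro integrableI_bounded) (auto intro: le_less_trans)

lemma norm_fourier_le_ext_norm:
  assumes "f \<in> borel_measurable circle" "\<beta> f < \<infinity>"
  shows "ennreal (norm (fourier f m)) \<le> \<beta> f"
proof -
  have "norm (fourier f m) \<le> (LINT z|circle. norm (f z * z powi (- m)))"
    unfolding fourier_def by simp
  also have "\<dots> = (LINT z|circle. norm (f z))"
    by (rule Bochner_Integration.integral_cong) (auto simp: norm_mult norm_power_int)
  finally have "ennreal (norm (fourier f m)) \<le> ennreal (LINT z|circle. norm (f z))" by (rule ennreal_leI)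
  also have "\<dots> = (\<integral>\<^sup>+z. norm (f z) \<partial>circle)"
    using integrable_ext_norm[OF assms] by (intro nn_integral_eq_integral[symmetric]) auto
  also have "\<dots> \<le> \<beta> f" by (rule nn_integral_norm_le_ext_norm[OF assms(1)])
  finally show ?thesis .
qed

end

section \<open>The Hardy space and its invariant subspaces\<close>

lemma span_monomials: "cfun.span (range (\<lambda>(n::nat) z. z ^ n)) = range poly"
proof
  show "cfun.span (range (\<lambda>(n::nat) z. z ^ n)) \<subseteq> range poly"
  proof (rule cfun.span_minimal)
    show "range (\<lambda>(n::nat) z. z ^ n) \<subseteq> range (poly :: complex poly \<Rightarrow> _)"
    proof (rule image_subsetI)
      fix n :: nat
      have "(\<lambda>z. z ^ n) = poly (monom (1::complex) n)" by (simp add: fun_eq_iff poly_monom)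
      then show "(\<lambda>z. z ^ n) \<in> range (poly :: complex poly \<Rightarrow> _)" by blast
    qed
    show "cfun.subspace (range poly)"
    proof (rule cfun.subspaceI)
      have "(0 :: complex \<Rightarrow> complex) = poly 0" by (simp add: fun_eq_iff)
      then show "(0 :: complex \<Rightarrow> complex) \<in> range poly" by blast
    next
      fix f g :: "complex \<Rightarrow> complex" assume "f \<in> range poly" "g \<in> range poly"
      then obtain p q where "f = poly p" "g = poly q" by blast
      then have "f + g = poly (p + q)" by (simp add: fun_eq_iff)
      then show "f + g \<in> range poly" by blast
    next
      fix c and f :: "complex \<Rightarrow> complex" assume "f \<in> range poly"
      then obtain p where "f = poly p" by blast
      then have "(\<lambda>z. c * f z) = poly (smult c p)" by (simp add: fun_eq_iff)
      then show "(\<lambda>z. c * f z) \<in> range poly" by blast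
    qed
  qed
  show "range poly \<subseteq> cfun.span (range (\<lambda>(n::nat) z. z ^ n))"
  proof (rule image_subsetI)
    fix p :: "complex poly"
    have "(\<lambda>z. \<Sum>i<n. coeff p i * z ^ i) \<in> cfun.span (range (\<lambda>(n::nat) z. z ^ n))" for n
    proof (induction n)
      case 0
      then show ?case using cfun.span_zero by (simp add: zero_fun_def)
    next
      case (Suc n)
      have "(\<lambda>z. coeff p n * z ^ n) \<in> cfun.span (range (\<lambda>(n::nat) z. z ^ n))"
        by (intro cfun.span_scale[of "\<lambda>z. z ^ n"] cfun.span_base) blast
      from cfun.span_add[OF Suc this] show ?case by (simp add: plus_fun_def)
    qed
    from this[of "Suc (degree p)"] show "poly p \<in> cfun.span (range (\<lambda>(n::nat) z. z ^ n))"
      by (simp add: poly_altdef[abs_def] lessThan_Suc_atMost)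
  qed
qed

text \<open>Multiplication by \<open>z\<close> turns the coefficient at \<open>m\<close> into the
  one at \<open>m - 1\<close>, still negative; hence the induction needs \<open>m\<close>
  arbitrary.\<close>

lemma fourier_poly_neg: "m < 0 \<Longrightarrow> fourier (poly p) m = 0"
proof (induction p arbitrary: m)
  case 0
  then show ?case by (simp add: fourier_def)
next
  case (pCons a p)
  have int: "integrable circle (\<lambda>z. poly p z * z powi 1)" "integrable circle (\<lambda>z. a * z powi 0)"
    by (intro integrable_mult_power_int Linf_integrable Linf_poly) (simp add: circle.integrable_const)
  have "poly (pCons a p) = (\<lambda>z. a * z powi 0 + poly p z * z powi 1)" by (simp add: fun_eq_iff mult.commute)
  then have "fourier (poly (pCons a p)) m = fourier (\<lambda>z. a * z powi 0 + poly p z * z powi 1) m" by simp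
  also have "\<dots> = a * fourier (\<lambda>z. z powi 0) m + fourier (poly p) (m - 1)"
    unfolding fourier_add[OF int(2,1)] fourier_cmult fourier_mult_power_int ..
  also have "\<dots> = 0" using pCons by (simp add: fourier_power_int del: power_int_0_right)
  finally show ?case .
qed

context continuous_rotationally_symmetric_norm
begin

lemma ext_norm_diff_lt:
  assumes [measurable]: "f \<in> borel_measurable circle" "g \<in> borel_measurable circle" "h \<in> borel_measurable circle"
    and "\<beta> (\<lambda>z. f z - g z) < ennreal (e / 2)" "\<beta> (\<lambda>z. g z - h z) < ennreal (e / 2)" "e > 0"
  shows "\<beta> (\<lambda>z. f z - h z) < ennreal e"
proof -
  have "\<beta> (\<lambda>z. f z - h z) = \<beta> (\<lambda>z. (f z - g z) + (g z - h z))" by simp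
  also have "\<dots> \<le> \<beta> (\<lambda>z. f z - g z) + \<beta> (\<lambda>z. g z - h z)" by (rule ext_norm_triangle) auto
  also have "\<dots> < ennreal (e / 2) + ennreal (e / 2)" by (rule add_strict_mono) fact+
  also have "\<dots> = ennreal e" using assms by (simp flip: ennreal_plus)
  finally show ?thesis .
qed

lemma H_space_iff:
  "f \<in> H_space \<alpha> \<longleftrightarrow> f \<in> L_space \<alpha> \<and> (\<forall>e>0. \<exists>p. \<beta> (\<lambda>z. f z - poly p z) < ennreal e)"
  by (auto simp: H_space_def closure_in_def span_monomials)

lemma H_space_approx:
  "f \<in> H_space \<alpha> \<Longrightarrow> e > 0 \<Longrightarrow> \<exists>p. \<beta> (\<lambda>z. f z - poly p z) < ennreal e"
  by (simp add: H_space_iff)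

lemma H_space_imp_L_space: "f \<in> H_space \<alpha> \<Longrightarrow> f \<in> L_space \<alpha>"
  by (simp add: H_space_iff)

lemma H_space_measurable: "f \<in> H_space \<alpha> \<Longrightarrow> f \<in> borel_measurable circle"
  by (rule L_spaceD(1)[OF H_space_imp_L_space])

lemma H_space_closed:
  assumes f: "f \<in> L_space \<alpha>" and approx: "\<And>e. e > 0 \<Longrightarrow> \<exists>g\<in>H_space \<alpha>. \<beta> (\<lambda>z. f z - g z) < ennreal e"
  shows "f \<in> H_space \<alpha>"
  unfolding H_space_iff
proof (intro conjI f allI impI)
  fix e :: real assume e: "e > 0"
  then obtain g where g: "g \<in> H_space \<alpha>" "\<beta> (\<lambda>z. f z - g z) < ennreal (e / 2)"
    using approx[of "e / 2"] by auto
  have "e / 2 > 0" using e by simp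
  from H_space_approx[OF g(1) this] obtain p where "\<beta> (\<lambda>z. g z - poly p z) < ennreal (e / 2)" ..
  with g have "\<beta> (\<lambda>z. f z - poly p z) < ennreal e"
    using e by (intro ext_norm_diff_lt[OF L_spaceD(1)[OF f] H_space_measurable poly_measurable_circle]) auto
  then show "\<exists>p. \<beta> (\<lambda>z. f z - poly p z) < ennreal e" ..
qed

lemma H_space_mult_poly:
  assumes f: "f \<in> H_space \<alpha>"
  shows "(\<lambda>z. poly p z * f z) \<in> H_space \<alpha>"
  unfolding H_space_iff
proof (intro conjI allI impI L_space_mult_bounded Linf_poly H_space_imp_L_space f)
  fix e :: real assume e: "e > 0"
  obtain C where C: "C > 0" "AE z in circle. norm (poly p z) \<le> C" using Linf_poly by (rule LinfE)
  have "e / C > 0" using C e by simp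
  from H_space_approx[OF f this] obtain q where q: "\<beta> (\<lambda>z. f z - poly q z) < ennreal (e / C)" ..
  have "\<beta> (\<lambda>z. poly p z * (f z - poly q z)) < ennreal e"
    by (rule ext_norm_mult_bounded_lt[OF q C(2,1) e])
  then have "\<beta> (\<lambda>z. poly p z * f z - poly (p * q) z) < ennreal e"
    by (simp add: right_diff_distrib)
  then show "\<exists>q. \<beta> (\<lambda>z. poly p z * f z - poly q z) < ennreal e" ..
qed

lemma poly_in_H_space: "poly p \<in> H_space \<alpha>"
proof -
  have "\<beta> (\<lambda>z. poly p z - poly p z) < ennreal e" if "e > 0" for e
    using that by (simp add: ext_norm_zero)
  then show ?thesis unfolding H_space_iff using Linf_subset_L_space[OF Linf_poly] by blast
qed

lemma bounded_poly_limit_Linf: "bounded_poly_limit g \<Longrightarrow> g \<in> Linf"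
  by (rule bounded_poly_limit_bounded, assumption) (auto simp: bounded_poly_limit_def intro: LinfI)

text \<open>Stated for \<open>L_space \<alpha>\<close> so that it serves twice:
  \<open>H_space \<alpha>\<close> and every closed invariant subspace are stable under polynomials
  and closed, hence stable under these multipliers.\<close>

lemma mult_bounded_poly_limit_approx:
  assumes f: "f \<in> L_space \<alpha>" and g: "bounded_poly_limit g" and e: "e > 0"
  shows "\<exists>p. \<beta> (\<lambda>z. g z * f z - poly p z * f z) < ennreal e"
proof -
  obtain p C where C: "\<And>n z. z \<in> sphere 0 1 \<Longrightarrow> norm (poly (p n) z) \<le> C"
    and lim: "AE z in circle. (\<lambda>n::nat. poly (p n) z) \<longlonglongrightarrow> g z"
    using g unfolding bounded_poly_limit_def by blast
  have gm [measurable]: "g \<in> borel_measurable circle" using g by (simp add: bounded_poly_limit_def)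
  obtain D where D: "AE z in circle. norm (g z) \<le> D" using g by (rule bounded_poly_limit_bounded)
  have "\<exists>n. \<beta> (\<lambda>z. (g z - poly (p n) z) * f z) < ennreal e"
  proof (rule ext_norm_dominated_convergence[OF f _ _ _ e])
    show "(\<lambda>z. g z - poly (p n) z) \<in> borel_measurable circle" for n by measurable
    show "AE z in circle. norm (g z - poly (p n) z) \<le> D + C" for n
      using D AE_space
    proof eventually_elim
      case (elim z)
      then show ?case using C[of z n] norm_triangle_ineq4[of "g z" "poly (p n) z"] by simp
    qed
    show "AE z in circle. (\<lambda>n. g z - poly (p n) z) \<longlonglongrightarrow> 0"
      using lim
    proof eventually_elim
      case (elim z)
      from tendsto_diff[OF tendsto_const[of "g z"] elim] show ?case by simp
    qed
  qed
  then show ?thesis by (auto simp: left_diff_distrib)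
qed

lemma H_space_mult_bounded_poly_limit:
  assumes f: "f \<in> H_space \<alpha>" and g: "bounded_poly_limit g"
  shows "(\<lambda>z. g z * f z) \<in> H_space \<alpha>"
proof (rule H_space_closed)
  show "(\<lambda>z. g z * f z) \<in> L_space \<alpha>"
    by (rule L_space_mult_bounded[OF H_space_imp_L_space[OF f] bounded_poly_limit_Linf[OF g]])
  show "\<exists>h\<in>H_space \<alpha>. \<beta> (\<lambda>z. g z * f z - h z) < ennreal e" if e: "e > 0" for e
  proof -
    from mult_bounded_poly_limit_approx[OF H_space_imp_L_space[OF f] g e]
    obtain p where "\<beta> (\<lambda>z. g z * f z - poly p z * f z) < ennreal e" ..
    then show ?thesis by (rule bexI[where x = "\<lambda>z. poly p z * f z"]) (rule H_space_mult_poly[OF f])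
  qed
qed

lemma Hinf_subset_H_space:
  assumes "f \<in> Hinf"
  shows "f \<in> H_space \<alpha>"
proof -
  have "(\<lambda>z. f z * poly 1 z) \<in> H_space \<alpha>"
    by (rule H_space_mult_bounded_poly_limit[OF poly_in_H_space Hinf_imp_bounded_poly_limit[OF assms]])
  then show ?thesis by simp
qed

lemma L_space_integrable: "f \<in> L_space \<alpha> \<Longrightarrow> integrable circle f"
  by (rule integrable_ext_norm) (auto dest: L_spaceD)

lemma L_space_imp_sqrt_L2:
  assumes "f \<in> L_space \<alpha>"
  shows "(\<lambda>z. complex_of_real (c * sqrt (norm (f z)))) \<in> L2 circle"
proof -
  have "f \<in> borel_measurable circle" using assms by (rule L_spaceD)
  moreover have "integrable circle (\<lambda>z. norm (f z))" using L_space_integrable[OF assms] by simp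
  ultimately show ?thesis by (auto simp: L2_def norm_mult power_mult_distrib)
qed

lemma H_space_fourier_neg:
  assumes f: "f \<in> H_space \<alpha>" and m: "m < 0"
  shows "fourier f m = 0"
proof -
  note fL = H_space_imp_L_space[OF f]
  have "norm (fourier f m) \<le> e" if e: "e > 0" for e
  proof -
    from H_space_approx[OF f e] obtain p where p: "\<beta> (\<lambda>z. f z - poly p z) < ennreal e" ..
    have "fourier (\<lambda>z. f z - poly p z) m = fourier f m"
      using fourier_diff[OF L_space_integrable[OF fL] Linf_integrable[OF Linf_poly]] fourier_poly_neg[OF m] by simp
    moreover have "ennreal (norm (fourier (\<lambda>z. f z - poly p z) m)) \<le> \<beta> (\<lambda>z. f z - poly p z)"
      using L_spaceD(1)[OF fL] p by (intro norm_fourier_le_ext_norm) (auto intro: less_trans)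
    ultimately have "ennreal (norm (fourier f m)) < ennreal e" using p by (auto intro: le_less_trans)
    then show ?thesis using e by (simp add: ennreal_less_iff)
  qed
  then have "norm (fourier f m) \<le> 0" by (rule field_le_epsilon[of _ 0, simplified])
  then show ?thesis by simp
qed

lemma Linf_H_space_imp_Hinf:
  assumes "f \<in> Linf" "f \<in> H_space \<alpha>"
  shows "f \<in> Hinf"
  using H_space_fourier_neg[OF assms(2)] assms(1) by (simp add: Hinf_def fourier_def)

end

text \<open>From \<open>exp y \<ge> y\<^sup>2 / 2\<close> for \<open>y \<ge> 0\<close>. A multiplier
  of modulus \<open>exp (- (c * sqrt \<bar>f\<bar>))\<close> thus makes an arbitrary
  \<open>f\<close> bounded.\<close>

lemma exp_neg_sqrt_mult_le:
  fixes x c :: real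
  assumes "x \<ge> 0" "c > 0"
  shows "exp (- (c * sqrt x)) * x \<le> 2 / c\<^sup>2"
proof -
  have "(c * sqrt x)\<^sup>2 / 2 \<le> exp (c * sqrt x)"
  proof -
    have "0 \<le> c * sqrt x" using assms by simp
    with exp_lower_Taylor_quadratic[OF this] show ?thesis by linarith
  qed
  then have "c\<^sup>2 * x \<le> 2 * exp (c * sqrt x)" using assms by (simp add: power_mult_distrib)
  then show ?thesis using assms by (simp add: exp_minus field_simps)
qed

section \<open>Closed invariant subspaces and density of their bounded elements\<close>

locale invariant_subspace = continuous_rotationally_symmetric_norm +
  fixes M :: "(complex \<Rightarrow> complex) set"
  assumes sub_H: "M \<subseteq> H_space \<alpha>"
    and subspace: "cfun.subspace M"
    and closed: "closure_in \<alpha> (H_space \<alpha>) M = M"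
    and invariant: "f \<in> M \<Longrightarrow> (\<lambda>z. z * f z) \<in> M"
begin

lemma M_add: "f \<in> M \<Longrightarrow> g \<in> M \<Longrightarrow> (\<lambda>z. f z + g z) \<in> M"
  using cfun.subspace_add[OF subspace, of f g] by (simp add: plus_fun_def)

lemma M_cmult: "f \<in> M \<Longrightarrow> (\<lambda>z. c * f z) \<in> M"
  by (rule cfun.subspace_scale[OF subspace])

lemma M_L_space: "f \<in> M \<Longrightarrow> f \<in> L_space \<alpha>"
  using sub_H H_space_imp_L_space by blast

lemma M_measurable: "f \<in> M \<Longrightarrow> f \<in> borel_measurable circle"
  using sub_H H_space_measurable by blast

text \<open>Limits of elements of \<open>M\<close> are in \<open>H_space \<alpha>\<close> because
  that space is itself closed, so closedness relative to it upgrades to closedness in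
  \<open>L_space \<alpha>\<close>.\<close>

lemma M_closed:
  assumes f: "f \<in> L_space \<alpha>" and approx: "\<And>e. e > 0 \<Longrightarrow> \<exists>g\<in>M. \<beta> (\<lambda>z. f z - g z) < ennreal e"
  shows "f \<in> M"
proof -
  have "f \<in> H_space \<alpha>" by (rule H_space_closed[OF f]) (use approx sub_H in blast)
  then have "f \<in> closure_in \<alpha> (H_space \<alpha>) M" using approx by (simp add: closure_in_def)
  then show ?thesis by (simp add: closed)
qed

text \<open>A function and its a.e. modifications are at distance 0, so a closed subspace contains
  all representatives of its elements.\<close>

lemma M_AE_eq:
  assumes "g \<in> M" "f \<in> L_space \<alpha>" "AE z in circle. f z = g z"
  shows "f \<in> M"
proof (rule M_closed[OF assms(2)])
  fix e :: real assume "e > 0"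
  have "\<beta> (\<lambda>z. f z - g z) \<le> \<beta> (\<lambda>z. 0)"
    by (rule ext_norm_mono) (use assms(3) in eventually_elim, simp)
  then have "\<beta> (\<lambda>z. f z - g z) < ennreal e" using \<open>e > 0\<close> by (simp add: ext_norm_zero)
  then show "\<exists>g\<in>M. \<beta> (\<lambda>z. f z - g z) < ennreal e" using assms(1) by blast
qed

lemma M_mult_poly: "f \<in> M \<Longrightarrow> (\<lambda>z. poly p z * f z) \<in> M"
proof (induction p)
  case 0
  then show ?case using M_cmult[of f 0] by simp
next
  case (pCons a p)
  from M_add[OF M_cmult[OF pCons.prems, of a] invariant[OF pCons.IH[OF pCons.prems]]]
  show ?case by (simp add: algebra_simps)
qed

lemma M_mult_bounded_poly_limit:
  assumes f: "f \<in> M" and g: "bounded_poly_limit g"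
  shows "(\<lambda>z. g z * f z) \<in> M"
proof (rule M_closed)
  show "(\<lambda>z. g z * f z) \<in> L_space \<alpha>"
    by (rule L_space_mult_bounded[OF M_L_space[OF f] bounded_poly_limit_Linf[OF g]])
  show "\<exists>h\<in>M. \<beta> (\<lambda>z. g z * f z - h z) < ennreal e" if e: "e > 0" for e
  proof -
    from mult_bounded_poly_limit_approx[OF M_L_space[OF f] g e]
    obtain p where "\<beta> (\<lambda>z. g z * f z - poly p z * f z) < ennreal e" ..
    then show ?thesis by (rule bexI[where x = "\<lambda>z. poly p z * f z"]) (rule M_mult_poly[OF f])
  qed
qed

text \<open>The multipliers are exposed, and not just the bounded approximants, because their a.e.
  nonvanishing is needed to produce a nonzero bounded element from a nonzero element of
  \<open>M\<close>.\<close>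

lemma Linf_dense_in_M:
  assumes f: "f \<in> M"
  obtains g :: "nat \<Rightarrow> complex \<Rightarrow> complex"
  where "\<And>n. bounded_poly_limit (g n)" "\<And>n. AE z in circle. g n z \<noteq> 0"
    "\<And>n. (\<lambda>z. g n z * f z) \<in> M \<inter> Linf"
    "\<And>e. e > 0 \<Longrightarrow> \<exists>n. \<beta> (\<lambda>z. f z - g n z * f z) < ennreal e"
proof -
  note fL = M_L_space[OF f]
  note [measurable] = M_measurable[OF f]
  define u where "u n z = inverse (real (Suc n)) * sqrt (norm (f z))" for n z
  have lim: "(\<lambda>n. sqn circle (\<lambda>z. complex_of_real (u n z))) \<longlonglongrightarrow> 0"
  proof -
    have "sqn circle (\<lambda>z. complex_of_real (u n z)) = (inverse (real (Suc n)))\<^sup>2 * (LINT z|circle. norm (f z))" for n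
      unfolding sqn_def norm_of_real power2_abs by (simp add: u_def power_mult_distrib)
    moreover have "(\<lambda>n. (inverse (real (Suc n)))\<^sup>2 * (LINT z|circle. norm (f z))) \<longlonglongrightarrow> 0\<^sup>2 * (LINT z|circle. norm (f z))"
      by (intro tendsto_intros LIMSEQ_inverse_real_of_nat)
    ultimately show ?thesis by simp
  qed
  obtain g r where g: "\<And>n. bounded_poly_limit (g n)" "\<And>n. AE z in circle. norm (g n z) = exp (- u n z)"
    and r: "strict_mono r" "AE z in circle. (\<lambda>n. g (r n) z) \<longlonglongrightarrow> 1"
  proof (rule outer_multipliers[OF _ _ lim])
    show "(\<lambda>z. complex_of_real (u n z)) \<in> L2 circle" for n
      unfolding u_def by (rule L_space_imp_sqrt_L2[OF fL])
    show "AE z in circle. u n z \<ge> 0" for n by (simp add: u_def)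
  qed (rule that)
  have gm: "g n \<in> borel_measurable circle" for n using g(1)[of n] by (simp add: bounded_poly_limit_def)
  show ?thesis
  proof (rule that[of "\<lambda>n. g (r n)"])
    show "bounded_poly_limit (g (r n))" for n by (rule g)
    show "AE z in circle. g (r n) z \<noteq> 0" for n
      using g(2)[of "r n"] by eventually_elim (metis exp_not_eq_zero norm_zero)
    have "AE z in circle. norm (g n z * f z) \<le> 2 / (inverse (real (Suc n)))\<^sup>2" for n
      using g(2)[of n]
    proof eventually_elim
      case (elim z)
      then show ?case using exp_neg_sqrt_mult_le[of "norm (f z)" "inverse (real (Suc n))"]
        by (simp only: norm_mult u_def) simp
    qed
    then have "(\<lambda>z. g n z * f z) \<in> Linf" for n using gm[of n] by (intro LinfI) auto
    then show "(\<lambda>z. g (r n) z * f z) \<in> M \<inter> Linf" for n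
      using M_mult_bounded_poly_limit[OF f g(1)] by blast
    show "\<exists>n. \<beta> (\<lambda>z. f z - g (r n) z * f z) < ennreal e" if e: "e > 0" for e
    proof -
      have "\<exists>n. \<beta> (\<lambda>z. (1 - g (r n) z) * f z) < ennreal e"
      proof (rule ext_norm_dominated_convergence[OF fL _ _ _ e])
        show "(\<lambda>z. 1 - g (r n) z) \<in> borel_measurable circle" for n using gm[of "r n"] by auto
        show "AE z in circle. norm (1 - g (r n) z) \<le> 2" for n
          using g(2)[of "r n"]
        proof eventually_elim
          case (elim z)
          have "norm (g (r n) z) \<le> 1" unfolding elim by (simp add: u_def)
          then show ?case using norm_triangle_ineq4[of 1 "g (r n) z"] by simp
        qed
        show "AE z in circle. (\<lambda>n. 1 - g (r n) z) \<longlonglongrightarrow> 0"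
          using r(2)
        proof eventually_elim
          case (elim z)
          from tendsto_diff[OF tendsto_const[of 1] elim] show ?case by simp
        qed
      qed
      then show ?thesis by (simp add: left_diff_distrib)
    qed
  qed
qed

end

section \<open>Beurling's theorem\<close>

lemma fourier_cmod_sq:
  assumes "f \<in> L2 circle" 
  shows "fourier (\<lambda>z. of_real ((norm (f z))\<^sup>2)) (- int n) = ip circle (\<lambda>z. z ^ n * f z) f"
  unfolding fourier_def ip_def
  by (rule Bochner_Integration.integral_cong[OF refl])
     (simp add: complex_norm_square mult_ac del: of_real_power)

text \<open>The orthogonality relations are the Fourier coefficients of the squared modulus at
  negative frequencies; as that function is real, the positive ones vanish too, and uniqueness
  leaves only the mean.\<close>

lemma cmod_sq_const:
  assumes f: "f \<in> L2 circle" and orth: "\<And>n. n > 0 \<Longrightarrow> ip circle (\<lambda>z. z ^ n * f z) f = 0"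
  shows "AE z in circle. (norm (f z))\<^sup>2 = sqn circle f"
proof -
  let ?g = "\<lambda>z. complex_of_real ((norm (f z))\<^sup>2)"
  have g: "integrable circle ?g" using f by (simp add: L2_def del: of_real_power)
  have neg: "fourier ?g (- int n) = 0" if "n > 0" for n
    using fourier_cmod_sq[OF f, of n] orth[OF that] by simp
  have pos: "fourier ?g (int n) = 0" if "n > 0" for n
    using neg[OF that] fourier_cnj[of ?g "int n"] by (simp del: of_real_power)
  \<comment> \<open>The constant is written as a multiple of \<open>z powi 0\<close> so that the
    rules for monomials apply.\<close>
  have c: "fourier (\<lambda>z. of_real (sqn circle f) * z powi 0) m = (if m = 0 then of_real (sqn circle f) else 0)" for m
    unfolding fourier_cmult fourier_power_int by simp
  have zero: "fourier ?g 0 = of_real (sqn circle f)"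
    by (simp add: fourier_def sqn_def del: of_real_power)
  have "fourier (\<lambda>z. ?g z - of_real (sqn circle f)) m = 0" for m
  proof -
    have "fourier (\<lambda>z. ?g z - of_real (sqn circle f) * z powi 0) m = 0"
    proof (cases m "0::int" rule: linorder_cases)
      case less
      then show ?thesis using neg[of "nat (- m)"] g c[of m]
        by (subst fourier_diff) (auto simp del: of_real_power power_int_0_right simp: integrable_mult_power_int)
    next
      case equal
      then show ?thesis using zero g c[of m]
        by (subst fourier_diff) (auto simp del: of_real_power power_int_0_right simp: integrable_mult_power_int)
    next
      case greater
      then show ?thesis using pos[of "nat m"] g c[of m]
        by (subst fourier_diff) (auto simp del: of_real_power power_int_0_right simp: integrable_mult_power_int)
    qed
    then show ?thesis by simp
  qed
  then have "AE z in circle. ?g z - of_real (sqn circle f) = 0"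
    using g by (intro fourier_unique) (auto simp del: of_real_power)
  then show ?thesis by eventually_elim (simp only: right_minus_eq of_real_eq_iff)
qed

lemma mult_setI:
  "f \<in> borel_measurable circle \<Longrightarrow> h \<in> S \<Longrightarrow> AE z in circle. f z = \<phi> z * h z \<Longrightarrow> f \<in> mult_set \<phi> S"
  unfolding mult_set_def by (intro CollectI conjI bexI[of _ h])

context invariant_subspace
begin

lemma M_Linf_mult_power: "f \<in> M \<inter> Linf \<Longrightarrow> (\<lambda>z. z ^ n * f z) \<in> M \<inter> Linf"
  using M_mult_poly[of f "monom 1 n"] Linf_mult[OF Linf_poly, of f "monom 1 n"] by (simp add: poly_monom)

lemma M_Linf_combination: "f \<in> M \<inter> Linf \<Longrightarrow> g \<in> M \<inter> Linf \<Longrightarrow> (\<lambda>z. f z + c * g z) \<in> M \<inter> Linf"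
  using M_add[OF _ M_cmult] Linf_add[OF _ Linf_cmult] by simp

lemma M_Linf_cmult: "f \<in> M \<inter> Linf \<Longrightarrow> (\<lambda>z. c * f z) \<in> M \<inter> Linf"
  using M_cmult Linf_cmult by simp

text \<open>Let \<open>k\<close> be the least frequency at which some bounded element of
  \<open>M\<close> has a nonzero coefficient. The condition that the \<open>k\<close>-th coefficient
  be 1 is affine, keeps limits away from 0, and is unaffected by adding multiples of
  \<open>z * g\<close>; so these are admissible variations of the minimization problem.\<close>

lemma extremal:
  assumes nonzero: "\<exists>f\<in>M. \<not> (AE z in circle. f z = 0)"
  obtains \<phi> f where "\<phi> \<in> borel_measurable circle" "AE z in circle. norm (\<phi> z) = 1"
    "\<And>n::nat. f n \<in> M \<inter> Linf" "(\<lambda>n. sqn circle (\<lambda>z. f n z - \<phi> z)) \<longlonglongrightarrow> 0"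
    "\<And>g. g \<in> M \<inter> Linf \<Longrightarrow> ip circle \<phi> (\<lambda>z. z * g z) = 0"
proof -
  have L2M: "f \<in> L2 circle" if "f \<in> M \<inter> Linf" for f using that Linf_imp_L2 by blast
  have "\<exists>f\<in>M \<inter> Linf. \<exists>k. fourier f (int k) \<noteq> 0"
  proof -
    obtain f where f: "f \<in> M" "\<not> (AE z in circle. f z = 0)" using nonzero by blast
    obtain g :: "nat \<Rightarrow> complex \<Rightarrow> complex" where g: "\<And>n. AE z in circle. g n z \<noteq> 0"
      "\<And>n. (\<lambda>z. g n z * f z) \<in> M \<inter> Linf"
      by (rule Linf_dense_in_M[OF f(1)]) (rule that)
    have "\<not> (AE z in circle. g 0 z * f z = 0)"
    proof
      assume "AE z in circle. g 0 z * f z = 0"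
      with g(1)[of 0] have "AE z in circle. f z = 0" by eventually_elim simp
      then show False using f(2) by simp
    qed
    then obtain m where m: "fourier (\<lambda>z. g 0 z * f z) m \<noteq> 0"
      using fourier_unique[OF Linf_integrable] g(2) by blast
    moreover have "m \<ge> 0" using m H_space_fourier_neg[of "\<lambda>z. g 0 z * f z" m] g(2)[of 0] sub_H by force
    ultimately have "fourier (\<lambda>z. g 0 z * f z) (int (nat m)) \<noteq> 0" by simp
    then show ?thesis using g(2) by blast
  qed
  then have ex: "\<exists>k. \<exists>f\<in>M \<inter> Linf. fourier f (int k) \<noteq> 0" by blast
  define k where "k = (LEAST k. \<exists>f\<in>M \<inter> Linf. fourier f (int k) \<noteq> 0)"
  obtain f0 where f0: "f0 \<in> M \<inter> Linf" "fourier f0 (int k) \<noteq> 0"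
    using LeastI_ex[OF ex] unfolding k_def by blast
  have low: "fourier f m = 0" if f: "f \<in> M \<inter> Linf" and m: "m < int k" for f m
  proof (cases "m < 0")
    case True
    then show ?thesis using f sub_H H_space_fourier_neg by blast
  next
    case False
    then have "nat m < k" using m by simp
    then have "\<not> (\<exists>f\<in>M \<inter> Linf. fourier f (int (nat m)) \<noteq> 0)" unfolding k_def by (rule not_less_Least)
    then show ?thesis using f False by auto
  qed
  define C where "C = {f \<in> M \<inter> Linf. fourier f (int k) = 1}"
  have "(\<lambda>z. inverse (fourier f0 (int k)) * f0 z) \<in> C"
    unfolding C_def using M_Linf_cmult[OF f0(1)] f0(2) by (simp add: fourier_cmult)
  then have Cne: "C \<noteq> {}" by blast
  have CL2: "f \<in> L2 circle" if "f \<in> C" for f using that L2M by (simp add: C_def)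
  define d where "d = Inf (sqn circle ` C)"
  have bdd: "bdd_below (sqn circle ` C)" by (rule bdd_belowI[of _ 0]) auto
  have d_le: "d \<le> sqn circle f" if "f \<in> C" for f
    unfolding d_def using that by (intro cInf_lower bdd) auto
  have "\<exists>f\<in>C. sqn circle f < d + inverse (real (Suc n))" for n
    using cInf_lessD[of "sqn circle ` C" "d + inverse (real (Suc n))"] Cne by (auto simp: d_def)
  then obtain f where f: "\<And>n. f n \<in> C" "\<And>n. sqn circle (f n) < d + inverse (real (Suc n))" by metis
  have fM: "f n \<in> M \<inter> Linf" for n using f(1)[of n] by (simp add: C_def)
  note fL2 = CL2[OF f(1)]
  have diff: "sqn circle (\<lambda>z. f i z - f j z) \<le> 2 * inverse (real (Suc i)) + 2 * inverse (real (Suc j))" for i j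
  proof -
    \<comment> \<open>The midpoint again belongs to the convex set \<open>C\<close>, so its square
      norm is at least \<open>d\<close>; the parallelogram law then forces near-minimizers to be
      close.\<close>
    let ?m = "\<lambda>z. (1/2) * (f i z + f j z)"
    have "(\<lambda>z. f i z + 1 * f j z) \<in> M \<inter> Linf" by (rule M_Linf_combination[OF fM fM])
    then have "?m \<in> M \<inter> Linf" by (intro M_Linf_cmult) simp
    moreover have "fourier ?m (int k) = 1"
      using f(1)[of i] f(1)[of j] circle.L2_integrable[OF fL2[of i]] circle.L2_integrable[OF fL2[of j]]
      unfolding fourier_cmult by (simp add: fourier_add C_def)
    ultimately have "d \<le> sqn circle ?m" by (intro d_le) (simp add: C_def)
    then have "4 * d \<le> sqn circle (\<lambda>z. f i z + f j z)"
      unfolding sqn_cmult by (simp add: norm_divide power_divide)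
    then show ?thesis using sqn_parallelogram[OF fL2 fL2, of i j] f(2)[of i] f(2)[of j] by linarith
  qed
  have Cauchy: "\<exists>N. \<forall>i\<ge>N. \<forall>j\<ge>N. sqn circle (\<lambda>z. f i z - f j z) < e" if e: "e > 0" for e
  proof -
    obtain N where N: "inverse (real (Suc N)) < e / 4"
      using reals_Archimedean[of "e / 4"] e by auto
    have inv: "inverse (real (Suc i)) < e / 4" if "i \<ge> N" for i
      using N that by (intro le_less_trans[OF _ N]) (simp add: le_imp_inverse_le)
    have "sqn circle (\<lambda>z. f i z - f j z) < e" if "i \<ge> N" "j \<ge> N" for i j
      using diff[of i j] inv[OF that(1)] inv[OF that(2)] by linarith
    then show ?thesis by blast
  qed
  obtain \<psi> where \<psi>: "\<psi> \<in> L2 circle" and lim: "(\<lambda>n. sqn circle (\<lambda>z. f n z - \<psi> z)) \<longlonglongrightarrow> 0"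
    by (rule circle.L2_complete[OF fL2 Cauchy])
  define s where "s = sqn circle \<psi>"
  have "(\<lambda>n. fourier (f n) (int k)) \<longlonglongrightarrow> fourier \<psi> (int k)"
    using ip_tendsto[OF fL2 \<psi> lim L2_power_int] by (simp add: fourier_eq_ip[symmetric])
  moreover have "fourier (f n) (int k) = 1" for n using f(1)[of n] by (simp add: C_def)
  ultimately have "fourier \<psi> (int k) = 1" by (simp add: LIMSEQ_const_iff)
  then have s: "s > 0" using Bessel[of "{int k}" \<psi>] \<psi> by (simp add: s_def)
  have sd: "s \<le> d"
  proof -
    have "(\<lambda>n. d + inverse (real (Suc n))) \<longlonglongrightarrow> d + 0"
      by (intro tendsto_intros LIMSEQ_inverse_real_of_nat)
    with sqn_tendsto[OF fL2 \<psi> lim] have "s \<le> d + 0"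
      unfolding s_def by (rule LIMSEQ_le) (use f(2) in \<open>auto intro: less_imp_le\<close>)
    then show ?thesis by simp
  qed
  \<comment> \<open>The limit \<open>\<psi>\<close> is not known to lie in \<open>M\<close>, so the
    competitor is formed from \<open>f n\<close>, where membership in \<open>C\<close> is clear, and
    \<open>n\<close> tends to infinity.\<close>
  have orth: "ip circle \<psi> (\<lambda>z. z * g z) = 0" if g: "g \<in> M \<inter> Linf" for g
  proof (rule ip_eq_0_of_minimal[OF \<psi>])
    have h: "(\<lambda>z. z * g z) \<in> M \<inter> Linf" using M_Linf_mult_power[OF g, of 1] by simp
    show hL: "(\<lambda>z. z * g z) \<in> L2 circle" by (rule L2M[OF h])
    \<comment> \<open>The \<open>k\<close>-th coefficient of \<open>z * g\<close> is the one of
      \<open>g\<close> at \<open>k - 1\<close>, below the minimal frequency.\<close>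
    have h0: "fourier (\<lambda>z. z * g z) (int k) = 0"
      using low[OF g, of "int k - 1"] fourier_mult_power_int[of g 1 "int k"] by (simp add: mult.commute)
    fix c
    have "(\<lambda>z. f n z + c * (z * g z)) \<in> C" for n
      using M_Linf_combination[OF fM h] f(1)[of n] circle.L2_integrable[OF fL2[of n]] circle.L2_integrable[OF hL]
      by (simp add: C_def fourier_add fourier_cmult h0)
    then have le: "d \<le> sqn circle (\<lambda>z. f n z + c * (z * g z))" for n by (rule d_le)
    have "(\<lambda>n. sqn circle (\<lambda>z. f n z + c * (z * g z))) \<longlonglongrightarrow> sqn circle (\<lambda>z. \<psi> z + c * (z * g z))"
      by (rule sqn_tendsto) (use lim in \<open>auto intro!: L2_add L2_cmult fL2 \<psi> hL\<close>)
    then have "d \<le> sqn circle (\<lambda>z. \<psi> z + c * (z * g z))"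
      by (rule LIMSEQ_le_const) (use le in blast)
    then show "sqn circle \<psi> \<le> sqn circle (\<lambda>z. \<psi> z + c * (z * g z))" using sd by (simp add: s_def)
  qed
  \<comment> \<open>The orthogonality applies to \<open>z * g\<close> with \<open>g\<close> bounded
    in \<open>M\<close>. It is used for \<open>z ^ (n - 1) * f j\<close> and carried over to
    \<open>\<psi>\<close> by letting \<open>j\<close> tend to infinity.\<close>
  have "ip circle (\<lambda>z. z ^ n * \<psi> z) \<psi> = 0" if n: "n > 0" for n
  proof -
    have mult: "(\<lambda>z. z ^ n * h z) \<in> L2 circle" if "h \<in> L2 circle" for h
      by (rule L2_mult_bounded[OF that, where C = 1]) (auto simp: norm_power)
    have z: "ip circle (\<lambda>z. z ^ n * f j z) \<psi> = 0" for j
    proof -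
      have eq: "(\<lambda>z. z ^ n * f j z) = (\<lambda>z. z * (z ^ (n - 1) * f j z))"
        using n by (simp add: fun_eq_iff power_eq_if)
      have "ip circle \<psi> (\<lambda>z. z ^ n * f j z) = 0"
        unfolding eq by (rule orth[OF M_Linf_mult_power[OF fM]])
      then show ?thesis using ip_cnj[of circle \<psi> "\<lambda>z. z ^ n * f j z"] by simp
    qed
    have "sqn circle (\<lambda>z. z ^ n * f j z - z ^ n * \<psi> z) = sqn circle (\<lambda>z. f j z - \<psi> z)" for j
      unfolding sqn_def by (rule Bochner_Integration.integral_cong[OF refl])
        (simp add: right_diff_distrib[symmetric] norm_mult norm_power)
    with lim have "(\<lambda>j. sqn circle (\<lambda>z. z ^ n * f j z - z ^ n * \<psi> z)) \<longlonglongrightarrow> 0" by simp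
    from ip_tendsto[OF mult[OF fL2] mult[OF \<psi>] this \<psi>] show ?thesis by (simp add: z LIMSEQ_const_iff)
  qed
  then have mod: "AE z in circle. (norm (\<psi> z))\<^sup>2 = s" unfolding s_def by (rule cmod_sq_const[OF \<psi>])
  \<comment> \<open>The modulus of \<open>\<psi>\<close> is a.e. the constant \<open>sqrt s\<close>,
    positive because the \<open>k\<close>-th coefficient of \<open>\<psi>\<close> is 1.\<close>
  let ?c = "complex_of_real (1 / sqrt s)"
  show ?thesis
  proof (rule that[of "\<lambda>z. ?c * \<psi> z" "\<lambda>n z. ?c * f n z"])
    show "(\<lambda>z. ?c * \<psi> z) \<in> borel_measurable circle" by (rule L2_measurable[OF L2_cmult[OF \<psi>]])
    show "AE z in circle. norm (?c * \<psi> z) = 1"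
      using mod
    proof eventually_elim
      case (elim z)
      then have "norm (\<psi> z) = sqrt s" by (metis norm_ge_zero real_sqrt_unique)
      then show ?case using s by (simp add: norm_mult norm_divide)
    qed
    show "(\<lambda>z. ?c * f n z) \<in> M \<inter> Linf" for n by (rule M_Linf_cmult[OF fM])
    have "(\<lambda>n. (norm ?c)\<^sup>2 * sqn circle (\<lambda>z. f n z - \<psi> z)) \<longlonglongrightarrow> (norm ?c)\<^sup>2 * 0"
      by (intro tendsto_intros lim)
    then show "(\<lambda>n. sqn circle (\<lambda>z. ?c * f n z - ?c * \<psi> z)) \<longlonglongrightarrow> 0"
      unfolding right_diff_distrib[symmetric] sqn_cmult by simp
    show "ip circle (\<lambda>z. ?c * \<psi> z) (\<lambda>z. z * g z) = 0" if "g \<in> M \<inter> Linf" for g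
      unfolding ip_cmult_left orth[OF that] by simp
  qed
qed

text \<open>L^2 convergence says nothing about \<open>\<alpha>\<close>, so the approximants are
  first made uniformly bounded. As \<open>\<phi>\<close> is unimodular, the excess \<open>u\<close>
  of the modulus over 1 is at most \<open>\<bar>f - \<phi>\<bar>\<close>, hence tends to 0 in L^2,
  and \<open>(1 + u) * exp (- u) \<le> 1\<close> bounds the damped functions.\<close>

lemma unimodular_L2_limit_in_M:
  assumes \<phi>: "\<phi> \<in> borel_measurable circle" "AE z in circle. norm (\<phi> z) = 1"
    and f: "\<And>n::nat. f n \<in> M \<inter> Linf" and lim: "(\<lambda>n. sqn circle (\<lambda>z. f n z - \<phi> z)) \<longlonglongrightarrow> 0"
  shows "\<phi> \<in> M"
proof -
  have fL2: "f n \<in> L2 circle" for n using f Linf_imp_L2 by blast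
  have \<phi>Linf: "\<phi> \<in> Linf" using \<phi>(2) by (intro LinfI[OF \<phi>(1), where C = 1]) (auto elim: eventually_mono)
  note \<phi>L2 = Linf_imp_L2[OF \<phi>Linf]
  obtain r where r: "strict_mono r" "AE z in circle. (\<lambda>n. f (r n) z) \<longlonglongrightarrow> \<phi> z"
    by (rule circle.AE_subseq_of_sqn[OF fL2 \<phi>L2 lim])
  define u where "u n z = max 0 (norm (f (r n) z) - 1)" for n z
  have fm [measurable]: "f n \<in> borel_measurable circle" for n using fL2 by (rule L2_measurable)
  have um: "(\<lambda>z. complex_of_real (u n z)) \<in> borel_measurable circle" for n
    unfolding u_def by measurable
  have ule: "AE z in circle. norm (complex_of_real (u n z)) \<le> norm (f (r n) z - \<phi> z)" for n
    using \<phi>(2)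
  proof eventually_elim
    case (elim z)
    have "norm (f (r n) z) \<le> norm (f (r n) z - \<phi> z) + norm (\<phi> z)"
      by (metis add.commute norm_triangle_sub)
    then show ?case using elim by (simp add: u_def)
  qed
  note uL2 = sqn_mono(2)[OF um L2_diff[OF fL2 \<phi>L2] ule]
  note usqn = sqn_mono(1)[OF um L2_diff[OF fL2 \<phi>L2] ule]
  have ulim: "(\<lambda>n. sqn circle (\<lambda>z. complex_of_real (u n z))) \<longlonglongrightarrow> 0"
  proof (rule tendsto_sandwich[OF _ _ tendsto_const])
    show "(\<lambda>n. sqn circle (\<lambda>z. f (r n) z - \<phi> z)) \<longlonglongrightarrow> 0"
      using LIMSEQ_subseq_LIMSEQ[OF lim r(1)] by (simp add: o_def)
  qed (use usqn in auto)
  obtain g r' where g: "\<And>n. bounded_poly_limit (g n)" "\<And>n. AE z in circle. norm (g n z) = exp (- u n z)"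
    and r': "strict_mono r'" "AE z in circle. (\<lambda>n. g (r' n) z) \<longlonglongrightarrow> 1"
  proof (rule outer_multipliers[OF uL2 _ ulim])
    show "AE z in circle. u n z \<ge> 0" for n by (simp add: u_def)
  qed (rule that)
  \<comment> \<open>The multiplier \<open>g (r' n)\<close> is built from \<open>u (r' n)\<close>,
    which measures the excess of \<open>f (r (r' n))\<close>; the indices must match for the bound
    by 1.\<close>
  define h where "h n z = g (r' n) z * f (r (r' n)) z" for n z
  have hM: "h n \<in> M" for n
    unfolding h_def [abs_def] using M_mult_bounded_poly_limit[OF _ g(1)] f by blast
  have hbd: "AE z in circle. norm (h n z) \<le> 1" for n
    using g(2)[of "r' n"]
  proof eventually_elim
    case (elim z)
    let ?x = "norm (f (r (r' n)) z)"
    have "?x \<le> 1 + u (r' n) z" by (simp add: u_def)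
    also have "\<dots> \<le> exp (u (r' n) z)" by (rule exp_ge_add_one_self)
    finally show ?case unfolding h_def norm_mult elim by (simp add: exp_minus field_simps)
  qed
  have hlim: "AE z in circle. (\<lambda>n. h n z) \<longlonglongrightarrow> \<phi> z"
    using r(2) r'(2)
  proof eventually_elim
    case (elim z)
    from tendsto_mult[OF elim(2) LIMSEQ_subseq_LIMSEQ[OF elim(1) r'(1)]]
    show ?case by (simp add: h_def o_def)
  qed
  show ?thesis
  proof (rule M_closed[OF Linf_subset_L_space[OF \<phi>Linf]])
    fix e :: real assume e: "e > 0"
    \<comment> \<open>The factor \<open>poly 1\<close> supplies the fixed element of
      \<open>L_space \<alpha>\<close> that dominated convergence requires.\<close>
    have "\<exists>n. \<beta> (\<lambda>z. (\<phi> z - h n z) * poly 1 z) < ennreal e"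
    proof (rule ext_norm_dominated_convergence[OF Linf_subset_L_space[OF Linf_poly] _ _ _ e])
      show "(\<lambda>z. \<phi> z - h n z) \<in> borel_measurable circle" for n using M_measurable[OF hM] \<phi>(1) by simp
      show "AE z in circle. norm (\<phi> z - h n z) \<le> 2" for n
        using \<phi>(2) hbd[of n]
      proof eventually_elim
        case (elim z)
        then show ?case using norm_triangle_ineq4[of "\<phi> z" "h n z"] by simp
      qed
      show "AE z in circle. (\<lambda>n. \<phi> z - h n z) \<longlonglongrightarrow> 0"
        using hlim
      proof eventually_elim
        case (elim z)
        from tendsto_diff[OF tendsto_const[of "\<phi> z"] elim] show ?case by simp
      qed
    qed
    then show "\<exists>g\<in>M. \<beta> (\<lambda>z. \<phi> z - g z) < ennreal e" using hM by auto
  qed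
qed

text \<open>\<open>\<phi> * h\<close> is a limit of \<open>\<phi>\<close> times polynomials, which
  belong to \<open>M\<close>; \<open>M_AE_eq\<close> then covers every representative.\<close>

lemma mult_set_subset_M:
  assumes \<phi>: "\<phi> \<in> M" "\<phi> \<in> Linf"
  shows "mult_set \<phi> (H_space \<alpha>) \<subseteq> M"
proof
  fix f assume "f \<in> mult_set \<phi> (H_space \<alpha>)"
  then obtain h where fm: "f \<in> borel_measurable circle" and h: "h \<in> H_space \<alpha>" and eq: "AE z in circle. f z = \<phi> z * h z"
    by (auto simp: mult_set_def)
  note hL = H_space_imp_L_space[OF h]
  note phL = L_space_mult_bounded[OF hL \<phi>(2)]
  have "(\<lambda>z. \<phi> z * h z) \<in> M"
  proof (rule M_closed[OF phL])
    fix e :: real assume e: "e > 0"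
    obtain C where C: "C > 0" "AE z in circle. norm (\<phi> z) \<le> C" using \<phi>(2) by (rule LinfE)
    have "e / C > 0" using C e by simp
    from H_space_approx[OF h this] obtain p where p: "\<beta> (\<lambda>z. h z - poly p z) < ennreal (e / C)" ..
    have "\<beta> (\<lambda>z. \<phi> z * (h z - poly p z)) < ennreal e"
      by (rule ext_norm_mult_bounded_lt[OF p C(2,1) e])
    then have "\<beta> (\<lambda>z. \<phi> z * h z - poly p z * \<phi> z) < ennreal e"
      by (simp add: algebra_simps)
    then show "\<exists>g\<in>M. \<beta> (\<lambda>z. \<phi> z * h z - g z) < ennreal e"
      by (rule bexI[where x = "\<lambda>z. poly p z * \<phi> z"]) (rule M_mult_poly[OF \<phi>(1)])
  qed
  then show "f \<in> M" by (rule M_AE_eq[OF _ L_space_AE_eq[OF phL fm eq] eq])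
qed

text \<open>The only candidate cofactor of \<open>f\<close> is \<open>cnj \<phi> * f\<close>. For
  bounded elements the orthogonality relations put it in \<open>Hinf\<close>; since multiplication
  by \<open>cnj \<phi>\<close> does not increase \<open>\<beta>\<close>, density extends this to all
  of \<open>M\<close>.\<close>

lemma M_subset_mult_set:
  assumes \<phi>: "\<phi> \<in> borel_measurable circle" "AE z in circle. norm (\<phi> z) = 1"
    and orth: "\<And>g. g \<in> M \<inter> Linf \<Longrightarrow> ip circle \<phi> (\<lambda>z. z * g z) = 0"
  shows "M \<subseteq> mult_set \<phi> (H_space \<alpha>)"
proof
  fix f assume f: "f \<in> M"
  have \<phi>c: "(\<lambda>z. cnj (\<phi> z)) \<in> Linf"
    using \<phi>(2) by (intro LinfI[where C = 1] borel_measurable_cnj \<phi>(1)) (auto elim: eventually_mono)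
  have bounded: "(\<lambda>z. cnj (\<phi> z) * g z) \<in> H_space \<alpha>" if g: "g \<in> M \<inter> Linf" for g
  proof (rule Hinf_subset_H_space)
    have "fourier (\<lambda>z. cnj (\<phi> z) * g z) m = 0" if m: "m < 0" for m
    proof -
      \<comment> \<open>One factor \<open>z\<close> is split off \<open>z powi (- m)\<close>,
        because orthogonality is available only against \<open>z\<close> times an element of
        \<open>M \<inter> Linf\<close>.\<close>
      define n where "n = nat (- m) - 1"
      have mn: "- m = int (Suc n)" using m by (simp add: n_def)
      have "fourier (\<lambda>z. cnj (\<phi> z) * g z) m = ip circle (\<lambda>z. z * (z ^ n * g z)) \<phi>"
        unfolding fourier_def ip_def mn by (simp add: mult_ac del: of_nat_Suc)
      also have "\<dots> = cnj (ip circle \<phi> (\<lambda>z. z * (z ^ n * g z)))" by (simp add: ip_cnj)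
      also have "\<dots> = 0" by (simp add: orth[OF M_Linf_mult_power[OF g]])
      finally show ?thesis .
    qed
    then show "(\<lambda>z. cnj (\<phi> z) * g z) \<in> Hinf"
      using Linf_mult[OF \<phi>c] g by (simp add: Hinf_def fourier_def)
  qed
  have h: "(\<lambda>z. cnj (\<phi> z) * f z) \<in> H_space \<alpha>"
  proof (rule H_space_closed[OF L_space_mult_bounded[OF M_L_space[OF f] \<phi>c]])
    fix e :: real assume e: "e > 0"
    obtain g :: "nat \<Rightarrow> complex \<Rightarrow> complex" where g: "\<And>n. (\<lambda>z. g n z * f z) \<in> M \<inter> Linf"
      "\<And>e. e > 0 \<Longrightarrow> \<exists>n. \<beta> (\<lambda>z. f z - g n z * f z) < ennreal e"
      by (rule Linf_dense_in_M[OF f]) (rule that)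
    obtain n where n: "\<beta> (\<lambda>z. f z - g n z * f z) < ennreal e" using g(2)[OF e] ..
    have "\<beta> (\<lambda>z. cnj (\<phi> z) * f z - cnj (\<phi> z) * (g n z * f z)) \<le> \<beta> (\<lambda>z. f z - g n z * f z)"
    proof (rule ext_norm_mono)
      show "AE z in circle. norm (cnj (\<phi> z) * f z - cnj (\<phi> z) * (g n z * f z)) \<le> norm (f z - g n z * f z)"
        using \<phi>(2) by eventually_elim (simp add: right_diff_distrib[symmetric] norm_mult)
    qed
    then have "\<beta> (\<lambda>z. cnj (\<phi> z) * f z - cnj (\<phi> z) * (g n z * f z)) < ennreal e" using n by (rule le_less_trans)
    then show "\<exists>h\<in>H_space \<alpha>. \<beta> (\<lambda>z. cnj (\<phi> z) * f z - h z) < ennreal e"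
      by (rule bexI[where x = "\<lambda>z. cnj (\<phi> z) * (g n z * f z)"]) (rule bounded[OF g(1)])
  qed
  have "AE z in circle. f z = \<phi> z * (cnj (\<phi> z) * f z)"
    using \<phi>(2)
  proof eventually_elim
    case (elim z)
    then have "\<phi> z * cnj (\<phi> z) = 1" using complex_norm_square[of "\<phi> z"] by simp
    then show ?case by (simp add: mult.assoc[symmetric])
  qed
  then show "f \<in> mult_set \<phi> (H_space \<alpha>)"
    by (rule mult_setI[OF M_measurable[OF f] h])
qed

lemma Beurling:
  assumes "\<exists>f\<in>M. \<not> (AE z in circle. f z = 0)"
  shows "\<exists>\<phi>. inner_function \<phi> \<and> M = mult_set \<phi> (H_space \<alpha>)"
proof -
  obtain \<phi> f where \<phi>: "\<phi> \<in> borel_measurable circle" "AE z in circle. norm (\<phi> z) = 1"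
    and f: "\<And>n::nat. f n \<in> M \<inter> Linf" "(\<lambda>n. sqn circle (\<lambda>z. f n z - \<phi> z)) \<longlonglongrightarrow> 0"
    and orth: "\<And>g. g \<in> M \<inter> Linf \<Longrightarrow> ip circle \<phi> (\<lambda>z. z * g z) = 0"
    by (rule extremal[OF assms]) (rule that)
  have \<phi>M: "\<phi> \<in> M" by (rule unimodular_L2_limit_in_M[OF \<phi> f])
  have \<phi>Linf: "\<phi> \<in> Linf" using \<phi>(2) by (intro LinfI[OF \<phi>(1), where C = 1]) (auto elim: eventually_mono)
  have "inner_function \<phi>"
    unfolding inner_function_def using Linf_H_space_imp_Hinf[OF \<phi>Linf] sub_H \<phi>M \<phi>(2) by blast
  moreover have "M = mult_set \<phi> (H_space \<alpha>)"
    using mult_set_subset_M[OF \<phi>M \<phi>Linf] M_subset_mult_set[OF \<phi> orth] by blast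
  ultimately show ?thesis by blast
qed

end

theorem theorem7p8:
  fixes \<alpha> :: "(complex \<Rightarrow> complex) \<Rightarrow> real" and M :: "(complex \<Rightarrow> complex) set"
  assumes "continuous_rotationally_symmetric_norm \<alpha>"
    and "M \<subseteq> H_space \<alpha>"
    and "cfun.subspace M"
    and "closure_in \<alpha> (H_space \<alpha>) M = M"
    and "\<exists>f\<in>M. \<not> (AE z in circle. f z = 0)"
  shows "(\<forall>f\<in>M. (\<lambda>z. z * f z) \<in> M) \<longleftrightarrow>
    (\<exists>\<phi>. inner_function \<phi> \<and> M = mult_set \<phi> (H_space \<alpha>))"
proof
  interpret continuous_rotationally_symmetric_norm \<alpha> by fact
  assume "\<forall>f\<in>M. (\<lambda>z. z * f z) \<in> M"
  then interpret invariant_subspace \<alpha> M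
    using assms by unfold_locales auto
  show "\<exists>\<phi>. inner_function \<phi> \<and> M = mult_set \<phi> (H_space \<alpha>)"
    by (rule Beurling) fact
next
  interpret continuous_rotationally_symmetric_norm \<alpha> by fact
  assume "\<exists>\<phi>. inner_function \<phi> \<and> M = mult_set \<phi> (H_space \<alpha>)"
  then obtain \<phi> where M: "M = mult_set \<phi> (H_space \<alpha>)" by blast
  \<comment> \<open>Since \<open>mult_set\<close> contains all measurable representatives, it
    suffices that \<open>z * f\<close> agrees a.e. with \<open>\<phi> * (z * h)\<close>.\<close>
  show "\<forall>f\<in>M. (\<lambda>z. z * f z) \<in> M"
  proof
    fix f assume "f \<in> M"
    then obtain h where f: "f \<in> borel_measurable circle" and h: "h \<in> H_space \<alpha>"
      and eq: "AE z in circle. f z = \<phi> z * h z"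
      by (auto simp: M mult_set_def)
    have "(\<lambda>z. z * h z) \<in> H_space \<alpha>" using H_space_mult_poly[OF h, of "[:0, 1:]"] by simp
    moreover have "AE z in circle. z * f z = \<phi> z * (z * h z)" using eq by eventually_elim simp
    moreover have "(\<lambda>z. z * f z) \<in> borel_measurable circle" using f by measurable
    ultimately show "(\<lambda>z. z * f z) \<in> M" unfolding M by (intro mult_setI)
  qed
qed

end
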